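(* The following Kronecker-separable approximation problem is NP-hard. Given integers $d_1 \geq d_2 \geq 2$ and a positive semidefinite operator $\Sigma$ on $\mathcal{H} = \mathbb{C}^{d_1} \otimes \mathbb{C}^{d_2}$, compute (to any prescribed precision) the best Kronecker-separable approximation $$\pi_{\mathrm{sep}}(\Sigma) = \operatorname*{arg\,min}_{\Sigma' \in \mathcal{B}^{\mathrm{sep}}_+(\mathcal{H})} \|\Sigma' - \Sigma\|^2,$$ where $\|\cdot\|$ is the Hilbert–Schmidt norm and $\mathcal{B}^{\mathrm{sep}}_+(\mathcal{H})$ is the closed convex cone of Kronecker-separable operators on $\mathcal{H}$.
   Context: A positive semidefinite (PSD) operator $\Sigma'$ on $\mathbb{C}^{d_1}\otimes\mathbb{C}^{d_2}$ is Kronecker-separable if there exist an integer $r\ge 1$ and PSD operators $\Sigma^{(1)}_a$ on $\mathbb{C}^{d_1}$ and $\Sigma^{(2)}_a$ on $\mathbb{C}^{d_2}$ ($1\le a\le r$) such that $\Sigma' = \sum_{a=1}^r \Sigma^{(1)}_a \otimes \Sigma^{(2)}_a$. The minimizer $\pi_{\mathrm{sep}}(\Sigma)$ exists and is unique. Computational conventions: $d_1,d_2$ are part of the input; $\Sigma$ is given as a Hermitian $d_1d_2\times d_1d_2$ matrix whose entries have rational real and imaginary parts; "to any prescribed precision" means that a rational $\delta>0$ is also given and the task is to output a matrix $\widehat{\Sigma}$ with rational real and imaginary parts such that $\|\widehat{\Sigma} - \pi_{\mathrm{sep}}(\Sigma)\| \le \delta$. A problem is NP-hard if some NP-complete problem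 (complete under polynomial-time Karp reductions) is polynomial-time Turing reducible to it, i.e. can be solved in polynomial time using an oracle for the problem at unit cost (with any valid output of the oracle allowed). The following theorem of Gharibian (2008) is a known result that may be taken as given. Let $\mathcal{K}$ be the set of trace-one Kronecker-separable operators on $\mathbb{C}^{d_1} \otimes \mathbb{C}^{d_2}$, regarded as a convex body in the affine space of trace-one Hermitian operators with the Hilbert–Schmidt norm, let $B(x,\delta)$ denote closed balls in that affine space, $\mathcal{K}_{+\delta} = \bigcup_{x\in\mathcal{K}} B(x,\delta)$ and $\mathcal{K}_{-\delta} = \{x \in \mathcal{K} : B(x,\delta) \subset \mathcal{K}\}$. There is a constant $C>0$ such that, with $d_1\ge d_2\ge 2$ part of the input, the weak membership problem (given a rational point $x$, assert either $x\in\mathcal{K}_{+\delta}$ or $x\notin\mathcal{K}_{-\delta}$, any true assertion being valid) is NP-hard for all $\delta \le C\, d_1^{-16} d_2^{-20.5}$. *)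

theory Defs
  imports
    "Jordan_Normal_Form.Schur_Decomposition"
    "HOL-Library.Log_Nat"
    Complex_Main
begin

section \<open>Machine model\<close>

text \<open>
  Polynomial time is defined through deterministic While programs whose variables hold nested
  lists of integers.  The cost is a bit cost: evaluating an expression is charged the sum of the
  bit lengths of all intermediate results, with integers written in binary.  Every primitive
  operation is computable on a multitape Turing machine in time polynomial in its charge, and a
  Turing machine step can be simulated at a charge polynomial in the size of the configuration.
  Hence the classes of polynomial-time computable functions, P, NP, and polynomial-time Karp and
  Turing reducibility are the usual ones (up to the standard coding of nested lists by bit
  strings).
\<close>

datatype data = Num int | Lst "data list"

fun bits :: "data \<Rightarrow> nat" where
  "bits (Num i) = 1 + nat (bitlen \<bar>i\<bar>)"
| "bits (Lst xs) = 1 + sum_list (map bits xs)"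

definition bool_data :: "bool \<Rightarrow> data" where
  "bool_data b = Num (if b then 1 else 0)"

datatype expr =
    Var nat
  | Const data
  | Head expr
  | Tail expr
  | Cons expr expr
  | IsNum expr
  | Add expr expr
  | Sub expr expr
  | Mul expr expr
  | Quot expr expr
  | Rem expr expr
  | Less expr expr
  | Equal expr expr

type_synonym state = "nat \<Rightarrow> data"

text \<open>Operations are total; on arguments of the wrong shape they return the empty list.\<close>

definition int_op :: "(int \<Rightarrow> int \<Rightarrow> int) \<Rightarrow> data \<Rightarrow> data \<Rightarrow> data" where
  "int_op f a b = (case (a, b) of (Num i, Num j) \<Rightarrow> Num (f i j) | _ \<Rightarrow> Lst [])"

fun eval_expr :: "expr \<Rightarrow> state \<Rightarrow> data" where
  "eval_expr (Var x) s = s x"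
| "eval_expr (Const c) s = c"
| "eval_expr (Head e) s = (case eval_expr e s of Lst (x # xs) \<Rightarrow> x | _ \<Rightarrow> Lst [])"
| "eval_expr (Tail e) s = (case eval_expr e s of Lst (x # xs) \<Rightarrow> Lst xs | _ \<Rightarrow> Lst [])"
| "eval_expr (Cons e e') s =
     (case eval_expr e' s of Lst xs \<Rightarrow> Lst (eval_expr e s # xs) | _ \<Rightarrow> Lst [])"
| "eval_expr (IsNum e) s = bool_data (case eval_expr e s of Num i \<Rightarrow> True | _ \<Rightarrow> False)"
| "eval_expr (Add e e') s = int_op (+) (eval_expr e s) (eval_expr e' s)"
| "eval_expr (Sub e e') s = int_op (-) (eval_expr e s) (eval_expr e' s)"
| "eval_expr (Mul e e') s = int_op (*) (eval_expr e s) (eval_expr e' s)"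
| "eval_expr (Quot e e') s = int_op (div) (eval_expr e s) (eval_expr e' s)"
| "eval_expr (Rem e e') s = int_op (mod) (eval_expr e s) (eval_expr e' s)"
| "eval_expr (Less e e') s =
     int_op (\<lambda>i j. if i < j then 1 else 0) (eval_expr e s) (eval_expr e' s)"
| "eval_expr (Equal e e') s = bool_data (eval_expr e s = eval_expr e' s)"

text \<open>The sum of the bit lengths of the values of all subexpressions.\<close>

fun cost :: "expr \<Rightarrow> state \<Rightarrow> nat" where
  "cost (Var x) s = bits (eval_expr (Var x) s)"
| "cost (Const c) s = bits (eval_expr (Const c) s)"
| "cost (Head e) s = bits (eval_expr (Head e) s) + cost e s"
| "cost (Tail e) s = bits (eval_expr (Tail e) s) + cost e s"
| "cost (IsNum e) s = bits (eval_expr (IsNum e) s) + cost e s"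
| "cost (Cons e e') s = bits (eval_expr (Cons e e') s) + cost e s + cost e' s"
| "cost (Add e e') s = bits (eval_expr (Add e e') s) + cost e s + cost e' s"
| "cost (Sub e e') s = bits (eval_expr (Sub e e') s) + cost e s + cost e' s"
| "cost (Mul e e') s = bits (eval_expr (Mul e e') s) + cost e s + cost e' s"
| "cost (Quot e e') s = bits (eval_expr (Quot e e') s) + cost e s + cost e' s"
| "cost (Rem e e') s = bits (eval_expr (Rem e e') s) + cost e s + cost e' s"
| "cost (Less e e') s = bits (eval_expr (Less e e') s) + cost e s + cost e' s"
| "cost (Equal e e') s = bits (eval_expr (Equal e e') s) + cost e s + cost e' s"

datatype com =
    Skip
  | Assign nat expr
  | Query nat expr
  | Seq com com
  | Cond expr com com
  | While expr com

text \<open>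
  \<open>exec f c s t s'\<close>: with the oracle \<open>f\<close>, program \<open>c\<close> started in \<open>s\<close> halts in \<open>s'\<close> after \<open>t\<close>
  time units.  A query is charged for writing it down, plus one unit; receiving the answer is
  free, but every later use of the answer is charged according to its size.  A test
  succeeds if it evaluates to \<open>Num 1\<close>.
\<close>

inductive exec :: "(data \<Rightarrow> data) \<Rightarrow> com \<Rightarrow> state \<Rightarrow> nat \<Rightarrow> state \<Rightarrow> bool" for f where
  "exec f Skip s 1 s"
| "exec f (Assign x e) s (1 + cost e s) (s(x := eval_expr e s))"
| "exec f (Query x e) s (1 + cost e s) (s(x := f (eval_expr e s)))"
| "exec f c\<^sub>1 s t\<^sub>1 s' \<Longrightarrow> exec f c\<^sub>2 s' t\<^sub>2 s'' \<Longrightarrow> exec f (Seq c\<^sub>1 c\<^sub>2) s (1 + t\<^sub>1 + t\<^sub>2) s''"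
| "eval_expr e s = Num 1 \<Longrightarrow> exec f c\<^sub>1 s t s' \<Longrightarrow> exec f (Cond e c\<^sub>1 c\<^sub>2) s (1 + cost e s + t) s'"
| "eval_expr e s \<noteq> Num 1 \<Longrightarrow> exec f c\<^sub>2 s t s' \<Longrightarrow> exec f (Cond e c\<^sub>1 c\<^sub>2) s (1 + cost e s + t) s'"
| "eval_expr e s \<noteq> Num 1 \<Longrightarrow> exec f (While e c) s (1 + cost e s) s"
| "eval_expr e s = Num 1 \<Longrightarrow> exec f c s t\<^sub>1 s' \<Longrightarrow> exec f (While e c) s' t\<^sub>2 s'' \<Longrightarrow>
     exec f (While e c) s (1 + cost e s + t\<^sub>1 + t\<^sub>2) s''"

inductive_cases exec_SkipE: "exec f Skip s t s'"
inductive_cases exec_AssignE: "exec f (Assign x e) s t s'"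
inductive_cases exec_QueryE: "exec f (Query x e) s t s'"
inductive_cases exec_SeqE: "exec f (Seq c d) s t s'"
inductive_cases exec_CondE: "exec f (Cond e c d) s t s'"
inductive_cases exec_WhileE: "exec f (While e c) s t s'"

lemma exec_deterministic: "exec f c s t s' \<Longrightarrow> exec f c s u r \<Longrightarrow> u = t \<and> r = s'"
proof (induction arbitrary: u r rule: exec.induct)
  case (1 s)
  then show ?case by (auto elim: exec_SkipE)
next
  case (2 x e s)
  then show ?case by (auto elim: exec_AssignE)
next
  case (3 x e s)
  then show ?case by (auto elim: exec_QueryE)
next
  case (4 c\<^sub>1 s t\<^sub>1 s' c\<^sub>2 t\<^sub>2 s'')
  from 4(5) obtain u\<^sub>1 m u\<^sub>2 where
    "u = 1 + u\<^sub>1 + u\<^sub>2" "exec f c\<^sub>1 s u\<^sub>1 m" "exec f c\<^sub>2 m u\<^sub>2 r"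
    by (rule exec_SeqE) simp
  with 4(3,4) show ?case by blast
next
  case (5 e s c\<^sub>1 t s' c\<^sub>2)
  from 5(4) show ?case
    by (rule exec_CondE) (simp_all add: 5(1) 5(3))
next
  case (6 e s c\<^sub>2 t s' c\<^sub>1)
  from 6(4) show ?case
    by (rule exec_CondE) (simp_all add: 6(1) 6(3))
next
  case (7 e s c)
  from 7(2) show ?case
    by (rule exec_WhileE) (simp_all add: 7(1))
next
  case (8 e s c t\<^sub>1 s' t\<^sub>2 s'')
  from 8(6) show ?case
  proof (rule exec_WhileE)
    fix u\<^sub>1 m u\<^sub>2
    assume *: "u = Suc (cost e s + u\<^sub>1 + u\<^sub>2)" "exec f c s u\<^sub>1 m"
      "exec f (While e c) m u\<^sub>2 r"
    from 8(4)[OF *(2)] *(3) have "u\<^sub>1 = t\<^sub>1" "exec f (While e c) s' u\<^sub>2 r"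
      by simp_all
    with 8(5) *(1) show ?case by simp
  qed (simp add: 8(1))
qed

text \<open>Input and output are passed in variable 0; all other variables initially hold the empty list.\<close>

definition runs :: "(data \<Rightarrow> data) \<Rightarrow> com \<Rightarrow> data \<Rightarrow> nat \<Rightarrow> data \<Rightarrow> bool" where
  "runs f c x t y \<longleftrightarrow> (\<exists>s. exec f c ((\<lambda>_. Lst [])(0 := x)) t s \<and> s 0 = y)"

fun query_free :: "com \<Rightarrow> bool" where
  "query_free (Query x e) = False"
| "query_free (Seq c d) = (query_free c \<and> query_free d)"
| "query_free (Cond e c d) = (query_free c \<and> query_free d)"
| "query_free (While e c) = query_free c"
| "query_free _ = True"


section \<open>NP-hardness of search problems\<close>

text \<open>In \<open>runs (\<lambda>_. Lst [])\<close> below the oracle is a dummy: the program makes no queries.\<close>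

definition poly_time :: "(data \<Rightarrow> data) \<Rightarrow> bool" where
  "poly_time F \<longleftrightarrow>
     (\<exists>c. query_free c \<and>
       (\<exists>q :: nat poly. \<forall>x. \<exists>t \<le> poly q (bits x). runs (\<lambda>_. Lst []) c x t (F x)))"

definition in_NP :: "data set \<Rightarrow> bool" where
  "in_NP L \<longleftrightarrow>
     (\<exists>V. poly_time (\<lambda>z. bool_data (z \<in> V)) \<and>
       (\<exists>p :: nat poly. \<forall>x. x \<in> L \<longleftrightarrow> (\<exists>w. bits w \<le> poly p (bits x) \<and> Lst [x, w] \<in> V)))"

definition karp_reducible :: "data set \<Rightarrow> data set \<Rightarrow> bool" where
  "karp_reducible L L' \<longleftrightarrow> (\<exists>F. poly_time F \<and> (\<forall>x. x \<in> L \<longleftrightarrow> F x \<in> L'))"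

definition NP_complete :: "data set \<Rightarrow> bool" where
  "NP_complete L \<longleftrightarrow> in_NP L \<and> (\<forall>L'. in_NP L' \<longrightarrow> karp_reducible L' L)"

text \<open>
  A search problem relates each input to its valid outputs.  Inputs outside the promise are
  related to every output, so that an oracle may answer them arbitrarily.
\<close>

type_synonym search_problem = "data \<Rightarrow> data \<Rightarrow> bool"

definition solves :: "(data \<Rightarrow> data) \<Rightarrow> search_problem \<Rightarrow> bool" where
  "solves f R \<longleftrightarrow> (\<forall>x. R x (f x))"

text \<open>
  One program must decide \<open>L\<close> correctly for every oracle that returns valid outputs.  Since
  valid outputs may be arbitrarily long (for instance fractions that are not in lowest
  terms), and since no machine can read a superpolynomially long answer in polynomial time, the
  polynomial time bound is required for those oracles whose answers have length at most \<open>p\<close> of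
  the length of the query.  Here \<open>p\<close> is an arbitrary polynomial, on which the time bound, but
  not the program, may depend.
\<close>

definition turing_reducible :: "data set \<Rightarrow> search_problem \<Rightarrow> bool" where
  "turing_reducible L R \<longleftrightarrow>
     (\<exists>c. (\<forall>f. solves f R \<longrightarrow> (\<forall>x. \<exists>t. runs f c x t (bool_data (x \<in> L)))) \<and>
          (\<forall>p :: nat poly. \<exists>q :: nat poly.
             \<forall>f. solves f R \<and> (\<forall>z. bits (f z) \<le> poly p (bits z)) \<longrightarrow>
               (\<forall>x. \<exists>t \<le> poly q (bits x). runs f c x t (bool_data (x \<in> L)))))"

definition NP_hard :: "search_problem \<Rightarrow> bool" where
  "NP_hard R \<longleftrightarrow> (\<exists>L. NP_complete L \<and> turing_reducible L R)"


section \<open>Kronecker-separable operators\<close>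

definition mat_trace :: "complex mat \<Rightarrow> complex" where
  "mat_trace A = (\<Sum>i<dim_row A. A $$ (i, i))"

definition hs_norm :: "complex mat \<Rightarrow> real" where
  "hs_norm A = sqrt (Re (mat_trace (mat_adjoint A * A)))"

definition hermitian :: "nat \<Rightarrow> complex mat \<Rightarrow> bool" where
  "hermitian n A \<longleftrightarrow> A \<in> carrier_mat n n \<and> mat_adjoint A = A"

definition psd :: "nat \<Rightarrow> complex mat \<Rightarrow> bool" where
  "psd n A \<longleftrightarrow> hermitian n A \<and> (\<forall>v \<in> carrier_vec n. 0 \<le> Re ((A *\<^sub>v v) \<bullet>c v))"

text \<open>
  Operators on the tensor product of the spaces of dimensions \<open>d\<^sub>1\<close> and \<open>d\<^sub>2\<close> are matrices of
  order \<open>d\<^sub>1 * d\<^sub>2\<close>, in the lexicographically ordered product basis.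
\<close>

definition kron :: "complex mat \<Rightarrow> complex mat \<Rightarrow> complex mat" where
  "kron A B = mat (dim_row A * dim_row B) (dim_col A * dim_col B)
     (\<lambda>(i, j). A $$ (i div dim_row B, j div dim_col B) * B $$ (i mod dim_row B, j mod dim_col B))"

definition mat_sum :: "nat \<Rightarrow> nat \<Rightarrow> (nat \<Rightarrow> complex mat) \<Rightarrow> complex mat" where
  "mat_sum n r M = mat n n (\<lambda>(i, j). \<Sum>a<r. M a $$ (i, j))"

definition sep_cone :: "nat \<Rightarrow> nat \<Rightarrow> complex mat set" where
  "sep_cone d1 d2 = {S. psd (d1 * d2) S \<and>
     (\<exists>r A B. r \<ge> 1 \<and> (\<forall>a<r. psd d1 (A a) \<and> psd d2 (B a)) \<and>
       S = mat_sum (d1 * d2) r (\<lambda>a. kron (A a) (B a)))}"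

definition pi_sep :: "nat \<Rightarrow> nat \<Rightarrow> complex mat \<Rightarrow> complex mat" where
  "pi_sep d1 d2 S = (ARG_MIN (\<lambda>S'. (hs_norm (S' - S))\<^sup>2) S'. S' \<in> sep_cone d1 d2)"


section \<open>The computational problems\<close>

text \<open>
  Rationals are given by an integer numerator and a positive integer denominator, not
  necessarily in lowest terms; matrices are given by rows.
\<close>

definition codes_rat :: "data \<Rightarrow> real \<Rightarrow> bool" where
  "codes_rat v x \<longleftrightarrow> (\<exists>p q. v = Lst [Num p, Num q] \<and> q > 0 \<and> x = of_int p / of_int q)"

definition codes_complex :: "data \<Rightarrow> complex \<Rightarrow> bool" where
  "codes_complex v z \<longleftrightarrow> (\<exists>a b. v = Lst [a, b] \<and> codes_rat a (Re z) \<and> codes_rat b (Im z))"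

definition codes_row :: "data \<Rightarrow> complex list \<Rightarrow> bool" where
  "codes_row v zs \<longleftrightarrow> (\<exists>vs. v = Lst vs \<and> list_all2 codes_complex vs zs)"

definition codes_mat :: "nat \<Rightarrow> data \<Rightarrow> complex mat \<Rightarrow> bool" where
  "codes_mat n v A \<longleftrightarrow> A \<in> carrier_mat n n \<and>
     (\<exists>vs. v = Lst vs \<and> list_all2 codes_row vs (map list_of_vec (rows A)))"

definition sep_approximation :: search_problem where
  "sep_approximation x y \<longleftrightarrow>
     (\<forall>d1 d2 \<delta> S vd vS.
        x = Lst [Num (int d1), Num (int d2), vd, vS] \<and>
        d1 \<ge> d2 \<and> d2 \<ge> 2 \<and> codes_rat vd \<delta> \<and> \<delta> > 0 \<and>
        codes_mat (d1 * d2) vS S \<and> psd (d1 * d2) S \<longrightarrow>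
        (\<exists>T. codes_mat (d1 * d2) y T \<and> hs_norm (T - pi_sep d1 d2 S) \<le> \<delta>))"

definition trace_one_hermitian :: "nat \<Rightarrow> complex mat set" where
  "trace_one_hermitian n = {X. hermitian n X \<and> mat_trace X = 1}"

definition hs_ball :: "nat \<Rightarrow> complex mat \<Rightarrow> real \<Rightarrow> complex mat set" where
  "hs_ball n X \<delta> = {Y \<in> trace_one_hermitian n. hs_norm (Y - X) \<le> \<delta>}"

definition sep_states :: "nat \<Rightarrow> nat \<Rightarrow> complex mat set" where
  "sep_states d1 d2 = {X \<in> sep_cone d1 d2. mat_trace X = 1}"

definition sep_states_plus :: "nat \<Rightarrow> nat \<Rightarrow> real \<Rightarrow> complex mat set" where
  "sep_states_plus d1 d2 \<delta> = (\<Union>X \<in> sep_states d1 d2. hs_ball (d1 * d2) X \<delta>)"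

definition sep_states_minus :: "nat \<Rightarrow> nat \<Rightarrow> real \<Rightarrow> complex mat set" where
  "sep_states_minus d1 d2 \<delta> = {X \<in> sep_states d1 d2. hs_ball (d1 * d2) X \<delta> \<subseteq> sep_states d1 d2}"

text \<open>
  The precision is not part of the input; it is a parameter of the problem that depends on
  the dimensions.  Output \<open>Num 1\<close> asserts membership in the enlarged set, \<open>Num 0\<close> asserts
  non-membership in the shrunken set.
\<close>

definition weak_membership :: "(nat \<Rightarrow> nat \<Rightarrow> real) \<Rightarrow> search_problem" where
  "weak_membership \<delta> x y \<longleftrightarrow>
     (\<forall>d1 d2 X vX.
        x = Lst [Num (int d1), Num (int d2), vX] \<and> d1 \<ge> d2 \<and> d2 \<ge> 2 \<and>
        codes_mat (d1 * d2) vX X \<and> X \<in> trace_one_hermitian (d1 * d2) \<longrightarrow>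
        y = Num 1 \<and> X \<in> sep_states_plus d1 d2 (\<delta> d1 d2) \<or>
        y = Num 0 \<and> X \<notin> sep_states_minus d1 d2 (\<delta> d1 d2))"

end

theory Submission
  imports Defs "HOL-Analysis.Function_Topology"
begin

text \<open>
  Weak membership in the set of separable states, with tolerance of order \<open>1 / n\<^sup>2\<^sup>1\<close> for
  \<open>n = d\<^sub>1 d\<^sub>2\<close>, is decided with two queries for best separable approximations.  An operator \<open>X\<close> of
  trace one is close to a separable state if and only if the best approximation of \<open>X + \<eta>\<close>, for a
  small \<open>\<eta> > 0\<close>, is close to \<open>X + \<eta>\<close>.  This query is valid only if \<open>X + \<eta>\<close> is positive
  semidefinite, which the first query certifies: \<open>X\<close> is embedded into an operator of
  dimensions \<open>2 n\<close> and \<open>2\<close> that is always positive semidefinite, but is separable if and only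
  if \<open>X\<close> is positive semidefinite.  Comparison with the answers is entrywise, so that all
  numbers have polynomial length.  Since a best approximation is used as a point of the cone, its existence is
  needed; it follows from Caratheodory's theorem for cones and compactness.
\<close>

section \<open>Polynomial-time subroutines with oracle access\<close>

text \<open>The obstacle is that a query outside the promise may be answered arbitrarily, so nothing
  follows from an answer before its query is known to be valid. The chain starts from a check of the
  input alone: bounded entries of \<open>X\<close> make \<open>1 + X / n^3\<close> positive
  semidefinite and the first query valid; its answer gives X + \<eta> \<ge> 0, which makes the
  second query valid. The shift by \<eta> is there because approximate answers confirm
  semidefiniteness only up to an error. Leaving this test to the oracle avoids an exact elimination
  algorithm, with its bounds on intermediate numbers, in the machine model. The exponents are found
  backwards. The tolerance 1 / (N n^21) is small enough because 21 is at least 16 and 20.5. Passing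
  from entries to the norm and normalising the trace cost at most a factor n^5, hence \<eta> = 1 /
  (N n^26). The error of the first test, enlarged by n^3 when the scaling is undone, must stay below
  \<eta>, which the precision 1 / (N n^34) ensures.\<close>

type_synonym answers = "data \<Rightarrow> data"

definition bounded_oracle :: "nat poly \<Rightarrow> answers \<Rightarrow> bool" where
  "bounded_oracle p f \<longleftrightarrow> (\<forall>z. bits (f z) \<le> poly p (bits z))"

definition ctx_size :: "('x \<Rightarrow> data) list \<Rightarrow> 'x \<Rightarrow> nat" where
  "ctx_size \<Gamma> x = (\<Sum>g\<leftarrow>\<Gamma>. bits (g x))"

text \<open>Halting with the right value is demanded for every oracle, the bounds only for oracles
  bounded by \<open>p\<close>: these are the two clauses of \<open>turing_reducible\<close>. The
  size of the result is bounded as well because whatever uses the result later is charged for it. In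
  \<open>computable\<close> below the program is chosen before \<open>p\<close>, as it is
  there.\<close>

definition implements ::
  "com \<Rightarrow> nat list \<Rightarrow> nat \<Rightarrow> ('x \<Rightarrow> data) list \<Rightarrow> (answers \<Rightarrow> 'x \<Rightarrow> data) \<Rightarrow> nat poly \<Rightarrow> nat poly \<Rightarrow> bool"
where
  "implements c \<rho> m \<Gamma> F p q \<longleftrightarrow>
     (\<forall>f x s. map s \<rho> = map (\<lambda>g. g x) \<Gamma> \<longrightarrow>
        (\<exists>t s'. exec f c s t s' \<and> s' m = F f x \<and> (\<forall>v<m. s' v = s v) \<and>
           (bounded_oracle p f \<longrightarrow>
              t \<le> poly q (ctx_size \<Gamma> x) \<and> bits (F f x) \<le> poly q (ctx_size \<Gamma> x))))"

text \<open>
  The list \<open>\<Gamma>\<close> consists of the quantities, depending on a hidden parameter \<open>x\<close>, that are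
  available in program variables.  Any choice \<open>\<rho>\<close> of these variables and any target \<open>m\<close>
  above them is allowed; all variables from \<open>m\<close> on may be overwritten.
\<close>

definition computable :: "('x \<Rightarrow> data) list \<Rightarrow> (answers \<Rightarrow> 'x \<Rightarrow> data) \<Rightarrow> bool" where
  "computable \<Gamma> F \<longleftrightarrow>
     (\<forall>\<rho> m. length \<rho> = length \<Gamma> \<and> (\<forall>v\<in>set \<rho>. v < m) \<longrightarrow>
        (\<exists>c. \<forall>p. \<exists>q. implements c \<rho> m \<Gamma> F p q))"

text \<open>A local binding: the parameter becomes a pair, and the value bound last is its second
  component.\<close>

definition lift :: "('x \<Rightarrow> data) list \<Rightarrow> ('x \<times> data \<Rightarrow> data) list" where
  "lift \<Gamma> = map (\<lambda>g y. g (fst y)) \<Gamma> @ [snd]"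

lemma poly_nat_mono: "m \<le> n \<Longrightarrow> poly (q :: nat poly) m \<le> poly q n"
  by (induction q) (auto intro!: add_mono mult_mono)

lemma computableI:
  assumes "\<And>\<rho> m. length \<rho> = length \<Gamma> \<Longrightarrow> \<forall>v\<in>set \<rho>. v < m \<Longrightarrow>
    \<exists>c. \<forall>p. \<exists>q. implements c \<rho> m \<Gamma> F p q"
  shows "computable \<Gamma> F"
  using assms by (auto simp: computable_def)

lemma computableE:
  assumes "computable \<Gamma> F" "length \<rho> = length \<Gamma>" "\<forall>v\<in>set \<rho>. v < m"
  obtains c where "\<And>p. \<exists>q. implements c \<rho> m \<Gamma> F p q"
  using assms unfolding computable_def by blast

lemma implementsE:
  assumes "implements c \<rho> m \<Gamma> F p q" "map s \<rho> = map (\<lambda>g. g x) \<Gamma>"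
  obtains t s' where "exec f c s t s'" "s' m = F f x" "\<And>v. v < m \<Longrightarrow> s' v = s v"
    "bounded_oracle p f \<Longrightarrow> t \<le> poly q (ctx_size \<Gamma> x)"
    "bounded_oracle p f \<Longrightarrow> bits (F f x) \<le> poly q (ctx_size \<Gamma> x)"
  using assms unfolding implements_def by blast

lemma bits_pos [simp]: "0 < bits d"
  by (cases d) auto

lemma bits_le_ctx_size: "g \<in> set \<Gamma> \<Longrightarrow> bits (g x) \<le> ctx_size \<Gamma> x"
  unfolding ctx_size_def by (rule member_le_sum_list) auto

lemma ctx_size_lift: "ctx_size (lift \<Gamma>) y = ctx_size \<Gamma> (fst y) + bits (snd y)"
  by (simp add: ctx_size_def lift_def o_def)

lemma computable_var:
  assumes "g \<in> set \<Gamma>"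
  shows "computable \<Gamma> (\<lambda>f x. g x)"
proof (rule computableI)
  fix \<rho> :: "nat list" and m assume len: "length \<rho> = length \<Gamma>" and "\<forall>v\<in>set \<rho>. v < (m :: nat)"
  from assms obtain j where j: "j < length \<Gamma>" "\<Gamma> ! j = g"
    by (auto simp: in_set_conv_nth)
  have "implements (Assign m (Var (\<rho> ! j))) \<rho> m \<Gamma> (\<lambda>f x. g x) p [:1, 1:]" for p
    unfolding implements_def
  proof (intro allI impI)
    fix f x s assume "map s \<rho> = map (\<lambda>g. g x) \<Gamma>"
    then have "map s \<rho> ! j = map (\<lambda>g. g x) \<Gamma> ! j" by simp
    then have eq: "s (\<rho> ! j) = g x" using j len by simp
    have "bits (g x) \<le> ctx_size \<Gamma> x" by (rule bits_le_ctx_size[OF assms])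
    then show "\<exists>t s'. exec f (Assign m (Var (\<rho> ! j))) s t s' \<and> s' m = g x \<and> (\<forall>v<m. s' v = s v) \<and>
        (bounded_oracle p f \<longrightarrow>
           t \<le> poly [:1, 1:] (ctx_size \<Gamma> x) \<and> bits (g x) \<le> poly [:1, 1:] (ctx_size \<Gamma> x))"
      by - (rule exI, rule exI, rule conjI, rule exec.intros, auto simp: eq)
  qed
  then show "\<exists>c. \<forall>p. \<exists>q. implements c \<rho> m \<Gamma> (\<lambda>f x. g x) p q" by blast
qed

lemma computable_const: "computable \<Gamma> (\<lambda>f x. d)"
proof (rule computableI)
  fix \<rho> :: "nat list" and m :: nat
  have "implements (Assign m (Const d)) \<rho> m \<Gamma> (\<lambda>f x. d) p [:1 + bits d:]" for p
    unfolding implements_def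
    by (intro allI impI) (rule exI, rule exI, rule conjI, rule exec.intros, auto)
  then show "\<exists>c. \<forall>p. \<exists>q. implements c \<rho> m \<Gamma> (\<lambda>f x. d) p q" by blast
qed

text \<open>The same code serves the other context: each quantity of \<Gamma> is read from a
  variable of \<Delta> that holds it after reindexing by \<pi>. Several entries of \<Gamma> may
  share one variable, which costs the factor \<open>length \<Gamma>\<close>.\<close>

lemma computable_weaken:
  assumes F: "computable \<Gamma> F" and sub: "\<And>g. g \<in> set \<Gamma> \<Longrightarrow> (\<lambda>y. g (\<pi> y)) \<in> set \<Delta>"
  shows "computable \<Delta> (\<lambda>f y. F f (\<pi> y))"
proof (rule computableI)
  fix \<rho> :: "nat list" and m assume len: "length \<rho> = length \<Delta>" and less: "\<forall>v\<in>set \<rho>. v < (m :: nat)"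
  have "\<forall>g \<in> set \<Gamma>. \<exists>i. i < length \<Delta> \<and> \<Delta> ! i = (\<lambda>y. g (\<pi> y))"
    using sub by (metis in_set_conv_nth)
  then obtain idx where idx: "\<And>g. g \<in> set \<Gamma> \<Longrightarrow> idx g < length \<Delta> \<and> \<Delta> ! idx g = (\<lambda>y. g (\<pi> y))"
    by metis
  define \<rho>' where "\<rho>' = map (\<lambda>g. \<rho> ! idx g) \<Gamma>"
  have "\<forall>v\<in>set \<rho>'. v < m" using less len idx by (auto simp: \<rho>'_def)
  then obtain c where c: "\<And>p. \<exists>q. implements c \<rho>' m \<Gamma> F p q"
    using computableE[OF F, of \<rho>' m] by (auto simp: \<rho>'_def)
  have size: "ctx_size \<Gamma> (\<pi> y) \<le> length \<Gamma> * ctx_size \<Delta> y" for y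
  proof -
    have "(\<Sum>g\<leftarrow>\<Gamma>. bits (g (\<pi> y))) \<le> (\<Sum>g\<leftarrow>\<Gamma>. ctx_size \<Delta> y)"
      using bits_le_ctx_size[OF sub, of _ y] by (intro sum_list_mono) auto
    then show ?thesis by (simp add: ctx_size_def sum_list_triv)
  qed
  have "\<exists>q. implements c \<rho> m \<Delta> (\<lambda>f y. F f (\<pi> y)) p q" for p
  proof -
    from c obtain q where q: "implements c \<rho>' m \<Gamma> F p q" by blast
    have "implements c \<rho> m \<Delta> (\<lambda>f y. F f (\<pi> y)) p (pcompose q [:0, length \<Gamma>:])"
      unfolding implements_def
    proof (intro allI impI)
      fix f y s assume eq: "map s \<rho> = map (\<lambda>g. g y) \<Delta>"
      have "map s \<rho>' = map (\<lambda>g. g (\<pi> y)) \<Gamma>"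
      proof (rule nth_equalityI)
        fix j assume "j < length (map s \<rho>')"
        then have j: "j < length \<Gamma>" by (simp add: \<rho>'_def)
        then have i: "idx (\<Gamma> ! j) < length \<Delta>" "\<Delta> ! idx (\<Gamma> ! j) = (\<lambda>y. (\<Gamma> ! j) (\<pi> y))" using idx by auto
        have "map s \<rho> ! idx (\<Gamma> ! j) = map (\<lambda>g. g y) \<Delta> ! idx (\<Gamma> ! j)" by (simp add: eq)
        then have "s (\<rho> ! idx (\<Gamma> ! j)) = (\<Gamma> ! j) (\<pi> y)" using i len by simp
        then show "map s \<rho>' ! j = map (\<lambda>g. g (\<pi> y)) \<Gamma> ! j" using j by (simp add: \<rho>'_def)
      qed (simp add: \<rho>'_def)
      from implementsE[OF q this, of f] obtain t s' where *:
        "exec f c s t s'" "s' m = F f (\<pi> y)" "\<And>v. v < m \<Longrightarrow> s' v = s v"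
        "bounded_oracle p f \<Longrightarrow> t \<le> poly q (ctx_size \<Gamma> (\<pi> y))"
        "bounded_oracle p f \<Longrightarrow> bits (F f (\<pi> y)) \<le> poly q (ctx_size \<Gamma> (\<pi> y))" by blast
      have "poly q (ctx_size \<Gamma> (\<pi> y)) \<le> poly (pcompose q [:0, length \<Gamma>:]) (ctx_size \<Delta> y)"
        using size[of y] by (simp add: poly_pcompose poly_nat_mono mult.commute)
      with * show "\<exists>t s'. exec f c s t s' \<and> s' m = F f (\<pi> y) \<and> (\<forall>v<m. s' v = s v) \<and>
        (bounded_oracle p f \<longrightarrow> t \<le> poly (pcompose q [:0, length \<Gamma>:]) (ctx_size \<Delta> y) \<and>
           bits (F f (\<pi> y)) \<le> poly (pcompose q [:0, length \<Gamma>:]) (ctx_size \<Delta> y))"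
        by (meson order_trans)
    qed
    then show ?thesis by blast
  qed
  then show "\<exists>c. \<forall>p. \<exists>q. implements c \<rho> m \<Delta> (\<lambda>f y. F f (\<pi> y)) p q" by blast
qed

text \<open>The value of \<open>F\<close> stays in the target \<open>m\<close> while
  \<open>G\<close> runs above it with target \<open>Suc m\<close>; the result then overwrites it.
  The bound for \<open>G\<close> refers to a context that contains the value of \<open>F\<close>,
  hence the composition of polynomials.\<close>

lemma computable_let:
  assumes F: "computable \<Gamma> F" and G: "computable (lift \<Gamma>) G"
  shows "computable \<Gamma> (\<lambda>f x. G f (x, F f x))"
proof (rule computableI)
  fix \<rho> :: "nat list" and m assume len: "length \<rho> = length \<Gamma>" and less: "\<forall>v\<in>set \<rho>. v < (m :: nat)"
  obtain c where c: "\<And>p. \<exists>q. implements c \<rho> m \<Gamma> F p q"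
    using computableE[OF F len less] by blast
  obtain d where d: "\<And>p. \<exists>q. implements d (\<rho> @ [m]) (Suc m) (lift \<Gamma>) G p q"
    using computableE[OF G, of "\<rho> @ [m]" "Suc m"] len less by (force simp: lift_def less_Suc_eq)
  let ?c = "Seq c (Seq d (Assign m (Var (Suc m))))"
  have "\<exists>q. implements ?c \<rho> m \<Gamma> (\<lambda>f x. G f (x, F f x)) p q" for p
  proof -
    from c d obtain q r where q: "implements c \<rho> m \<Gamma> F p q"
      and r: "implements d (\<rho> @ [m]) (Suc m) (lift \<Gamma>) G p r" by blast
    let ?r = "pcompose r ([:0, 1:] + q)"
    let ?q = "[:3:] + q + [:2:] * ?r"
    have "implements ?c \<rho> m \<Gamma> (\<lambda>f x. G f (x, F f x)) p ?q"
      unfolding implements_def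
    proof (intro allI impI)
      fix f x s assume eq: "map s \<rho> = map (\<lambda>g. g x) \<Gamma>"
      from implementsE[OF q eq, of f] obtain t s' where 1:
        "exec f c s t s'" "s' m = F f x" "\<And>v. v < m \<Longrightarrow> s' v = s v"
        "bounded_oracle p f \<Longrightarrow> t \<le> poly q (ctx_size \<Gamma> x)"
        "bounded_oracle p f \<Longrightarrow> bits (F f x) \<le> poly q (ctx_size \<Gamma> x)" by blast
      have "map s' \<rho> = map s \<rho>" using 1(3) less by simp
      then have "map s' (\<rho> @ [m]) = map (\<lambda>g. g (x, F f x)) (lift \<Gamma>)"
        using eq 1(2) by (simp add: lift_def)
      from implementsE[OF r this, of f] obtain u s'' where 2:
        "exec f d s' u s''" "s'' (Suc m) = G f (x, F f x)" "\<And>v. v < Suc m \<Longrightarrow> s'' v = s' v"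
        "bounded_oracle p f \<Longrightarrow> u \<le> poly r (ctx_size (lift \<Gamma>) (x, F f x))"
        "bounded_oracle p f \<Longrightarrow> bits (G f (x, F f x)) \<le> poly r (ctx_size (lift \<Gamma>) (x, F f x))" by blast
      have e: "exec f ?c s (1 + t + (1 + u + (1 + cost (Var (Suc m)) s''))) (s''(m := eval_expr (Var (Suc m)) s''))"
        by (rule exec.intros(4)[OF 1(1) exec.intros(4)[OF 2(1) exec.intros(2)]])
      have "poly r (ctx_size (lift \<Gamma>) (x, F f x)) \<le> poly ?r (ctx_size \<Gamma> x)" if "bounded_oracle p f"
        using 1(5)[OF that] by (simp add: ctx_size_lift poly_pcompose poly_nat_mono)
      then have b: "u \<le> poly ?r (ctx_size \<Gamma> x)" "bits (G f (x, F f x)) \<le> poly ?r (ctx_size \<Gamma> x)"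
        if "bounded_oracle p f" using 2(4,5) that order_trans by blast+
      show "\<exists>t s'. exec f ?c s t s' \<and> s' m = G f (x, F f x) \<and> (\<forall>v<m. s' v = s v) \<and>
        (bounded_oracle p f \<longrightarrow> t \<le> poly ?q (ctx_size \<Gamma> x) \<and>
           bits (G f (x, F f x)) \<le> poly ?q (ctx_size \<Gamma> x))"
        using e 1(3,4) 2(2,3) b by - (rule exI, rule exI, rule conjI, rule e, auto)
    qed
    then show ?thesis by blast
  qed
  then show "\<exists>c. \<forall>p. \<exists>q. implements c \<rho> m \<Gamma> (\<lambda>f x. G f (x, F f x)) p q" by blast
qed

lemma lift_memI: "g \<in> set \<Gamma> \<Longrightarrow> (\<lambda>y. g (fst y)) \<in> set (lift \<Gamma>)" "snd \<in> set (lift \<Gamma>)"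
  by (auto simp: lift_def)

lemma computable_lift: "computable \<Gamma> F \<Longrightarrow> computable (lift \<Gamma>) (\<lambda>f y. F f (fst y))"
  by (erule computable_weaken) (rule lift_memI)

lemma computable_assign:
  assumes "\<And>\<rho>. length \<rho> = length \<Gamma> \<Longrightarrow> \<exists>e. \<forall>f x s. map s \<rho> = map (\<lambda>g. g x) \<Gamma> \<longrightarrow>
    eval_expr e s = F f x \<and> cost e s \<le> a * ctx_size \<Gamma> x + b"
  and "\<And>f x. bits (F f x) \<le> a * ctx_size \<Gamma> x + b"
  shows "computable \<Gamma> F"
proof (rule computableI)
  fix \<rho> :: "nat list" and m assume len: "length \<rho> = length \<Gamma>"
  from assms(1)[OF len] obtain e where e: "\<And>f x s. map s \<rho> = map (\<lambda>g. g x) \<Gamma> \<Longrightarrow>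
    eval_expr e s = F f x \<and> cost e s \<le> a * ctx_size \<Gamma> x + b" by blast
  have "implements (Assign m e) \<rho> m \<Gamma> F p [:b + 1, a:]" for p
    unfolding implements_def
  proof (intro allI impI)
    fix f x s assume eq: "map s \<rho> = map (\<lambda>g. g x) \<Gamma>"
    show "\<exists>t s'. exec f (Assign m e) s t s' \<and> s' m = F f x \<and> (\<forall>v<m. s' v = s v) \<and>
        (bounded_oracle p f \<longrightarrow> t \<le> poly [:b + 1, a:] (ctx_size \<Gamma> x) \<and>
           bits (F f x) \<le> poly [:b + 1, a:] (ctx_size \<Gamma> x))"
      using e[OF eq, of f] assms(2)[of f x]
      by - (rule exI, rule exI, rule conjI, rule exec.intros, auto simp: mult.commute)
  qed
  then show "\<exists>c. \<forall>p. \<exists>q. implements c \<rho> m \<Gamma> F p q" by blast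
qed

lemma computable_unary:
  assumes F: "computable \<Gamma> F"
    and E: "\<And>e s. eval_expr (E e) s = h (eval_expr e s)"
      "\<And>e s. cost (E e) s = bits (eval_expr (E e) s) + cost e s"
    and h: "\<And>d. bits (h d) \<le> bits d + 1"
  shows "computable \<Gamma> (\<lambda>f x. h (F f x))"
proof -
  have "computable (lift \<Gamma>) (\<lambda>f y. h (snd y))"
  proof (rule computable_assign[where a = 2 and b = 1])
    fix \<rho> :: "nat list" assume len: "length \<rho> = length (lift \<Gamma>)"
    show "\<exists>e. \<forall>f x s. map s \<rho> = map (\<lambda>g. g x) (lift \<Gamma>) \<longrightarrow>
        eval_expr e s = h (snd x) \<and> cost e s \<le> 2 * ctx_size (lift \<Gamma>) x + 1"
    proof (intro exI[of _ "E (Var (last \<rho>))"] allI impI)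
      fix x s assume "map s \<rho> = map (\<lambda>g. g x) (lift \<Gamma>)"
      then have "last (map s \<rho>) = last (map (\<lambda>g. g x) (lift \<Gamma>))" by simp
      moreover have "\<rho> \<noteq> []" using len by (auto simp: lift_def)
      ultimately have "s (last \<rho>) = snd x" by (simp add: lift_def last_map)
      then show "eval_expr (E (Var (last \<rho>))) s = h (snd x) \<and>
          cost (E (Var (last \<rho>))) s \<le> 2 * ctx_size (lift \<Gamma>) x + 1"
        using h[of "snd x"] by (simp add: E ctx_size_lift)
    qed
  next
    fix f :: answers and x :: "'a \<times> data"
    show "bits (h (snd x)) \<le> 2 * ctx_size (lift \<Gamma>) x + 1"
      using h[of "snd x"] by (simp add: ctx_size_lift)
  qed
  from computable_let[OF F this] show ?thesis by simp
qed

lemma computable_binary: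
  assumes F: "computable \<Gamma> F" and G: "computable \<Gamma> G"
    and E: "\<And>e e' s. eval_expr (E e e') s = h (eval_expr e s) (eval_expr e' s)"
      "\<And>e e' s. cost (E e e') s = bits (eval_expr (E e e') s) + cost e s + cost e' s"
    and h: "\<And>d d'. bits (h d d') \<le> bits d + bits d' + 3"
  shows "computable \<Gamma> (\<lambda>f x. h (F f x) (G f x))"
proof -
  have "computable (lift (lift \<Gamma>)) (\<lambda>f y. h (snd (fst y)) (snd y))"
  proof (rule computable_assign[where a = 2 and b = 3])
    fix \<rho> :: "nat list" assume len: "length \<rho> = length (lift (lift \<Gamma>))"
    show "\<exists>e. \<forall>f x s. map s \<rho> = map (\<lambda>g. g x) (lift (lift \<Gamma>)) \<longrightarrow>
        eval_expr e s = h (snd (fst x)) (snd x) \<and> cost e s \<le> 2 * ctx_size (lift (lift \<Gamma>)) x + 3"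
    proof (intro exI[of _ "E (Var (\<rho> ! length \<Gamma>)) (Var (\<rho> ! Suc (length \<Gamma>)))"] allI impI)
      fix x s assume eq: "map s \<rho> = map (\<lambda>g. g x) (lift (lift \<Gamma>))"
      have "map s \<rho> ! length \<Gamma> = snd (fst x)" "map s \<rho> ! Suc (length \<Gamma>) = snd x"
        unfolding eq by (simp_all add: lift_def nth_append)
      then have "s (\<rho> ! length \<Gamma>) = snd (fst x)" "s (\<rho> ! Suc (length \<Gamma>)) = snd x"
        using len by (simp_all add: lift_def)
      then show "eval_expr (E (Var (\<rho> ! length \<Gamma>)) (Var (\<rho> ! Suc (length \<Gamma>)))) s = h (snd (fst x)) (snd x) \<and>
          cost (E (Var (\<rho> ! length \<Gamma>)) (Var (\<rho> ! Suc (length \<Gamma>)))) s \<le> 2 * ctx_size (lift (lift \<Gamma>)) x + 3"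
        using h[of "snd (fst x)" "snd x"] by (simp add: E ctx_size_lift)
    qed
  next
    fix f :: answers and x :: "('a \<times> data) \<times> data"
    show "bits (h (snd (fst x)) (snd x)) \<le> 2 * ctx_size (lift (lift \<Gamma>)) x + 3"
      using h[of "snd (fst x)" "snd x"] by (simp add: ctx_size_lift)
  qed
  from computable_let[OF computable_lift[OF G] this]
  have "computable (lift \<Gamma>) (\<lambda>f y. h (snd y) (G f (fst y)))" by simp
  from computable_let[OF F this] show ?thesis by simp
qed

text \<open>The one primitive whose bounds depend on \<open>p\<close>: an answer is received free of
  charge, but its size enters every later cost.\<close>

lemma computable_query:
  assumes F: "computable \<Gamma> F"
  shows "computable \<Gamma> (\<lambda>f x. f (F f x))"
proof -
  have "computable (lift \<Gamma>) (\<lambda>f y. f (snd y))"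
  proof (rule computableI)
    fix \<rho> :: "nat list" and m assume len: "length \<rho> = length (lift \<Gamma>)"
    have "implements (Query m (Var (last \<rho>))) \<rho> m (lift \<Gamma>) (\<lambda>f y. f (snd y)) p (p + [:1, 1:])" for p
      unfolding implements_def
    proof (intro allI impI)
      fix f x s assume "map s \<rho> = map (\<lambda>g. g x) (lift \<Gamma>)"
      then have "last (map s \<rho>) = last (map (\<lambda>g. g x) (lift \<Gamma>))" by simp
      moreover have "\<rho> \<noteq> []" using len by (auto simp: lift_def)
      ultimately have eq: "s (last \<rho>) = snd x" by (simp add: lift_def last_map)
      have "bits (f (snd x)) \<le> poly p (bits (snd x))" if "bounded_oracle p f"
        using that by (simp add: bounded_oracle_def)
      then have "bits (f (snd x)) \<le> poly p (ctx_size (lift \<Gamma>) x)" if "bounded_oracle p f"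
        using that poly_nat_mono[of "bits (snd x)" "ctx_size (lift \<Gamma>) x" p]
        by (force simp: ctx_size_lift)
      then show "\<exists>t s'. exec f (Query m (Var (last \<rho>))) s t s' \<and> s' m = f (snd x) \<and> (\<forall>v<m. s' v = s v) \<and>
          (bounded_oracle p f \<longrightarrow> t \<le> poly (p + [:1, 1:]) (ctx_size (lift \<Gamma>) x) \<and>
             bits (f (snd x)) \<le> poly (p + [:1, 1:]) (ctx_size (lift \<Gamma>) x))"
        by - (rule exI, rule exI, rule conjI, rule exec.intros, auto simp: eq ctx_size_lift)
    qed
    then show "\<exists>c. \<forall>p. \<exists>q. implements c \<rho> m (lift \<Gamma>) (\<lambda>f y. f (snd y)) p q" by blast
  qed
  from computable_let[OF F this] show ?thesis by simp
qed

subsection \<open>Operations on data\<close>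

definition hd_data :: "data \<Rightarrow> data" where
  "hd_data d = (case d of Lst (x # xs) \<Rightarrow> x | _ \<Rightarrow> Lst [])"

definition tl_data :: "data \<Rightarrow> data" where
  "tl_data d = (case d of Lst (x # xs) \<Rightarrow> Lst xs | _ \<Rightarrow> Lst [])"

definition cons_data :: "data \<Rightarrow> data \<Rightarrow> data" where
  "cons_data a d = (case d of Lst xs \<Rightarrow> Lst (a # xs) | _ \<Rightarrow> Lst [])"

abbreviation add_data :: "data \<Rightarrow> data \<Rightarrow> data" where "add_data \<equiv> int_op (+)"
abbreviation sub_data :: "data \<Rightarrow> data \<Rightarrow> data" where "sub_data \<equiv> int_op (-)"
abbreviation mul_data :: "data \<Rightarrow> data \<Rightarrow> data" where "mul_data \<equiv> int_op (*)"
abbreviation less_data :: "data \<Rightarrow> data \<Rightarrow> data" where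
  "less_data \<equiv> int_op (\<lambda>i j. if i < j then 1 else 0)"
abbreviation eq_data :: "data \<Rightarrow> data \<Rightarrow> data" where "eq_data a b \<equiv> bool_data (a = b)"

lemma data_op_simps [simp]:
  "hd_data (Lst (x # xs)) = x" "hd_data (Lst []) = Lst []" "hd_data (Num i) = Lst []"
  "tl_data (Lst (x # xs)) = Lst xs" "tl_data (Lst []) = Lst []" "tl_data (Num i) = Lst []"
  "cons_data a (Lst xs) = Lst (a # xs)"
  "int_op g (Num i) (Num j) = Num (g i j)"
  by (simp_all add: hd_data_def tl_data_def cons_data_def int_op_def)

lemma bits_int_op:
  assumes "\<And>i j. bitlen \<bar>g i j\<bar> \<le> bitlen \<bar>i\<bar> + bitlen \<bar>j\<bar> + 1"
  shows "bits (int_op g d d') \<le> bits d + bits d' + 3"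
proof -
  have "nat (bitlen \<bar>g i j\<bar>) \<le> nat (bitlen \<bar>i\<bar>) + nat (bitlen \<bar>j\<bar>) + 1" for i j
    using assms[of i j] bitlen_nonneg[of "\<bar>i\<bar>"] bitlen_nonneg[of "\<bar>j\<bar>"] by linarith
  note * = this
  show ?thesis
  proof (cases "\<exists>i j. d = Num i \<and> d' = Num j")
    case True
    then obtain i j where "d = Num i" "d' = Num j" by blast
    then show ?thesis using *[of i j] by (simp add: int_op_def)
  qed (auto simp: int_op_def split: data.splits)
qed

lemma bitlen_le:
  assumes "0 \<le> x" "0 \<le> k" "x < 2 ^ nat k"
  shows "bitlen x \<le> k"
  using assms by (metis bitlen_le_iff_power)

lemma bitlen_abs_less: "\<bar>i\<bar> < 2 ^ nat (bitlen \<bar>i\<bar>)"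
  using bitlen_bounds[of "\<bar>i\<bar>"] by (cases "i = 0") auto

lemma bitlen_op_bounds:
  "bitlen \<bar>i + j\<bar> \<le> bitlen \<bar>i\<bar> + bitlen \<bar>j\<bar> + 1"
  "bitlen \<bar>i - j\<bar> \<le> bitlen \<bar>i\<bar> + bitlen \<bar>j\<bar> + 1"
  "bitlen \<bar>i * j\<bar> \<le> bitlen \<bar>i\<bar> + bitlen \<bar>j\<bar> + 1"
proof -
  let ?a = "nat (bitlen \<bar>i\<bar>)" and ?b = "nat (bitlen \<bar>j\<bar>)"
  have nn: "0 \<le> bitlen \<bar>i\<bar>" "0 \<le> bitlen \<bar>j\<bar>" by (rule bitlen_nonneg)+
  have e: "nat (bitlen \<bar>i\<bar> + bitlen \<bar>j\<bar> + 1) = ?a + ?b + 1" using nn by simp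
  have i: "\<bar>i\<bar> < 2 ^ ?a" and j: "\<bar>j\<bar> < 2 ^ ?b" by (rule bitlen_abs_less)+
  have "(2 :: int) ^ ?a \<le> 2 ^ (?a + ?b)" "(2 :: int) ^ ?b \<le> 2 ^ (?a + ?b)"
    by (rule power_increasing; simp)+
  with i j have s: "\<bar>i\<bar> + \<bar>j\<bar> < 2 ^ (?a + ?b + 1)"
    unfolding power_add[of 2 "?a + ?b" 1] power_one_right by linarith
  show "bitlen \<bar>i + j\<bar> \<le> bitlen \<bar>i\<bar> + bitlen \<bar>j\<bar> + 1"
    "bitlen \<bar>i - j\<bar> \<le> bitlen \<bar>i\<bar> + bitlen \<bar>j\<bar> + 1"
    by (rule bitlen_le; use s nn in \<open>simp only: e\<close>; linarith)+
  have "\<bar>i * j\<bar> < 2 ^ (?a + ?b)"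
    unfolding abs_mult power_add using i j by (intro mult_strict_mono) auto
  also have "\<dots> \<le> 2 ^ (?a + ?b + 1)" by simp
  finally show "bitlen \<bar>i * j\<bar> \<le> bitlen \<bar>i\<bar> + bitlen \<bar>j\<bar> + 1"
    by (intro bitlen_le) (use nn e in auto)
qed

lemma bits_bool_data: "bits (bool_data b) \<le> 2"
  by (simp add: bool_data_def bitlen_def compute_floorlog)

lemma computable_hd: "computable \<Gamma> F \<Longrightarrow> computable \<Gamma> (\<lambda>f x. hd_data (F f x))"
  by (rule computable_unary[where E = Head and h = hd_data])
    (auto simp: hd_data_def split: data.splits list.splits)

lemma computable_tl: "computable \<Gamma> F \<Longrightarrow> computable \<Gamma> (\<lambda>f x. tl_data (F f x))"
  by (rule computable_unary[where E = Tail and h = tl_data])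
    (auto simp: tl_data_def split: data.splits list.splits)

lemma computable_cons:
  "computable \<Gamma> F \<Longrightarrow> computable \<Gamma> G \<Longrightarrow> computable \<Gamma> (\<lambda>f x. cons_data (F f x) (G f x))"
  by (rule computable_binary[where E = Cons and h = cons_data]) (auto simp: cons_data_def split: data.splits)

lemma computable_add:
  "computable \<Gamma> F \<Longrightarrow> computable \<Gamma> G \<Longrightarrow> computable \<Gamma> (\<lambda>f x. add_data (F f x) (G f x))"
  by (rule computable_binary[where E = Add and h = add_data]) (auto intro!: bits_int_op bitlen_op_bounds)

lemma computable_sub:
  "computable \<Gamma> F \<Longrightarrow> computable \<Gamma> G \<Longrightarrow> computable \<Gamma> (\<lambda>f x. sub_data (F f x) (G f x))"
  by (rule computable_binary[where E = Sub and h = sub_data]) (auto intro!: bits_int_op bitlen_op_bounds)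

lemma computable_mul:
  "computable \<Gamma> F \<Longrightarrow> computable \<Gamma> G \<Longrightarrow> computable \<Gamma> (\<lambda>f x. mul_data (F f x) (G f x))"
  by (rule computable_binary[where E = Mul and h = mul_data]) (auto intro!: bits_int_op bitlen_op_bounds)

lemma computable_less:
  "computable \<Gamma> F \<Longrightarrow> computable \<Gamma> G \<Longrightarrow> computable \<Gamma> (\<lambda>f x. less_data (F f x) (G f x))"
  by (rule computable_binary[where E = Less and h = less_data])
    (auto intro!: bits_int_op simp: bitlen_nonneg bitlen_def compute_floorlog)

lemma computable_eq:
  assumes "computable \<Gamma> F" "computable \<Gamma> G"
  shows "computable \<Gamma> (\<lambda>f x. eq_data (F f x) (G f x))"
proof (rule computable_binary[where E = Equal and h = eq_data, OF assms])
  fix d d' show "bits (eq_data d d') \<le> bits d + bits d' + 3"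
    using bits_bool_data[of "d = d'"] by linarith
qed simp_all


section \<open>Constant powers and loops over lists\<close>

lemma computable_num_power:
  "computable \<Gamma> F \<Longrightarrow> computable \<Gamma> (\<lambda>f x. (mul_data (F f x) ^^ j) (Num 1))"
  by (induction j) (auto intro: computable_const computable_mul)

text \<open>Every computable value has polynomial size, because \<open>implements\<close> bounds it;
  storing the context in the first variables gives a state to which that bound applies.\<close>

lemma computable_bits:
  assumes "computable \<Gamma> F"
  shows "\<exists>q. \<forall>f x. bounded_oracle p f \<longrightarrow> bits (F f x) \<le> poly q (ctx_size \<Gamma> x)"
proof -
  let ?\<rho> = "[0..<length \<Gamma>]"
  have "length ?\<rho> = length \<Gamma>" "\<forall>v\<in>set ?\<rho>. v < length \<Gamma>" by auto
  from computableE[OF assms this] obtain c where "\<And>p. \<exists>q. implements c ?\<rho> (length \<Gamma>) \<Gamma> F p q"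
    by blast
  then obtain q where q: "implements c ?\<rho> (length \<Gamma>) \<Gamma> F p q" by blast
  have "bits (F f x) \<le> poly q (ctx_size \<Gamma> x)" if "bounded_oracle p f" for f x
  proof -
    have "map (\<lambda>i. (\<Gamma> ! i) x) ?\<rho> = map (\<lambda>g. g x) \<Gamma>"
      by (rule nth_equalityI) auto
    from implementsE[OF q this, of f] that show ?thesis by blast
  qed
  then show ?thesis by blast
qed

text \<open>What \<open>fold_loop\<close> visits when it strips heads until \<open>Lst []\<close> is
  left. A number differs from \<open>Lst []\<close>, so it takes one round, with the default head
  \<open>Lst []\<close>.\<close>

fun items :: "data \<Rightarrow> data list" where
  "items (Lst xs) = xs"
| "items (Num i) = [Lst []]"

lemma items_Nil_iff: "items d = [] \<longleftrightarrow> d = Lst []"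
  by (cases d) auto

lemma items_step:
  "items d = a # xs \<Longrightarrow> hd_data d = a \<and> items (tl_data d) = xs \<and> bits (tl_data d) \<le> bits d \<and> bits a \<le> bits d"
  by (cases d) auto

lemma length_items_le: "length (items d) \<le> bits d"
proof (cases d)
  case (Lst xs)
  have "(\<Sum>x\<leftarrow>xs. 1) \<le> (\<Sum>x\<leftarrow>xs. bits x)"
    by (rule sum_list_mono) (metis bits_pos One_nat_def Suc_leI)
  then show ?thesis using Lst by (simp add: sum_list_triv)
qed auto

lemma bits_items_le: "a \<in> set (items d) \<Longrightarrow> bits a \<le> bits d"
  by (cases d) (auto intro!: le_SucI member_le_sum_list)

lemma bits_tl_data: "bits (tl_data d) \<le> bits d"
  by (auto simp: tl_data_def split: data.splits list.splits)

text \<open>Variable \<open>m\<close> holds the accumulator, \<open>m + 1\<close> the rest of the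
  list, \<open>m + 2\<close> the current item and \<open>m + 3\<close> the result of the body. The
  nested \<open>Equal\<close> is a negation: it yields \<open>Num 1\<close> as long as the rest is
  not \<open>Lst []\<close>.\<close>

definition fold_loop :: "nat \<Rightarrow> com \<Rightarrow> com" where
  "fold_loop m d = While (Equal (Equal (Var (m + 1)) (Const (Lst []))) (Const (Num 0)))
     (Seq (Assign (m + 2) (Head (Var (m + 1)))) (Seq (Assign (m + 1) (Tail (Var (m + 1))))
       (Seq d (Assign m (Var (m + 3))))))"

text \<open>\<open>B\<close> bounds the rest of the list and \<open>M\<close> the accumulators, so
  all rounds obey one cost bound. \<open>M\<close> has to bound the fold over every prefix, since
  the body runs on these values and the induction restarts from each of them.\<close>

lemma exec_fold_loop:
  assumes r: "implements d (\<rho> @ [m + 2, m]) (m + 3) (lift (lift \<Gamma>)) G p r"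
    and less: "\<forall>v\<in>set \<rho>. v < m"
    and s: "map s \<rho> = map (\<lambda>g. g x) \<Gamma>" "s m = A" "s (m + 1) = D" "bits D \<le> B"
    and bounded: "\<And>ys zs. bounded_oracle p f \<Longrightarrow> items D = ys @ zs \<Longrightarrow>
      bits (fold (\<lambda>a acc. G f ((x, a), acc)) ys A) \<le> M"
  shows "\<exists>t s'. exec f (fold_loop m d) s t s' \<and>
    s' m = fold (\<lambda>a acc. G f ((x, a), acc)) (items D) A \<and> (\<forall>v<m. s' v = s v) \<and>
    (bounded_oracle p f \<longrightarrow>
       t \<le> (length (items D) + 1) * (poly r (ctx_size \<Gamma> x + B + M) + 6 * B + M + 30))"
  using s bounded
proof (induction "items D" arbitrary: D A s)
  case Nil
  let ?e = "Equal (Equal (Var (m + 1)) (Const (Lst []))) (Const (Num 0))"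
  have D: "D = Lst []" using Nil.hyps items_Nil_iff by metis
  then have e: "exec f (fold_loop m d) s (1 + cost ?e s) s"
    using Nil.prems unfolding fold_loop_def by (intro exec.intros) (simp add: bool_data_def)
  have "cost ?e s \<le> 25"
    using Nil.prems(3) D by (simp add: bool_data_def bitlen_def compute_floorlog)
  then show ?case using e Nil.prems(2) D by (intro exI[of _ "1 + cost ?e s"] exI[of _ s]) auto
next
  case (Cons a xs)
  let ?e = "Equal (Equal (Var (m + 1)) (Const (Lst []))) (Const (Num 0))"
  let ?K = "poly r (ctx_size \<Gamma> x + B + M) + 6 * B + M + 30"
  note step = items_step[OF Cons.hyps(2)[symmetric]]
  have ne: "D \<noteq> Lst []" using Cons.hyps(2) by auto
  have test: "eval_expr ?e s = Num 1" using Cons.prems(3) ne by (simp add: bool_data_def)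
  have ce: "cost ?e s \<le> B + 20"
    using Cons.prems(3,4) by (simp add: bool_data_def bitlen_def compute_floorlog)
  define s1 where "s1 = s(m + 2 := a)"
  define s2 where "s2 = s1(m + 1 := tl_data D)"
  have hd_tl: "eval_expr (Head e) s = hd_data (eval_expr e s)"
    "eval_expr (Tail e) s = tl_data (eval_expr e s)" for e s
    by (auto simp: hd_data_def tl_data_def split: data.splits list.splits)
  have e1: "exec f (Assign (m + 2) (Head (Var (m + 1)))) s (1 + cost (Head (Var (m + 1))) s) s1"
    using exec.intros(2)[of f "m + 2" "Head (Var (m + 1))" s] step Cons.prems(3)
    by (simp only: hd_tl s1_def) (simp add: hd_tl)
  have c1: "cost (Head (Var (m + 1))) s \<le> 2 * B"
    using step Cons.prems(3,4) by (simp only: cost.simps hd_tl) simp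
  have e2: "exec f (Assign (m + 1) (Tail (Var (m + 1)))) s1 (1 + cost (Tail (Var (m + 1))) s1) s2"
    using exec.intros(2)[of f "m + 1" "Tail (Var (m + 1))" s1] Cons.prems(3)
    by (simp only: hd_tl s2_def) (simp add: hd_tl s1_def)
  have c2: "cost (Tail (Var (m + 1))) s1 \<le> 2 * B"
    using step Cons.prems(3,4) by (simp only: cost.simps hd_tl) (simp add: s1_def)
  have same: "map s2 \<rho> = map s \<rho>" using less by (auto simp: s1_def s2_def)
  have "map s2 (\<rho> @ [m + 2, m]) = map (\<lambda>g. g ((x, a), A)) (lift (lift \<Gamma>))"
    using same Cons.prems(1,2) by (simp add: lift_def) (simp add: s1_def s2_def)
  from implementsE[OF r this, of f] obtain t3 s3 where 3:
    "exec f d s2 t3 s3" "s3 (m + 3) = G f ((x, a), A)" "\<And>v. v < m + 3 \<Longrightarrow> s3 v = s2 v"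
    "bounded_oracle p f \<Longrightarrow> t3 \<le> poly r (ctx_size (lift (lift \<Gamma>)) ((x, a), A))" by blast
  define s4 where "s4 = s3(m := G f ((x, a), A))"
  have e4: "exec f (Assign m (Var (m + 3))) s3 (1 + bits (G f ((x, a), A))) s4"
    using exec.intros(2)[of f m "Var (m + 3)" s3] 3(2) by (simp add: s4_def)
  have frame: "\<And>v. v < m \<Longrightarrow> s4 v = s v" using 3(3) by (simp add: s4_def s1_def s2_def)
  have "\<exists>t s'. exec f (fold_loop m d) s4 t s' \<and>
    s' m = fold (\<lambda>a acc. G f ((x, a), acc)) (items (tl_data D)) (G f ((x, a), A)) \<and>
    (\<forall>v<m. s' v = s4 v) \<and> (bounded_oracle p f \<longrightarrow> t \<le> (length (items (tl_data D)) + 1) * ?K)"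
  proof (rule Cons.hyps(1))
    show "map s4 \<rho> = map (\<lambda>g. g x) \<Gamma>" using frame less Cons.prems(1) by (metis map_cong)
    show "s4 (m + 1) = tl_data D" using 3(3)[of "m + 1"] by (simp add: s4_def s2_def)
    fix ys zs assume "bounded_oracle p f" "items (tl_data D) = ys @ zs"
    then show "bits (fold (\<lambda>a acc. G f ((x, a), acc)) ys (G f ((x, a), A))) \<le> M"
      using Cons.prems(5)[of "a # ys" zs] step Cons.hyps(2) by simp
  qed (use step Cons.prems in \<open>auto simp: s4_def\<close>)
  then obtain t5 s5 where 5: "exec f (fold_loop m d) s4 t5 s5"
    "s5 m = fold (\<lambda>a acc. G f ((x, a), acc)) (items D) A" "\<forall>v<m. s5 v = s v"
    "bounded_oracle p f \<Longrightarrow> t5 \<le> (length xs + 1) * ?K"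
    using step Cons.hyps(2)[symmetric] frame by auto
  let ?t = "1 + cost ?e s + (1 + (1 + cost (Head (Var (m + 1))) s) + (1 + (1 + cost (Tail (Var (m + 1))) s1)
    + (1 + t3 + (1 + bits (G f ((x, a), A)))))) + t5"
  have "exec f (fold_loop m d) s ?t s5"
    unfolding fold_loop_def
    by (rule exec.intros(8)[OF test exec.intros(4)[OF e1 exec.intros(4)[OF e2 exec.intros(4)[OF 3(1) e4]]]
      5(1)[unfolded fold_loop_def]])
  moreover have "?t \<le> (length (items D) + 1) * ?K" if b: "bounded_oracle p f"
  proof -
    have "bits A \<le> M" using Cons.prems(5)[OF b, of "[]"] by simp
    moreover have "bits a \<le> B" using step Cons.prems(4) by simp
    ultimately have "poly r (ctx_size (lift (lift \<Gamma>)) ((x, a), A)) \<le> poly r (ctx_size \<Gamma> x + B + M)"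
      by (intro poly_nat_mono) (simp add: ctx_size_lift)
    then have "t3 \<le> poly r (ctx_size \<Gamma> x + B + M)" using 3(4)[OF b] by simp
    moreover have "bits (G f ((x, a), A)) \<le> M"
      using Cons.prems(5)[OF b, of "[a]" xs] Cons.hyps(2) by simp
    ultimately have "?t \<le> ?K + t5" using ce c1 c2 by linarith
    also have "\<dots> \<le> ?K + (length xs + 1) * ?K" using 5(4)[OF b] by linarith
    also have "\<dots> = (length (items D) + 1) * ?K" using Cons.hyps(2)[symmetric] by simp
    finally show ?thesis .
  qed
  ultimately show ?case using 5(2,3) by blast
qed

text \<open>The bound on all partial folds is a separate premise: a body of polynomial growth, such
  as squaring, can produce exponential lengths when it is iterated.\<close>

lemma computable_fold:
  assumes L: "computable \<Gamma> L" and I: "computable \<Gamma> I" and G: "computable (lift (lift \<Gamma>)) G"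
    and size: "\<And>p. \<exists>q. \<forall>f x ys zs. bounded_oracle p f \<longrightarrow> items (L f x) = ys @ zs \<longrightarrow>
      bits (fold (\<lambda>a acc. G f ((x, a), acc)) ys (I f x)) \<le> poly q (ctx_size \<Gamma> x)"
  shows "computable \<Gamma> (\<lambda>f x. fold (\<lambda>a acc. G f ((x, a), acc)) (items (L f x)) (I f x))"
    (is "computable \<Gamma> ?F")
proof (rule computableI)
  fix \<rho> :: "nat list" and m assume len: "length \<rho> = length \<Gamma>" and less: "\<forall>v\<in>set \<rho>. v < m"
  have less1: "\<forall>v\<in>set \<rho>. v < m + 1" using less by auto
  obtain c where c: "\<And>p. \<exists>q. implements c \<rho> m \<Gamma> I p q"
    using computableE[OF I len less] by blast
  obtain l where l: "\<And>p. \<exists>q. implements l \<rho> (m + 1) \<Gamma> L p q"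
    using computableE[OF L len less1] by blast
  have "length (\<rho> @ [m + 2, m]) = length (lift (lift \<Gamma>))" "\<forall>v\<in>set (\<rho> @ [m + 2, m]). v < m + 3"
    using len less by (auto simp: lift_def)
  then obtain d where d: "\<And>p. \<exists>q. implements d (\<rho> @ [m + 2, m]) (m + 3) (lift (lift \<Gamma>)) G p q"
    using computableE[OF G] by blast
  let ?c = "Seq c (Seq l (fold_loop m d))"
  have "\<exists>q. implements ?c \<rho> m \<Gamma> ?F p q" for p
  proof -
    from c l d obtain q1 q2 r where q1: "implements c \<rho> m \<Gamma> I p q1"
      and q2: "implements l \<rho> (m + 1) \<Gamma> L p q2"
      and r: "implements d (\<rho> @ [m + 2, m]) (m + 3) (lift (lift \<Gamma>)) G p r" by blast
    from size[of p] obtain q3 where q3: "\<And>f x ys zs. bounded_oracle p f \<Longrightarrow> items (L f x) = ys @ zs \<Longrightarrow>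
      bits (fold (\<lambda>a acc. G f ((x, a), acc)) ys (I f x)) \<le> poly q3 (ctx_size \<Gamma> x)" by blast
    let ?q = "[:2:] + q1 + q2 + q3 + (q2 + [:1:]) * (pcompose r ([:0, 1:] + q2 + q3) + [:6:] * q2 + q3 + [:30:])"
    have "implements ?c \<rho> m \<Gamma> ?F p ?q"
      unfolding implements_def
    proof (intro allI impI)
      fix f x s assume eq: "map s \<rho> = map (\<lambda>g. g x) \<Gamma>"
      from implementsE[OF q1 eq, of f] obtain t1 s1 where 1:
        "exec f c s t1 s1" "s1 m = I f x" "\<And>v. v < m \<Longrightarrow> s1 v = s v"
        "bounded_oracle p f \<Longrightarrow> t1 \<le> poly q1 (ctx_size \<Gamma> x)" by blast
      have eq1: "map s1 \<rho> = map (\<lambda>g. g x) \<Gamma>" using 1(3) less eq by (metis map_cong)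
      from implementsE[OF q2 eq1, of f] obtain t2 s2 where 2:
        "exec f l s1 t2 s2" "s2 (m + 1) = L f x" "\<And>v. v < m + 1 \<Longrightarrow> s2 v = s1 v"
        "bounded_oracle p f \<Longrightarrow> t2 \<le> poly q2 (ctx_size \<Gamma> x)"
        "bounded_oracle p f \<Longrightarrow> bits (L f x) \<le> poly q2 (ctx_size \<Gamma> x)" by blast
      have eq2: "map s2 \<rho> = map (\<lambda>g. g x) \<Gamma>" using 2(3) less1 eq1 by (metis map_cong)
      have m2: "s2 m = I f x" using 1(2) 2(3) by simp
      let ?M = "poly q3 (ctx_size \<Gamma> x)"
      have "\<exists>t s'. exec f (fold_loop m d) s2 t s' \<and> s' m = ?F f x \<and> (\<forall>v<m. s' v = s2 v) \<and>
          (bounded_oracle p f \<longrightarrow> t \<le> (length (items (L f x)) + 1) *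
             (poly r (ctx_size \<Gamma> x + bits (L f x) + ?M) + 6 * bits (L f x) + ?M + 30))"
        by (rule exec_fold_loop[OF r less eq2 m2 2(2)]) (use q3 in auto)
      then obtain t3 s3 where 3: "exec f (fold_loop m d) s2 t3 s3" "s3 m = ?F f x" "\<forall>v<m. s3 v = s2 v"
        "bounded_oracle p f \<Longrightarrow> t3 \<le> (length (items (L f x)) + 1) *
             (poly r (ctx_size \<Gamma> x + bits (L f x) + ?M) + 6 * bits (L f x) + ?M + 30)" by blast
      have e: "exec f ?c s (1 + t1 + (1 + t2 + t3)) s3"
        by (rule exec.intros(4)[OF 1(1) exec.intros(4)[OF 2(1) 3(1)]])
      have "1 + t1 + (1 + t2 + t3) \<le> poly ?q (ctx_size \<Gamma> x)" if b: "bounded_oracle p f"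
      proof -
        note bl = 2(5)[OF b]
        have "t3 \<le> (poly q2 (ctx_size \<Gamma> x) + 1) *
             (poly r (ctx_size \<Gamma> x + poly q2 (ctx_size \<Gamma> x) + ?M) + 6 * poly q2 (ctx_size \<Gamma> x) + ?M + 30)"
          using bl length_items_le[of "L f x"]
          by (intro order_trans[OF 3(4)[OF b]] mult_le_mono add_mono poly_nat_mono) auto
        then show ?thesis using 1(4)[OF b] 2(4)[OF b] by (simp add: poly_pcompose)
      qed
      moreover have "bits (?F f x) \<le> poly ?q (ctx_size \<Gamma> x)" if b: "bounded_oracle p f"
        using q3[OF b, of x "items (L f x)" "[]"] by simp
      ultimately show "\<exists>t s'. exec f ?c s t s' \<and> s' m = ?F f x \<and> (\<forall>v<m. s' v = s v) \<and>
        (bounded_oracle p f \<longrightarrow> t \<le> poly ?q (ctx_size \<Gamma> x) \<and> bits (?F f x) \<le> poly ?q (ctx_size \<Gamma> x))"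
        using e 1(3) 2(3) 3(2,3) by (intro exI[of _ "1 + t1 + (1 + t2 + t3)"] exI[of _ s3]) auto
    qed
    then show ?thesis by blast
  qed
  then show "\<exists>c. \<forall>p. \<exists>q. implements c \<rho> m \<Gamma> ?F p q" by blast
qed


section \<open>Building and comparing nested lists\<close>

lemma items_rev: "fold (\<lambda>a acc. cons_data a acc) xs (Lst ys) = Lst (rev xs @ ys)"
  by (induction xs arbitrary: ys) auto

lemma bits_rev_prefix_le: "items d = ys @ zs \<Longrightarrow> bits (Lst (rev ys)) \<le> bits d + 1"
  by (cases d) (auto simp: rev_map[symmetric] append_eq_Cons_conv Cons_eq_append_conv)

text \<open>Lists grow at the head, so loops deliver their output in reverse order; this puts it
  right.\<close>

lemma computable_rev:
  assumes "computable \<Gamma> L"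
  shows "computable \<Gamma> (\<lambda>f x. Lst (rev (items (L f x))))"
proof -
  have "computable \<Gamma> (\<lambda>f x. fold (\<lambda>a acc. cons_data (snd (fst ((x, a), acc))) (snd ((x, a), acc)))
      (items (L f x)) (Lst []))"
  proof (rule computable_fold[OF assms])
    show "computable (lift (lift \<Gamma>)) (\<lambda>f y. cons_data (snd (fst y)) (snd y))"
      by (intro computable_cons computable_var) (auto simp: lift_def)
  next
    fix p
    obtain q where q: "\<forall>f x. bounded_oracle p f \<longrightarrow> bits (L f x) \<le> poly q (ctx_size \<Gamma> x)"
      using computable_bits[OF assms] by blast
    have "\<forall>f x ys zs. bounded_oracle p f \<longrightarrow> items (L f x) = ys @ zs \<longrightarrow>
        bits (fold (\<lambda>a acc. cons_data (snd (fst ((x, a), acc))) (snd ((x, a), acc))) ys (Lst []))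
          \<le> poly (q + [:1:]) (ctx_size \<Gamma> x)"
    proof (intro allI impI)
      fix f x ys zs assume "bounded_oracle p f" "items (L f x) = ys @ zs"
      then have "bits (Lst (rev ys)) \<le> bits (L f x) + 1" "bits (L f x) \<le> poly q (ctx_size \<Gamma> x)"
        using q bits_rev_prefix_le[of "L f x" ys zs] by blast+
      then have "bits (Lst (rev ys)) \<le> poly (q + [:1:]) (ctx_size \<Gamma> x)"
        by (simp del: bits.simps)
      then show "bits (fold (\<lambda>a acc. cons_data (snd (fst ((x, a), acc))) (snd ((x, a), acc))) ys (Lst []))
          \<le> poly (q + [:1:]) (ctx_size \<Gamma> x)"
        by (simp add: items_rev del: bits.simps)
    qed
    then show "\<exists>q. \<forall>f x ys zs. bounded_oracle p f \<longrightarrow> items (L f x) = ys @ zs \<longrightarrow>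
        bits (fold (\<lambda>a acc. cons_data (snd (fst ((x, a), acc))) (snd ((x, a), acc))) ys (Lst []))
          \<le> poly q (ctx_size \<Gamma> x)" by blast
  qed (rule computable_const)
  then show ?thesis by (simp add: items_rev)
qed

text \<open>Every element gives rise to a block of fixed length. The position is passed along
  because diagonal entries are treated differently. Used on the rows and again on the entries of a
  row, this builds block matrices.\<close>

definition expand_list :: "(data \<Rightarrow> data \<Rightarrow> data) list \<Rightarrow> data list \<Rightarrow> data list" where
  "expand_list gs xs = concat (map (\<lambda>(i, a). map (\<lambda>g. g (Num (int i)) a) gs) (List.enumerate 0 xs))"

lemma expand_list_append1:
  "expand_list gs (xs @ [a]) = expand_list gs xs @ map (\<lambda>g. g (Num (int (length xs))) a) gs"
  by (simp add: expand_list_def enumerate_append_eq)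

lemma fold_cons_data: "fold (\<lambda>g r. cons_data (h g) r) gs (Lst ys) = Lst (rev (map h gs) @ ys)"
  by (induction gs arbitrary: ys) auto

text \<open>The accumulator consists of the position reached and the output so far in reverse
  order.\<close>

definition expand_step :: "(data \<Rightarrow> data \<Rightarrow> data) list \<Rightarrow> data \<Rightarrow> data \<Rightarrow> data" where
  "expand_step gs a acc = cons_data (add_data (hd_data acc) (Num 1))
     (cons_data (fold (\<lambda>g r. cons_data (g (hd_data acc) a) r) gs (hd_data (tl_data acc))) (Lst []))"

lemma fold_expand_step:
  "fold (expand_step gs) xs (Lst [Num 0, Lst []]) = Lst [Num (int (length xs)), Lst (rev (expand_list gs xs))]"
proof (induction xs rule: rev_induct)
  case Nil
  show ?case by (simp add: expand_list_def)
next
  case (snoc a xs)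
  then show ?case by (simp add: expand_step_def fold_cons_data expand_list_append1)
qed

lemma bits_Lst_le: "(\<And>a. a \<in> set xs \<Longrightarrow> bits a \<le> W) \<Longrightarrow> bits (Lst xs) \<le> 1 + length xs * W"
  using sum_list_mono[of xs bits "\<lambda>_. W"] by (simp add: sum_list_triv)

lemma bitlen_nat_le: "nat (bitlen \<bar>int i\<bar>) \<le> i"
proof -
  have "int i < 2 ^ i" by (metis of_nat_less_two_power)
  then have "bitlen (int i) \<le> int i" by (intro bitlen_le) auto
  then show ?thesis by simp
qed

lemma set_expand_list:
  assumes "b \<in> set (expand_list gs xs)"
  obtains i g a where "i < length xs" "g \<in> set gs" "a \<in> set xs" "b = g (Num (int i)) a"
  using assms by (auto simp: expand_list_def in_set_enumerate_eq) (metis nth_mem)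

lemma length_expand_list: "length (expand_list gs xs) = length xs * length gs"
proof (induction xs rule: rev_induct)
  case Nil
  show ?case by (simp add: expand_list_def)
qed (simp add: expand_list_append1)

lemma computable_bits_list:
  assumes "\<And>g. g \<in> set gs \<Longrightarrow> computable \<Gamma> (F g)"
  shows "\<exists>q. \<forall>g f x. g \<in> set gs \<longrightarrow> bounded_oracle p f \<longrightarrow> bits (F g f x) \<le> poly q (ctx_size \<Gamma> x)"
  using assms
proof (induction gs)
  case (Cons g gs)
  then obtain q r where
    "\<forall>h f x. h \<in> set gs \<longrightarrow> bounded_oracle p f \<longrightarrow> bits (F h f x) \<le> poly q (ctx_size \<Gamma> x)"
    "\<forall>f x. bounded_oracle p f \<longrightarrow> bits (F g f x) \<le> poly r (ctx_size \<Gamma> x)"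
    using computable_bits[of \<Gamma> "F g" p] by force
  then have "\<forall>h f x. h \<in> set (g # gs) \<longrightarrow> bounded_oracle p f \<longrightarrow> bits (F h f x) \<le> poly (q + r) (ctx_size \<Gamma> x)"
    by (auto simp: trans_le_add1 trans_le_add2)
  then show ?case by blast
qed simp

text \<open>Only the list is traversed by a loop. The functions \<open>gs\<close> belong to the
  program, so their successive application is unrolled in the body.\<close>

lemma computable_expand_list:
  fixes gs :: "(answers \<Rightarrow> 'x \<Rightarrow> data \<Rightarrow> data \<Rightarrow> data) list"
  assumes L: "computable \<Gamma> L"
    and gs: "\<And>g. g \<in> set gs \<Longrightarrow> computable (lift (lift \<Gamma>)) (\<lambda>f y. g f (fst (fst y)) (snd (fst y)) (snd y))"
  shows "computable \<Gamma> (\<lambda>f x. Lst (expand_list (map (\<lambda>g. g f x) gs) (items (L f x))))"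
proof -
  let ?G = "\<lambda>f y. expand_step (map (\<lambda>g. g f (fst (fst y))) gs) (snd (fst y)) (snd y)"
  have step: "computable (lift (lift \<Gamma>)) ?G"
  proof -
    let ?\<Delta> = "lift (lift \<Gamma>)"
    have g: "computable ?\<Delta> (\<lambda>f y. g f (fst (fst y)) (hd_data (snd y)) (snd (fst y)))" if "g \<in> set gs" for g
    proof -
      have "computable (lift ?\<Delta>) (\<lambda>f y. g f (fst (fst (fst y))) (snd y) (snd (fst (fst y))))"
      proof -
        \<comment> \<open>Here the parameter has the form (((x, item), accumulator), position),
          whereas \<open>g\<close> expects ((x, position), item).\<close>
        let ?\<pi> = "\<lambda>y. ((fst (fst (fst y)), snd y), snd (fst (fst y)))"
        have "computable (lift ?\<Delta>)
            (\<lambda>f y. (\<lambda>f y. g f (fst (fst y)) (snd (fst y)) (snd y)) f (?\<pi> y))"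
          by (rule computable_weaken[OF gs[OF that]]) (auto simp: lift_def)
        then show ?thesis by simp
      qed
      from computable_let[OF computable_hd[OF computable_var] this, of snd] show ?thesis
        by (simp add: lift_def)
    qed
    have "computable ?\<Delta> (\<lambda>f y. fold (\<lambda>g r. cons_data (g (hd_data (snd y)) (snd (fst y))) r)
        (map (\<lambda>g. g f (fst (fst y))) hs) (R f y))" if "computable ?\<Delta> R" "set hs \<subseteq> set gs" for hs R
      using that
    proof (induction hs arbitrary: R)
      case (Cons h hs)
      then show ?case using g[of h] by (auto intro!: Cons.IH computable_cons)
    qed simp
    note this[OF computable_hd[OF computable_tl[OF computable_var]] order_refl, of snd]
    then show ?thesis unfolding expand_step_def
      by (intro computable_cons computable_add computable_hd computable_const computable_var)
        (auto simp: lift_def)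
  qed
  have eq: "fold (\<lambda>a acc. ?G f ((x, a), acc)) xs (Lst [Num 0, Lst []])
      = Lst [Num (int (length xs)), Lst (rev (expand_list (map (\<lambda>g. g f x) gs) xs))]" for f x xs
    using fold_expand_step[of "map (\<lambda>g. g f x) gs" xs] by simp
  have "computable \<Gamma> (\<lambda>f x. fold (\<lambda>a acc. ?G f ((x, a), acc)) (items (L f x)) (Lst [Num 0, Lst []]))"
  proof (rule computable_fold[OF L computable_const step])
    fix p
    obtain q where q: "\<And>f x. bounded_oracle p f \<Longrightarrow> bits (L f x) \<le> poly q (ctx_size \<Gamma> x)"
      using computable_bits[OF L] by blast
    obtain r where r: "\<And>g f y. g \<in> set gs \<Longrightarrow> bounded_oracle p f \<Longrightarrow>
        bits (g f (fst (fst y)) (snd (fst y)) (snd y)) \<le> poly r (ctx_size (lift (lift \<Gamma>)) y)"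
      using computable_bits_list[where F = "\<lambda>g f y. g f (fst (fst y)) (snd (fst y)) (snd y)", OF gs, of gs p]
      by blast
    let ?r = "pcompose r ([:1, 1:] + [:2:] * q)"
    let ?q = "[:5:] + q + q * [:length gs:] * ?r"
    have "bits (Lst [Num (int (length ys)), Lst (rev (expand_list (map (\<lambda>g. g f x) gs) ys))])
        \<le> poly ?q (ctx_size \<Gamma> x)" if b: "bounded_oracle p f" and ys: "items (L f x) = ys @ zs" for f x ys zs
    proof -
      have len: "length ys \<le> poly q (ctx_size \<Gamma> x)"
        using length_items_le[of "L f x"] q[OF b, of x] ys by simp
      have "bits a \<le> poly ?r (ctx_size \<Gamma> x)" if "a \<in> set (expand_list (map (\<lambda>g. g f x) gs) ys)" for a
      proof -
        from that obtain i g b' where *: "i < length ys" "g \<in> set gs" "b' \<in> set ys" "a = g f x (Num (int i)) b'"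
          by (auto elim!: set_expand_list)
        have "bits b' \<le> poly q (ctx_size \<Gamma> x)"
          using bits_items_le[of b' "L f x"] q[OF b, of x] ys *(3) by auto
        moreover have "bits (Num (int i)) \<le> 1 + poly q (ctx_size \<Gamma> x)"
          using bitlen_nat_le[of i] *(1) len by simp
        ultimately have "poly r (ctx_size (lift (lift \<Gamma>)) ((x, Num (int i)), b')) \<le> poly ?r (ctx_size \<Gamma> x)"
          by (simp add: poly_pcompose ctx_size_lift del: bits.simps) (rule poly_nat_mono, simp)
        with r[OF *(2) b, of "((x, Num (int i)), b')"] *(4) show ?thesis by simp
      qed
      then have "bits (Lst (rev (expand_list (map (\<lambda>g. g f x) gs) ys)))
          \<le> 1 + length ys * length gs * poly ?r (ctx_size \<Gamma> x)"
        using bits_Lst_le[of "rev (expand_list (map (\<lambda>g. g f x) gs) ys)" "poly ?r (ctx_size \<Gamma> x)"]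
        by (simp add: length_expand_list)
      also have "\<dots> \<le> 1 + poly q (ctx_size \<Gamma> x) * length gs * poly ?r (ctx_size \<Gamma> x)"
        using len by (intro add_mono mult_le_mono) auto
      finally show ?thesis using len bitlen_nat_le[of "length ys"]
        by (simp add: algebra_simps)
    qed
    then have "\<forall>f x ys zs. bounded_oracle p f \<longrightarrow> items (L f x) = ys @ zs \<longrightarrow>
        bits (fold (\<lambda>a acc. ?G f ((x, a), acc)) ys (Lst [Num 0, Lst []])) \<le> poly ?q (ctx_size \<Gamma> x)"
      unfolding eq by blast
    then show "\<exists>q. \<forall>f x ys zs. bounded_oracle p f \<longrightarrow> items (L f x) = ys @ zs \<longrightarrow>
        bits (fold (\<lambda>a acc. ?G f ((x, a), acc)) ys (Lst [Num 0, Lst []])) \<le> poly q (ctx_size \<Gamma> x)"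
      by (rule exI)
  qed
  from computable_rev[OF computable_hd[OF computable_tl[OF this]]] show ?thesis
    unfolding eq by simp
qed

text \<open>The second argument is a datum of unknown shape, an answer of the oracle. Therefore the
  recursion is over the first list alone, with total head and tail operations on the other
  side.\<close>

primrec all2_data :: "(data \<Rightarrow> data \<Rightarrow> bool) \<Rightarrow> data list \<Rightarrow> data \<Rightarrow> bool" where
  "all2_data P [] d = True"
| "all2_data P (a # xs) d = (P a (hd_data d) \<and> all2_data P xs (tl_data d))"

lemma mul_bool_data [simp]: "mul_data (bool_data a) (bool_data b) = bool_data (a \<and> b)"
  by (simp add: bool_data_def)

definition all2_step :: "(data \<Rightarrow> data \<Rightarrow> bool) \<Rightarrow> data \<Rightarrow> data \<Rightarrow> data" where
  "all2_step P a acc = cons_data (mul_data (hd_data acc) (bool_data (P a (hd_data (hd_data (tl_data acc))))))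
     (cons_data (tl_data (hd_data (tl_data acc))) (Lst []))"

lemma fold_all2_step:
  "fold (all2_step P) xs (Lst [bool_data b, d])
    = Lst [bool_data (b \<and> all2_data P xs d), (tl_data ^^ length xs) d]"
  by (induction xs arbitrary: b d) (auto simp: all2_step_def conj_assoc funpow_swap1)

lemma bits_funpow_tl_data: "bits ((tl_data ^^ k) d) \<le> bits d"
  by (induction k) (auto intro: order_trans[OF bits_tl_data])

lemma computable_all2:
  assumes L: "computable \<Gamma> L" and R: "computable \<Gamma> R"
    and P: "computable (lift (lift \<Gamma>)) (\<lambda>f y. bool_data (P f (fst (fst y)) (snd (fst y)) (snd y)))"
  shows "computable \<Gamma> (\<lambda>f x. bool_data (all2_data (P f x) (items (L f x)) (R f x)))"
proof -
  let ?G = "\<lambda>f y. all2_step (P f (fst (fst y))) (snd (fst y)) (snd y)"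
  let ?\<Delta> = "lift (lift \<Gamma>)"
  let ?b = "\<lambda>f y. hd_data (hd_data (tl_data (snd y)))"
  have "computable (lift ?\<Delta>) (\<lambda>f y. bool_data (P f (fst (fst (fst y))) (snd (fst (fst y))) (snd y)))"
  proof -
    let ?\<pi> = "\<lambda>y. ((fst (fst (fst y)), snd (fst (fst y))), snd y)"
    have "computable (lift ?\<Delta>)
        (\<lambda>f y. (\<lambda>f y. bool_data (P f (fst (fst y)) (snd (fst y)) (snd y))) f (?\<pi> y))"
      by (rule computable_weaken[OF P]) (auto simp: lift_def)
    then show ?thesis by simp
  qed
  moreover have "computable ?\<Delta> ?b"
    by (intro computable_hd computable_tl computable_var) (simp add: lift_def)
  ultimately have "computable ?\<Delta> (\<lambda>f y. bool_data (P f (fst (fst y)) (snd (fst y)) (?b f y)))"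
    using computable_let[of ?\<Delta> ?b] by fastforce
  then have step: "computable ?\<Delta> ?G"
    unfolding all2_step_def
    by (intro computable_cons computable_mul computable_hd computable_tl computable_const computable_var)
      (auto simp: lift_def)
  have eq: "fold (\<lambda>a acc. ?G f ((x, a), acc)) xs (Lst [bool_data True, d])
      = Lst [bool_data (all2_data (P f x) xs d), (tl_data ^^ length xs) d]" for f x xs d
    using fold_all2_step[of "P f x" xs True d] by simp
  have "computable \<Gamma> (\<lambda>f x. fold (\<lambda>a acc. ?G f ((x, a), acc)) (items (L f x))
      (cons_data (bool_data True) (cons_data (R f x) (Lst []))))"
  proof (rule computable_fold[OF L _ step])
    show "computable \<Gamma> (\<lambda>f x. cons_data (bool_data True) (cons_data (R f x) (Lst [])))"
      by (intro computable_cons computable_const R)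
    fix p
    obtain q where q: "\<And>f x. bounded_oracle p f \<Longrightarrow> bits (R f x) \<le> poly q (ctx_size \<Gamma> x)"
      using computable_bits[OF R] by blast
    let ?q = "[:3:] + q"
    have "bits (Lst [bool_data b, (tl_data ^^ k) (R f x)]) \<le> poly ?q (ctx_size \<Gamma> x)"
      if "bounded_oracle p f" for f x b k
      using q[OF that, of x] bits_bool_data[of b] bits_funpow_tl_data[of k "R f x"] by simp
    then have "\<forall>f x ys zs. bounded_oracle p f \<longrightarrow> items (L f x) = ys @ zs \<longrightarrow>
        bits (fold (\<lambda>a acc. ?G f ((x, a), acc)) ys
          (cons_data (bool_data True) (cons_data (R f x) (Lst [])))) \<le> poly ?q (ctx_size \<Gamma> x)"
      unfolding eq data_op_simps by blast
    then show "\<exists>q. \<forall>f x ys zs. bounded_oracle p f \<longrightarrow> items (L f x) = ys @ zs \<longrightarrow>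
        bits (fold (\<lambda>a acc. ?G f ((x, a), acc)) ys (cons_data (bool_data True) (cons_data (R f x) (Lst []))))
          \<le> poly q (ctx_size \<Gamma> x)"
      by (rule exI)
  qed
  from computable_hd[OF this] show ?thesis
    by (simp add: fold_all2_step[of _ _ True, simplified])
qed


subsection \<open>Replacing the answers to queries by a subroutine\<close>

fun expr_bound :: "expr \<Rightarrow> nat" where
  "expr_bound (Var x) = Suc x"
| "expr_bound (Const c) = 0"
| "expr_bound (Head e) = expr_bound e"
| "expr_bound (Tail e) = expr_bound e"
| "expr_bound (IsNum e) = expr_bound e"
| "expr_bound (Cons e e') = max (expr_bound e) (expr_bound e')"
| "expr_bound (Add e e') = max (expr_bound e) (expr_bound e')"
| "expr_bound (Sub e e') = max (expr_bound e) (expr_bound e')"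
| "expr_bound (Mul e e') = max (expr_bound e) (expr_bound e')"
| "expr_bound (Quot e e') = max (expr_bound e) (expr_bound e')"
| "expr_bound (Rem e e') = max (expr_bound e) (expr_bound e')"
| "expr_bound (Less e e') = max (expr_bound e) (expr_bound e')"
| "expr_bound (Equal e e') = max (expr_bound e) (expr_bound e')"

fun com_bound :: "com \<Rightarrow> nat" where
  "com_bound Skip = 0"
| "com_bound (Assign x e) = max (Suc x) (expr_bound e)"
| "com_bound (Query x e) = max (Suc x) (expr_bound e)"
| "com_bound (Seq c d) = max (com_bound c) (com_bound d)"
| "com_bound (Cond e c d) = max (expr_bound e) (max (com_bound c) (com_bound d))"
| "com_bound (While e c) = max (expr_bound e) (com_bound c)"

lemma eval_expr_cong: "(\<And>v. v < expr_bound e \<Longrightarrow> r v = s v) \<Longrightarrow> eval_expr e r = eval_expr e s"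
  and cost_cong: "(\<And>v. v < expr_bound e \<Longrightarrow> r v = s v) \<Longrightarrow> cost e r = cost e s"
  by (induction e) (auto split: data.split)

lemma bits_le_cost: "bits (eval_expr e s) \<le> cost e s"
  by (cases e) (simp_all only: cost.simps)

fun replace_query :: "nat \<Rightarrow> com \<Rightarrow> com \<Rightarrow> com" where
  "replace_query K d (Query x e) = Seq (Assign K e) (Seq d (Assign x (Var (Suc K))))"
| "replace_query K d (Seq c c') = Seq (replace_query K d c) (replace_query K d c')"
| "replace_query K d (Cond e c c') = Cond e (replace_query K d c) (replace_query K d c')"
| "replace_query K d (While e c) = While e (replace_query K d c)"
| "replace_query K d c = c"

lemma scaled_time:
  fixes W :: nat
  assumes "1 \<le> W" "u \<le> t * W" "u' \<le> t' * W"
  shows "k + u + u' \<le> (k + t + t') * W"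
proof -
  have "k \<le> k * W" using mult_le_mono2[OF assms(1), of k] by (simp only: mult_1_right)
  then show ?thesis using assms(2,3) unfolding add_mult_distrib by linarith
qed

text \<open>The simulating run agrees with the original one below \<open>K\<close>; the subroutine
  works from \<open>K\<close> on. \<open>T\<close> bounds the whole run and stays fixed while
  \<open>t\<close> varies over its parts. Since a query is charged for writing it down, its size is
  at most \<open>T\<close>, so the time of the subroutine and the size of its answer are at most
  \<open>poly q T\<close>. This gives the factor \<open>4 + T + 2 * poly q T\<close> for one query,
  and all other steps stay below it.\<close>

lemma exec_replace_query:
  assumes d: "implements d [K] (Suc K) [\<lambda>x. x] A p q"
    and "exec (A f) c s t s'" "com_bound c \<le> K" "\<forall>v<K. r v = s v"
    and T: "t \<le> T"
  shows "\<exists>t' r'. exec f (replace_query K d c) r t' r' \<and> (\<forall>v<K. r' v = s' v) \<and>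
    (bounded_oracle p f \<longrightarrow> t' \<le> t * (4 + T + 2 * poly q T))"
  using assms(2-5)
proof (induction arbitrary: r rule: exec.induct)
  case (1 s)
  then show ?case
    by (intro exI[of _ 1] exI[of _ r]) (auto intro: exec.intros(1) simp: One_nat_def[symmetric] simp del: One_nat_def)
next
  case (2 x e s)
  have "eval_expr e r = eval_expr e s" "cost e r = cost e s"
    using 2 by (auto intro!: eval_expr_cong cost_cong)
  then have "exec f (Assign x e) r (1 + cost e s) (r(x := eval_expr e s))"
    using exec.intros(2)[of f x e r] by simp
  moreover have "\<forall>v<K. (r(x := eval_expr e s)) v = (s(x := eval_expr e s)) v" using 2 by simp
  moreover have "1 + cost e s \<le> (1 + cost e s) * (4 + T + 2 * poly q T)"
    using scaled_time[of "4 + T + 2 * poly q T" 0 0 0 0 "1 + cost e s"] by simp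
  ultimately show ?case unfolding replace_query.simps by blast
next
  case (3 x e s)
  let ?z = "eval_expr e s"
  have eq: "eval_expr e r = ?z" "cost e r = cost e s"
    using 3 by (auto intro!: eval_expr_cong cost_cong)
  let ?r = "r(K := ?z)"
  have e1: "exec f (Assign K e) r (1 + cost e s) ?r"
    using exec.intros(2)[of f K e r] eq by simp
  have "map ?r [K] = map (\<lambda>g. g ?z) [\<lambda>x. x]" by simp
  from implementsE[OF d this, of f] obtain u r2 where 2:
    "exec f d ?r u r2" "r2 (Suc K) = A f ?z" "\<And>v. v < Suc K \<Longrightarrow> r2 v = ?r v"
    "bounded_oracle p f \<Longrightarrow> u \<le> poly q (bits ?z)"
    "bounded_oracle p f \<Longrightarrow> bits (A f ?z) \<le> poly q (bits ?z)" by (auto simp: ctx_size_def)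
  have e3: "exec f (Assign x (Var (Suc K))) r2 (1 + bits (A f ?z)) (r2(x := A f ?z))"
    using exec.intros(2)[of f x "Var (Suc K)" r2] 2(2) by simp
  let ?t = "1 + (1 + cost e s) + (1 + u + (1 + bits (A f ?z)))"
  have "exec f (replace_query K d (Query x e)) r ?t (r2(x := A f ?z))"
    unfolding replace_query.simps by (rule exec.intros(4)[OF e1 exec.intros(4)[OF 2(1) e3]])
  moreover have "?t \<le> (1 + cost e s) * (4 + T + 2 * poly q T)" if b: "bounded_oracle p f"
  proof -
    have "bits ?z \<le> T" using bits_le_cost[of e s] 3 by simp
    then have "poly q (bits ?z) \<le> poly q T" by (rule poly_nat_mono)
    then have "?t \<le> 1 * (4 + T + 2 * poly q T)" using 2(4,5)[OF b] 3 by simp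
    also have "\<dots> \<le> (1 + cost e s) * (4 + T + 2 * poly q T)" by (rule mult_right_mono) simp_all
    finally show ?thesis .
  qed
  moreover have "\<forall>v<K. (r2(x := A f ?z)) v = (s(x := A f ?z)) v" using 2(3) 3 by simp
  ultimately show ?case by blast
next
  case (4 c\<^sub>1 s t\<^sub>1 s' c\<^sub>2 t\<^sub>2 s'')
  let ?W = "4 + T + 2 * poly q T"
  have k: "com_bound c\<^sub>1 \<le> K" "com_bound c\<^sub>2 \<le> K" "t\<^sub>1 \<le> T" "t\<^sub>2 \<le> T" using 4 by auto
  from 4(3)[OF k(1) 4(6) k(3)] obtain u1 r1 where 1: "exec f (replace_query K d c\<^sub>1) r u1 r1"
    "\<forall>v<K. r1 v = s' v" "bounded_oracle p f \<longrightarrow> u1 \<le> t\<^sub>1 * ?W" by blast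
  from 4(4)[OF k(2) 1(2) k(4)] obtain u2 r2 where 2: "exec f (replace_query K d c\<^sub>2) r1 u2 r2"
    "\<forall>v<K. r2 v = s'' v" "bounded_oracle p f \<longrightarrow> u2 \<le> t\<^sub>2 * ?W" by blast
  have "exec f (replace_query K d (Seq c\<^sub>1 c\<^sub>2)) r (1 + u1 + u2) r2"
    unfolding replace_query.simps by (rule exec.intros(4)[OF 1(1) 2(1)])
  moreover have "1 + u1 + u2 \<le> (1 + t\<^sub>1 + t\<^sub>2) * ?W" if "bounded_oracle p f"
    using 1(3) 2(3) that by (intro scaled_time) auto
  ultimately show ?case using 2(2) by blast
next
  case (5 e s c\<^sub>1 t s' c\<^sub>2)
  let ?W = "4 + T + 2 * poly q T"
  have eq: "eval_expr e r = Num 1" "cost e r = cost e s"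
    using 5 eval_expr_cong[of e r s] cost_cong[of e r s] by auto
  have "com_bound c\<^sub>1 \<le> K" "t \<le> T" using 5 by auto
  from 5(3)[OF this(1) 5(5) this(2)] obtain u1 r1 where 1: "exec f (replace_query K d c\<^sub>1) r u1 r1"
    "\<forall>v<K. r1 v = s' v" "bounded_oracle p f \<longrightarrow> u1 \<le> t * ?W" by blast
  have "exec f (replace_query K d (Cond e c\<^sub>1 c\<^sub>2)) r (1 + cost e s + u1) r1"
    using exec.intros(5)[OF eq(1) 1(1)] eq(2) by simp
  moreover have "1 + cost e s + u1 \<le> (1 + cost e s + t) * ?W" if "bounded_oracle p f"
    using scaled_time[of ?W u1 t 0 0 "1 + cost e s"] 1(3) that by simp
  ultimately show ?case using 1(2) by blast
next
  case (6 e s c\<^sub>2 t s' c\<^sub>1)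
  let ?W = "4 + T + 2 * poly q T"
  have eq: "eval_expr e r \<noteq> Num 1" "cost e r = cost e s"
    using 6 eval_expr_cong[of e r s] cost_cong[of e r s] by auto
  have "com_bound c\<^sub>2 \<le> K" "t \<le> T" using 6 by auto
  from 6(3)[OF this(1) 6(5) this(2)] obtain u1 r1 where 1: "exec f (replace_query K d c\<^sub>2) r u1 r1"
    "\<forall>v<K. r1 v = s' v" "bounded_oracle p f \<longrightarrow> u1 \<le> t * ?W" by blast
  have "exec f (replace_query K d (Cond e c\<^sub>1 c\<^sub>2)) r (1 + cost e s + u1) r1"
    using exec.intros(6)[OF eq(1) 1(1)] eq(2) by simp
  moreover have "1 + cost e s + u1 \<le> (1 + cost e s + t) * ?W" if "bounded_oracle p f"
    using scaled_time[of ?W u1 t 0 0 "1 + cost e s"] 1(3) that by simp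
  ultimately show ?case using 1(2) by blast
next
  case (7 e s c)
  have eq: "eval_expr e r \<noteq> Num 1" "cost e r = cost e s"
    using 7 eval_expr_cong[of e r s] cost_cong[of e r s] by auto
  have "exec f (replace_query K d (While e c)) r (1 + cost e s) r"
    using exec.intros(7)[OF eq(1)] eq(2) by simp
  moreover have "1 + cost e s \<le> (1 + cost e s) * (4 + T + 2 * poly q T)"
    using scaled_time[of "4 + T + 2 * poly q T" 0 0 0 0 "1 + cost e s"] by simp
  ultimately show ?case using 7 by blast
next
  case (8 e s c t\<^sub>1 s' t\<^sub>2 s'')
  let ?W = "4 + T + 2 * poly q T"
  have eq: "eval_expr e r = Num 1" "cost e r = cost e s"
    using 8 eval_expr_cong[of e r s] cost_cong[of e r s] by auto
  have k: "com_bound c \<le> K" "t\<^sub>1 \<le> T" "t\<^sub>2 \<le> T" using 8 by auto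
  from 8(4)[OF k(1) 8(7) k(2)] obtain u1 r1 where 1: "exec f (replace_query K d c) r u1 r1"
    "\<forall>v<K. r1 v = s' v" "bounded_oracle p f \<longrightarrow> u1 \<le> t\<^sub>1 * ?W" by blast
  from 8(5)[OF 8(6) 1(2) k(3)] obtain u2 r2 where 2: "exec f (replace_query K d (While e c)) r1 u2 r2"
    "\<forall>v<K. r2 v = s'' v" "bounded_oracle p f \<longrightarrow> u2 \<le> t\<^sub>2 * ?W" by blast
  have "exec f (replace_query K d (While e c)) r (1 + cost e s + u1 + u2) r2"
    using exec.intros(8)[OF eq(1) 1(1) 2(1)[unfolded replace_query.simps]] eq(2) by simp
  moreover have "1 + cost e s + u1 + u2 \<le> (1 + cost e s + t\<^sub>1 + t\<^sub>2) * ?W" if "bounded_oracle p f"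
    using 1(3) 2(3) that by (intro scaled_time) auto
  ultimately show ?case using 2(2) by blast
qed

text \<open>The time bound of the given program is available for oracles with bounded answers.
  \<open>A f\<close> is such an oracle whenever \<open>f\<close> is, with a polynomial
  \<open>r\<close> that depends on \<open>p\<close>, while the combined program is the same for all
  \<open>p\<close>.\<close>

theorem turing_reducible_trans:
  assumes red: "turing_reducible L R" and A: "computable [\<lambda>x. x] A"
    and solves: "\<And>f. solves f R' \<Longrightarrow> solves (A f) R"
  shows "turing_reducible L R'"
proof -
  from red obtain c where
    c1: "\<And>f x. solves f R \<Longrightarrow> \<exists>t. runs f c x t (bool_data (x \<in> L))" and
    c2: "\<And>p. \<exists>q :: nat poly. \<forall>f. solves f R \<and> (\<forall>z. bits (f z) \<le> poly p (bits z)) \<longrightarrow>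
        (\<forall>x. \<exists>t \<le> poly q (bits x). runs f c x t (bool_data (x \<in> L)))"
    unfolding turing_reducible_def by blast
  \<comment> \<open>The successor keeps variable 0, which carries input and output, below
    \<open>K\<close> even if \<open>c\<close> mentions no variable.\<close>
  define K where "K = Suc (com_bound c)"
  obtain d where d: "\<And>p. \<exists>q. implements d [K] (Suc K) [\<lambda>x. x] A p q"
    using computableE[OF A, of "[K]" "Suc K"] by auto
  let ?c = "replace_query K d c"
  have sim: "\<exists>t'. runs f ?c x t' y \<and> (bounded_oracle p f \<longrightarrow> t' \<le> t * (4 + t + 2 * poly q t))"
    if "runs (A f) c x t y" and q: "implements d [K] (Suc K) [\<lambda>x. x] A p q" for f x t y p q
  proof -
    from that obtain s where s: "exec (A f) c ((\<lambda>_. Lst [])(0 := x)) t s" "s 0 = y"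
      by (auto simp: runs_def)
    have "com_bound c \<le> K" by (simp add: K_def)
    from exec_replace_query[OF q s(1) this allI[OF impI[OF refl]] order_refl]
    obtain t' r where r: "exec f ?c ((\<lambda>_. Lst [])(0 := x)) t' r" "\<forall>v<K. r v = s v"
      "bounded_oracle p f \<longrightarrow> t' \<le> t * (4 + t + 2 * poly q t)" by blast
    moreover have "r 0 = y" using r(2) s(2) by (simp add: K_def)
    ultimately show ?thesis unfolding runs_def by blast
  qed
  show ?thesis
    unfolding turing_reducible_def
  proof (intro exI[of _ ?c] conjI allI impI)
    fix f x assume "solves f R'"
    then obtain t where "runs (A f) c x t (bool_data (x \<in> L))" using c1 solves by blast
    moreover obtain q where "implements d [K] (Suc K) [\<lambda>x. x] A 0 q" using d by blast
    ultimately show "\<exists>t. runs f ?c x t (bool_data (x \<in> L))" using sim by meson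
  next
    fix p
    obtain q where q: "implements d [K] (Suc K) [\<lambda>x. x] A p q" using d by blast
    obtain r where r: "\<And>f x. bounded_oracle p f \<Longrightarrow> bits (A f x) \<le> poly r (bits x)"
      using computable_bits[OF A, of p] by (auto simp: ctx_size_def)
    obtain u where u: "\<And>f x. solves f R \<Longrightarrow> (\<And>z. bits (f z) \<le> poly r (bits z)) \<Longrightarrow>
        \<exists>t \<le> poly u (bits x). runs f c x t (bool_data (x \<in> L))"
      using c2[of r] by blast
    let ?u = "u * ([:4:] + u + [:2:] * pcompose q u)"
    have "\<exists>t \<le> poly ?u (bits x). runs f ?c x t (bool_data (x \<in> L))"
      if f: "solves f R'" "\<forall>z. bits (f z) \<le> poly p (bits z)" for f x
    proof -
      have b: "bounded_oracle p f" using f by (simp add: bounded_oracle_def)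
      from u[OF solves[OF f(1)] r[OF b]] obtain t where
        t: "t \<le> poly u (bits x)" "runs (A f) c x t (bool_data (x \<in> L))" by blast
      from sim[OF t(2) q] b obtain t' where
        t': "runs f ?c x t' (bool_data (x \<in> L))" "t' \<le> t * (4 + t + 2 * poly q t)" by blast
      have "t * (4 + t + 2 * poly q t) \<le> poly ?u (bits x)"
        using t(1) by (simp add: poly_pcompose mult_le_mono add_mono poly_nat_mono)
      then show ?thesis using t' by (meson order_trans)
    qed
    then show "\<exists>q. \<forall>f. solves f R' \<and> (\<forall>z. bits (f z) \<le> poly p (bits z)) \<longrightarrow>
        (\<forall>x. \<exists>t \<le> poly q (bits x). runs f ?c x t (bool_data (x \<in> L)))"
      by blast
  qed
qed

section \<open>Positive semidefinite forms\<close>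

text \<open>Matrices are replaced by functions of two indices, read only below \<open>n\<close>, so
  that blocks, contractions and sums need no carriers.\<close>

definition qform :: "nat \<Rightarrow> (nat \<Rightarrow> nat \<Rightarrow> complex) \<Rightarrow> (nat \<Rightarrow> complex) \<Rightarrow> complex" where
  "qform n a v = (\<Sum>i<n. \<Sum>j<n. a i j * v j * cnj (v i))"

definition psd_form :: "nat \<Rightarrow> (nat \<Rightarrow> nat \<Rightarrow> complex) \<Rightarrow> bool" where
  "psd_form n a \<longleftrightarrow> (\<forall>i<n. \<forall>j<n. a i j = cnj (a j i)) \<and> (\<forall>v. 0 \<le> Re (qform n a v))"

abbreviation entry :: "complex mat \<Rightarrow> nat \<Rightarrow> nat \<Rightarrow> complex" where
  "entry A \<equiv> (\<lambda>i j. A $$ (i, j))"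

lemma qform_cong:
  assumes "\<And>i j. i < n \<Longrightarrow> j < n \<Longrightarrow> a i j = b i j"
  shows "qform n a v = qform n b v"
  unfolding qform_def using assms by (intro sum.cong refl) simp

lemma psd_formI:
  assumes "\<And>i j. i < n \<Longrightarrow> j < n \<Longrightarrow> a i j = cnj (a j i)" "\<And>v. 0 \<le> Re (qform n a v)"
  shows "psd_form n a"
  using assms unfolding psd_form_def by blast

lemma psd_form_hermitian: "psd_form n a \<Longrightarrow> i < n \<Longrightarrow> j < n \<Longrightarrow> a i j = cnj (a j i)"
  unfolding psd_form_def by blast

lemma psd_form_nonneg: "psd_form n a \<Longrightarrow> 0 \<le> Re (qform n a v)"
  unfolding psd_form_def by blast

lemma psd_form_cong:
  assumes eq: "\<And>i j. i < n \<Longrightarrow> j < n \<Longrightarrow> a i j = b i j" and a: "psd_form n a"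
  shows "psd_form n b"
proof (rule psd_formI)
  fix i j assume "i < n" "j < n"
  then show "b i j = cnj (b j i)" using psd_form_hermitian[OF a, of i j] eq[of i j] eq[of j i] by simp
next
  fix v
  have "qform n a v = qform n b v" by (rule qform_cong[OF eq])
  then show "0 \<le> Re (qform n b v)" using psd_form_nonneg[OF a, of v] by simp
qed

lemma mat_adjoint_entry:
  assumes "A \<in> carrier_mat n m" "i < m" "j < n"
  shows "mat_adjoint A $$ (i, j) = cnj (A $$ (j, i))"
  using assms by (auto simp: mat_adjoint_def mat_of_rows_def)

lemma mat_adjoint_carrier: "A \<in> carrier_mat n m \<Longrightarrow> mat_adjoint A \<in> carrier_mat m n"
  by (auto simp: mat_adjoint_def)

lemma hermitian_iff:
  "hermitian n A \<longleftrightarrow> A \<in> carrier_mat n n \<and> (\<forall>i<n. \<forall>j<n. A $$ (i, j) = cnj (A $$ (j, i)))"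
proof
  assume h: "hermitian n A"
  then have c: "A \<in> carrier_mat n n" "mat_adjoint A = A" by (auto simp: hermitian_def)
  have "A $$ (i, j) = cnj (A $$ (j, i))" if "i < n" "j < n" for i j
    using mat_adjoint_entry[OF c(1) that] unfolding c(2) .
  with c(1) show "A \<in> carrier_mat n n \<and> (\<forall>i<n. \<forall>j<n. A $$ (i, j) = cnj (A $$ (j, i)))"
    by blast
next
  assume "A \<in> carrier_mat n n \<and> (\<forall>i<n. \<forall>j<n. A $$ (i, j) = cnj (A $$ (j, i)))"
  then have A: "A \<in> carrier_mat n n" and h: "\<And>i j. i < n \<Longrightarrow> j < n \<Longrightarrow> A $$ (i, j) = cnj (A $$ (j, i))"
    by blast+
  have "mat_adjoint A = A"
  proof (rule eq_matI)
    fix i j assume "i < dim_row A" "j < dim_col A"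
    then have ij: "i < n" "j < n" using A by auto
    show "mat_adjoint A $$ (i, j) = A $$ (i, j)"
      using mat_adjoint_entry[OF A ij] h[OF ij] by (rule trans[OF _ sym])
  qed (use A mat_adjoint_carrier[OF A] in auto)
  then show "hermitian n A" using A by (simp add: hermitian_def)
qed

lemma qform_inner:
  assumes "A \<in> carrier_mat n n"
  shows "(A *\<^sub>v vec n v) \<bullet>c vec n v = qform n (entry A) v"
proof -
  have "(A *\<^sub>v vec n v) \<bullet>c vec n v = (\<Sum>i<n. (\<Sum>j<n. A $$ (i, j) * v j) * cnj (v i))"
    using assms by (auto simp: scalar_prod_def atLeast0LessThan intro!: sum.cong)
  then show ?thesis by (simp add: qform_def sum_distrib_right)
qed

lemma psd_iff: "psd n A \<longleftrightarrow> A \<in> carrier_mat n n \<and> psd_form n (entry A)"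
proof -
  have "(\<forall>v\<in>carrier_vec n. 0 \<le> Re ((A *\<^sub>v v) \<bullet>c v)) \<longleftrightarrow> (\<forall>v. 0 \<le> Re (qform n (entry A) v))"
    if A: "A \<in> carrier_mat n n"
  proof
    assume "\<forall>v\<in>carrier_vec n. 0 \<le> Re ((A *\<^sub>v v) \<bullet>c v)"
    then show "\<forall>v. 0 \<le> Re (qform n (entry A) v)" using qform_inner[OF A] by (metis vec_carrier)
  next
    assume *: "\<forall>v. 0 \<le> Re (qform n (entry A) v)"
    show "\<forall>v\<in>carrier_vec n. 0 \<le> Re ((A *\<^sub>v v) \<bullet>c v)"
    proof
      fix v :: "complex vec" assume v: "v \<in> carrier_vec n"
      then have "vec n (\<lambda>i. v $ i) = v" by auto
      then show "0 \<le> Re ((A *\<^sub>v v) \<bullet>c v)" using * qform_inner[OF A, of "\<lambda>i. v $ i"] by simp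
    qed
  qed
  then show ?thesis by (auto simp: psd_def hermitian_iff psd_form_def)
qed

lemma psd_form_zero: "psd_form n (\<lambda>i j. 0)"
  by (simp add: psd_form_def qform_def)

lemma qform_scale: "qform n (\<lambda>i j. c * a i j) v = c * qform n a v"
  by (simp add: qform_def sum_distrib_left mult.assoc)

lemma qform_add: "qform n (\<lambda>i j. a i j + b i j) v = qform n a v + qform n b v"
  by (simp add: qform_def sum.distrib distrib_right)

lemma psd_form_scale:
  assumes "psd_form n a" "0 \<le> r"
  shows "psd_form n (\<lambda>i j. complex_of_real r * a i j)"
proof (rule psd_formI)
  fix i j assume "i < n" "j < n"
  from psd_form_hermitian[OF assms(1) this]
  show "complex_of_real r * a i j = cnj (complex_of_real r * a j i)" by simp
next
  fix v show "0 \<le> Re (qform n (\<lambda>i j. complex_of_real r * a i j) v)"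
    using psd_form_nonneg[OF assms(1)] assms(2) by (simp add: qform_scale)
qed

lemma psd_form_add:
  assumes "psd_form n a" "psd_form n b"
  shows "psd_form n (\<lambda>i j. a i j + b i j)"
proof (rule psd_formI)
  fix i j assume ij: "i < n" "j < n"
  show "a i j + b i j = cnj (a j i + b j i)"
    using psd_form_hermitian[OF assms(1) ij] psd_form_hermitian[OF assms(2) ij] by simp
next
  fix v show "0 \<le> Re (qform n (\<lambda>i j. a i j + b i j) v)"
    using psd_form_nonneg[OF assms(1)] psd_form_nonneg[OF assms(2)] by (simp add: qform_add)
qed

lemma qform_two_points:
  assumes "i < n" "j < n" "i \<noteq> j"
  shows "qform n a (\<lambda>k. if k = i then x else if k = j then y else 0)
    = a i i * x * cnj x + a i j * y * cnj x + a j i * x * cnj y + a j j * y * cnj y"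
proof -
  let ?v = "\<lambda>k. if k = i then x else if k = j then y else 0"
  have inner: "(\<Sum>l<n. a k l * ?v l * cnj (?v k)) = (a k i * x + a k j * y) * cnj (?v k)" for k
  proof -
    have "(\<Sum>l<n. a k l * ?v l * cnj (?v k)) = (\<Sum>l\<in>{i, j}. a k l * ?v l * cnj (?v k))"
      by (rule sum.mono_neutral_right) (use assms in auto)
    then show ?thesis using assms(3) by (simp add: distrib_right)
  qed
  have "qform n a ?v = (\<Sum>k<n. (a k i * x + a k j * y) * cnj (?v k))"
    unfolding qform_def inner ..
  also have "\<dots> = (\<Sum>k\<in>{i, j}. (a k i * x + a k j * y) * cnj (?v k))"
    by (rule sum.mono_neutral_right) (use assms in auto)
  finally show ?thesis using assms(3) by (simp add: algebra_simps)
qed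

lemma psd_form_diag:
  assumes "psd_form n a" "i < n"
  shows "0 \<le> Re (a i i)" "a i i = complex_of_real (Re (a i i))"
proof -
  have "a i i = cnj (a i i)" using psd_form_hermitian[OF assms(1) assms(2) assms(2)] .
  then show "a i i = complex_of_real (Re (a i i))" by (simp add: complex_eq_iff)
  have "qform n a (\<lambda>k. if k = i then 1 else 0) = (\<Sum>k<n. \<Sum>l<n. if l = i then a k l * cnj (if k = i then 1 else 0) else 0)"
    unfolding qform_def by (intro sum.cong refl) auto
  also have "\<dots> = (\<Sum>k<n. if k = i then a k i else 0)"
    using assms(2) by (intro sum.cong refl) auto
  finally have "qform n a (\<lambda>k. if k = i then 1 else 0) = a i i" using assms(2) by simp
  then show "0 \<le> Re (a i i)" using psd_form_nonneg[OF assms(1)] by metis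
qed

text \<open>The form is evaluated at the vector with entry \<open>- s * c\<close> at
  \<open>i\<close> and \<open>t\<close> at \<open>j\<close>. If \<alpha> is nonzero, s = 1 and t =
  \<alpha> give \<alpha> times the minor. If \<alpha> is 0, the value is \<beta> t^2 - 2 s t |c|^2,
  and t = 1 with s = (\<beta> + 1) / (2 |c|^2) would make it -1 unless \<open>c\<close>
  vanishes.\<close>

lemma psd_form_minor:
  assumes a: "psd_form n a" and ij: "i < n" "j < n"
  shows "(cmod (a i j))\<^sup>2 \<le> Re (a i i) * Re (a j j)"
proof (cases "i = j")
  case True
  have "cmod (a i i) = Re (a i i)"
    using psd_form_diag[OF a ij(1)] by (metis abs_of_nonneg norm_of_real)
  then show ?thesis using True by (simp add: power2_eq_square)
next
  case False
  define c \<alpha> \<beta> where "c = a i j" and "\<alpha> = Re (a i i)" and "\<beta> = Re (a j j)"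
  have eqs: "a i i = complex_of_real \<alpha>" "a j j = complex_of_real \<beta>" "a i j = c" "a j i = cnj c"
    using psd_form_diag[OF a] ij psd_form_hermitian[OF a ij(2,1)] by (auto simp: \<alpha>_def \<beta>_def c_def)
  have \<alpha>: "0 \<le> \<alpha>" using psd_form_diag[OF a ij(1)] by (simp add: \<alpha>_def)
  have cc: "c * cnj c = complex_of_real ((cmod c)\<^sup>2)" by (simp only: complex_norm_square)
  have form: "0 \<le> \<alpha> * s\<^sup>2 * (cmod c)\<^sup>2 - 2 * s * t * (cmod c)\<^sup>2 + \<beta> * t\<^sup>2" for s t :: real
  proof -
    have "qform n a (\<lambda>k. if k = i then complex_of_real (- s) * c else if k = j then complex_of_real t else 0)
      = complex_of_real \<alpha> * complex_of_real s ^ 2 * (c * cnj c)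
        - 2 * complex_of_real s * complex_of_real t * (c * cnj c)
        + complex_of_real \<beta> * complex_of_real t ^ 2"
      unfolding qform_two_points[OF ij False] eqs by (simp add: power2_eq_square algebra_simps)
    also have "\<dots> = complex_of_real (\<alpha> * s\<^sup>2 * (cmod c)\<^sup>2 - 2 * s * t * (cmod c)\<^sup>2 + \<beta> * t\<^sup>2)"
      unfolding cc by simp
    finally show ?thesis
      using psd_form_nonneg[OF a, of "\<lambda>k. if k = i then complex_of_real (- s) * c else if k = j then complex_of_real t else 0"]
      by (simp only: Re_complex_of_real)
  qed
  show ?thesis
  proof (cases "\<alpha> = 0")
    case True
    have "c = 0"
    proof (rule ccontr)
      assume "c \<noteq> 0"
      define K where "K = (cmod c)\<^sup>2"
      have "K \<noteq> 0" using \<open>c \<noteq> 0\<close> by (simp add: K_def)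
      then have eq: "2 * ((\<beta> + 1) / (2 * K)) * 1 * K = \<beta> + 1" by (simp add: field_simps)
      from form[of "(\<beta> + 1) / (2 * K)" 1, folded K_def, unfolded eq] True show False by simp
    qed
    then show ?thesis using True eqs by simp
  next
    case nz: False
    have "\<alpha> * 1\<^sup>2 * (cmod c)\<^sup>2 - 2 * 1 * \<alpha> * (cmod c)\<^sup>2 + \<beta> * \<alpha>\<^sup>2 = \<alpha> * (\<alpha> * \<beta> - (cmod c)\<^sup>2)"
      by (simp add: power2_eq_square right_diff_distrib)
    then have "0 \<le> \<alpha> * (\<alpha> * \<beta> - (cmod c)\<^sup>2)" using form[of 1 \<alpha>] by simp
    then have "0 \<le> \<alpha> * \<beta> - (cmod c)\<^sup>2" using \<alpha> nz by (simp add: zero_le_mult_iff)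
    then show ?thesis by (simp add: c_def \<alpha>_def \<beta>_def)
  qed
qed

lemma psd_form_entry_le:
  assumes "psd_form n a" "i < n" "j < n"
  shows "cmod (a i j) \<le> (Re (a i i) + Re (a j j)) / 2"
proof (rule power2_le_imp_le)
  have "4 * (Re (a i i) * Re (a j j)) \<le> (Re (a i i) + Re (a j j))\<^sup>2"
    using zero_le_power2[of "Re (a i i) - Re (a j j)"] by (simp add: power2_eq_square algebra_simps)
  then show "(cmod (a i j))\<^sup>2 \<le> ((Re (a i i) + Re (a j j)) / 2)\<^sup>2"
    using psd_form_minor[OF assms] by (simp add: power_divide)
  show "0 \<le> (Re (a i i) + Re (a j j)) / 2" using psd_form_diag(1)[OF assms(1)] assms(2,3) by simp
qed

lemma psd_form_entry_le_trace:
  assumes "psd_form n a" "i < n" "j < n"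
  shows "cmod (a i j) \<le> (\<Sum>k<n. Re (a k k))"
proof -
  have "Re (a k k) \<le> (\<Sum>k<n. Re (a k k))" if "k < n" for k
    using that psd_form_diag[OF assms(1)] by (intro member_le_sum) auto
  from this[OF assms(2)] this[OF assms(3)] psd_form_entry_le[OF assms] show ?thesis by simp
qed

section \<open>The Hilbert--Schmidt norm\<close>

lemma hs_norm_eq:
  assumes "A \<in> carrier_mat n n"
  shows "hs_norm A = sqrt (\<Sum>i<n. \<Sum>j<n. (cmod (A $$ (i, j)))\<^sup>2)"
proof -
  have ad: "mat_adjoint A \<in> carrier_mat n n" by (rule mat_adjoint_carrier[OF assms])
  have "mat_trace (mat_adjoint A * A) = (\<Sum>j<n. \<Sum>i<n. mat_adjoint A $$ (j, i) * A $$ (i, j))"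
    using assms ad by (auto simp: mat_trace_def scalar_prod_def atLeast0LessThan intro!: sum.cong)
  also have "\<dots> = (\<Sum>j<n. \<Sum>i<n. complex_of_real ((cmod (A $$ (i, j)))\<^sup>2))"
  proof (intro sum.cong refl)
    fix i j assume "j \<in> {..<n}" "i \<in> {..<n}"
    then show "mat_adjoint A $$ (j, i) * A $$ (i, j) = complex_of_real ((cmod (A $$ (i, j)))\<^sup>2)"
      using mat_adjoint_entry[OF assms, of j i] complex_norm_square[of "A $$ (i, j)"]
      by (simp add: mult.commute)
  qed
  finally have "Re (mat_trace (mat_adjoint A * A)) = (\<Sum>j<n. \<Sum>i<n. (cmod (A $$ (i, j)))\<^sup>2)"
    by simp
  then show ?thesis
    unfolding hs_norm_def by (subst sum.swap) simp
qed

lemma hs_norm_sq: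
  "A \<in> carrier_mat n n \<Longrightarrow> (hs_norm A)\<^sup>2 = (\<Sum>i<n. \<Sum>j<n. (cmod (A $$ (i, j)))\<^sup>2)"
  by (simp add: hs_norm_eq sum_nonneg)

lemma hs_norm_nonneg: "A \<in> carrier_mat n n \<Longrightarrow> 0 \<le> hs_norm A"
  by (simp add: hs_norm_eq sum_nonneg)

lemma entry_le_hs_norm:
  assumes "A \<in> carrier_mat n n" "i < n" "j < n"
  shows "cmod (A $$ (i, j)) \<le> hs_norm A"
proof (rule power2_le_imp_le[OF _ hs_norm_nonneg[OF assms(1)]])
  have "(cmod (A $$ (i, j)))\<^sup>2 \<le> (\<Sum>j<n. (cmod (A $$ (i, j)))\<^sup>2)"
    using assms(3) by (intro member_le_sum) auto
  also have "\<dots> \<le> (\<Sum>i<n. \<Sum>j<n. (cmod (A $$ (i, j)))\<^sup>2)"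
    using assms(2) by (intro member_le_sum[where f = "\<lambda>i. \<Sum>j<n. (cmod (A $$ (i, j)))\<^sup>2"]) (auto intro: sum_nonneg)
  finally show "(cmod (A $$ (i, j)))\<^sup>2 \<le> (hs_norm A)\<^sup>2" by (simp add: hs_norm_sq[OF assms(1)])
qed

lemma hs_norm_le:
  assumes "A \<in> carrier_mat n n" "\<And>i j. i < n \<Longrightarrow> j < n \<Longrightarrow> cmod (A $$ (i, j)) \<le> c" "0 \<le> c"
  shows "hs_norm A \<le> real n * c"
proof (rule power2_le_imp_le)
  have "(hs_norm A)\<^sup>2 \<le> (\<Sum>i<n. \<Sum>j<n. c\<^sup>2)"
    unfolding hs_norm_sq[OF assms(1)] using assms(2) by (intro sum_mono power_mono) auto
  then show "(hs_norm A)\<^sup>2 \<le> (real n * c)\<^sup>2" by (simp add: power2_eq_square algebra_simps)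
qed (use assms(3) in simp)


lemma hs_norm_diff_sq:
  assumes "A \<in> carrier_mat n n" "B \<in> carrier_mat n n"
  shows "(hs_norm (A - B))\<^sup>2 = (\<Sum>i<n. \<Sum>j<n. (cmod (A $$ (i, j) - B $$ (i, j)))\<^sup>2)"
  unfolding hs_norm_sq[OF minus_carrier_mat[OF assms(2)]] using assms by simp

lemma entry_diff_le_hs_norm:
  assumes "A \<in> carrier_mat n n" "B \<in> carrier_mat n n" "i < n" "j < n"
  shows "cmod (A $$ (i, j) - B $$ (i, j)) \<le> hs_norm (A - B)"
  using entry_le_hs_norm[OF minus_carrier_mat[OF assms(2)] assms(3,4), of A] assms by simp

section \<open>Existence of best separable approximations\<close>

text \<open>Gaussian elimination of one coordinate. If \<open>V a0 i\<close> is nonzero,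
  \<open>a0\<close> is the pivot: the other vectors are reduced to vanish at \<open>i\<close>, and a
  relation among them extends to \<open>a0\<close> with the coefficient that cancels coordinate
  \<open>i\<close>.\<close>

lemma linear_dependency:
  fixes V :: "'b \<Rightarrow> 'i \<Rightarrow> real"
  assumes "finite I" "finite J" "card I < card J"
  shows "\<exists>d. (\<exists>a\<in>J. d a \<noteq> 0) \<and> (\<forall>i\<in>I. (\<Sum>a\<in>J. d a * V a i) = 0)"
  using assms
proof (induction I arbitrary: J V rule: finite_induct)
  case empty
  then have "J \<noteq> {}" by auto
  then show ?case by (auto intro!: exI[of _ "\<lambda>_. 1"])
next
  case (insert i I)
  show ?case
  proof (cases "\<forall>a\<in>J. V a i = 0")
    case True
    have "card I < card J" using insert.hyps insert.prems by simp
    from insert.IH[OF insert.prems(1) this, of V] obtain d where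
      "\<exists>a\<in>J. d a \<noteq> 0" "\<forall>i\<in>I. (\<Sum>a\<in>J. d a * V a i) = 0" by blast
    then show ?thesis using True by (intro exI[of _ d]) auto
  next
    case False
    then obtain a0 where a0: "a0 \<in> J" "V a0 i \<noteq> 0" by blast
    let ?J = "J - {a0}"
    define V' where "V' = (\<lambda>a x. V a x - V a i / V a0 i * V a0 x)"
    have "card I < card ?J" using insert.hyps insert.prems a0 by simp
    from insert.IH[OF _ this, of V'] insert.prems obtain d where
      d: "\<exists>a\<in>?J. d a \<noteq> 0" "\<forall>x\<in>I. (\<Sum>a\<in>?J. d a * V' a x) = 0" by auto
    have V': "V' a i = 0" for a using a0 by (simp add: V'_def)
    define d' where "d' = d(a0 := - (\<Sum>a\<in>?J. d a * V a i) / V a0 i)"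
    have "(\<Sum>a\<in>J. d' a * V a x) = 0" if "x \<in> insert i I" for x
    proof -
      have "(\<Sum>a\<in>J. d' a * V a x) = d' a0 * V a0 x + (\<Sum>a\<in>?J. d' a * V a x)"
        using a0 insert.prems(1) by (simp add: sum.remove)
      also have "(\<Sum>a\<in>?J. d' a * V a x) = (\<Sum>a\<in>?J. d a * V' a x + d a * V a i * (V a0 x / V a0 i))"
        by (intro sum.cong refl) (auto simp: d'_def V'_def algebra_simps)
      also have "\<dots> = (\<Sum>a\<in>?J. d a * V a i) * (V a0 x / V a0 i)"
      proof -
        have "(\<Sum>a\<in>?J. d a * V' a x) = 0" using that d(2) V' by auto
        then show ?thesis by (simp only: sum.distrib sum_distrib_right[symmetric])
      qed
      finally show ?thesis by (simp add: d'_def)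
    qed
    moreover have "\<exists>a\<in>J. d' a \<noteq> 0" using d(1) by (auto simp: d'_def)
    ultimately show ?thesis by blast
  qed
qed

text \<open>Subtracting a multiple of a linear relation \<open>d\<close> leaves the sum unchanged.
  The largest multiple that keeps all coefficients nonnegative is the least ratio
  \<open>c a / d a\<close> over positive \<open>d a\<close>; it makes one coefficient zero, and that
  vector is dropped.\<close>

lemma conic_caratheodory:
  fixes V :: "'b \<Rightarrow> 'i \<Rightarrow> real"
  assumes "finite I" "finite J" "\<forall>a\<in>J. 0 \<le> c a"
  shows "\<exists>K c'. K \<subseteq> J \<and> card K \<le> card I \<and> (\<forall>a\<in>K. 0 \<le> c' a) \<and>
    (\<forall>i\<in>I. (\<Sum>a\<in>K. c' a * V a i) = (\<Sum>a\<in>J. c a * V a i))"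
  using assms(2,3)
proof (induction "card J" arbitrary: J c rule: less_induct)
  case less
  show ?case
  proof (cases "card J \<le> card I")
    case True
    then show ?thesis using less.prems by blast
  next
    case False
    then obtain e where e: "\<exists>a\<in>J. e a \<noteq> 0" "\<forall>i\<in>I. (\<Sum>a\<in>J. e a * V a i) = 0"
      using linear_dependency[OF assms(1) less.prems(1), of V] by (meson not_le)
    \<comment> \<open>The least ratio exists only if some coefficient is positive; if none is, the
      relation is negated.\<close>
    obtain d where d: "\<exists>a\<in>J. 0 < d a" "\<forall>i\<in>I. (\<Sum>a\<in>J. d a * V a i) = 0"
    proof (cases "\<exists>a\<in>J. 0 < e a")
      case True
      then show ?thesis using that e by blast
    next
      case False
      then have "\<exists>a\<in>J. 0 < - e a" using e(1) by force
      moreover have "\<forall>i\<in>I. (\<Sum>a\<in>J. - e a * V a i) = 0" using e(2) by (simp add: sum_negf)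
      ultimately show ?thesis by (rule that)
    qed
    let ?P = "{a \<in> J. 0 < d a}"
    have "finite ?P" "?P \<noteq> {}" using less.prems(1) d(1) by auto
    then have "Min ((\<lambda>a. c a / d a) ` ?P) \<in> (\<lambda>a. c a / d a) ` ?P" by (intro Min_in) auto
    then obtain a0 where "a0 \<in> ?P" "Min ((\<lambda>a. c a / d a) ` ?P) = c a0 / d a0" by blast
    moreover have "Min ((\<lambda>a. c a / d a) ` ?P) \<le> c a / d a" if "a \<in> ?P" for a
      using that \<open>finite ?P\<close> by (intro Min_le) auto
    ultimately have a0: "a0 \<in> ?P" "\<And>a. a \<in> ?P \<Longrightarrow> c a0 / d a0 \<le> c a / d a" by simp_all
    define t where "t = c a0 / d a0"
    define c2 where "c2 = (\<lambda>a. c a - t * d a)"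
    have t0: "0 \<le> t" using a0(1) less.prems(2) by (auto simp: t_def)
    have pos: "0 \<le> c2 a" if "a \<in> J" for a
    proof (cases "0 < d a")
      case True
      then show ?thesis using a0(2)[of a] that by (simp add: c2_def t_def field_simps)
    next
      case False
      then have "t * d a \<le> 0" using t0 by (simp add: mult_nonneg_nonpos)
      moreover have "0 \<le> c a" using less.prems(2) that by blast
      ultimately show ?thesis by (simp add: c2_def)
    qed
    have zero: "c2 a0 = 0" using a0(1) by (simp add: c2_def t_def)
    have "card (J - {a0}) < card J"
      using a0(1) less.prems(1) by (intro card_Diff1_less) auto
    from less.hyps[OF this, of c2] pos less.prems(1) obtain K c' where K:
      "K \<subseteq> J - {a0}" "card K \<le> card I" "\<forall>a\<in>K. 0 \<le> c' a"
      "\<forall>i\<in>I. (\<Sum>a\<in>K. c' a * V a i) = (\<Sum>a\<in>J - {a0}. c2 a * V a i)" by auto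
    have "(\<Sum>a\<in>J - {a0}. c2 a * V a i) = (\<Sum>a\<in>J. c a * V a i)" if "i \<in> I" for i
    proof -
      have "(\<Sum>a\<in>J - {a0}. c2 a * V a i) = (\<Sum>a\<in>J. c2 a * V a i)"
        by (rule sum.mono_neutral_left) (use a0(1) less.prems(1) zero in auto)
      also have "\<dots> = (\<Sum>a\<in>J. c a * V a i) - t * (\<Sum>a\<in>J. d a * V a i)"
        by (simp add: c2_def left_diff_distrib sum_subtractf sum_distrib_left mult.assoc)
      finally show ?thesis using d(2) that by simp
    qed
    then have "\<forall>i\<in>I. (\<Sum>a\<in>K. c' a * V a i) = (\<Sum>a\<in>J. c a * V a i)" using K(4) by simp
    moreover have "K \<subseteq> J" using K(1) by blast
    ultimately show ?thesis using K(2,3) by blast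
  qed
qed

section \<open>Separable operators as bounded sums of bounded products\<close>

definition kron_form :: "nat \<Rightarrow> (nat \<Rightarrow> nat \<Rightarrow> complex) \<Rightarrow> (nat \<Rightarrow> nat \<Rightarrow> complex) \<Rightarrow> nat \<Rightarrow> nat \<Rightarrow> complex" where
  "kron_form d2 A B i j = A (i div d2) (j div d2) * B (i mod d2) (j mod d2)"

lemma sum_div_mod:
  fixes f :: "nat \<Rightarrow> nat \<Rightarrow> 'b :: comm_monoid_add"
  shows "(\<Sum>i<d1 * d2. f (i div d2) (i mod d2)) = (\<Sum>x<d1. \<Sum>y<d2. f x y)"
proof (cases "d2 = 0")
  case False
  have "(\<Sum>x<d1. \<Sum>y<d2. f x y) = (\<Sum>(x, y)\<in>{..<d1} \<times> {..<d2}. f x y)"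
    by (simp add: sum.cartesian_product)
  also have "\<dots> = (\<Sum>i<d1 * d2. f (i div d2) (i mod d2))"
  proof (rule sum.reindex_bij_witness[of _ "\<lambda>i. (i div d2, i mod d2)" "\<lambda>(x, y). x * d2 + y"])
    fix p assume "p \<in> {..<d1} \<times> {..<d2}"
    then obtain x y where p: "p = (x, y)" "x < d1" "y < d2" by auto
    then have "x * d2 + y < Suc x * d2" by simp
    also have "\<dots> \<le> d1 * d2" using p(2) by (intro mult_le_mono1) simp
    finally show "(case p of (x, y) \<Rightarrow> x * d2 + y) \<in> {..<d1 * d2}" using p by simp
  qed (use False in \<open>auto simp: less_mult_imp_div_less\<close>)
  finally show ?thesis ..
qed simp

lemma index_less:
  fixes d1 d2 x y :: nat
  assumes "x < d1" "y < d2"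
  shows "x * d2 + y < d1 * d2"
proof -
  have "x * d2 + y < Suc x * d2" using assms(2) by simp
  also have "\<dots> \<le> d1 * d2" using assms(1) by (intro mult_le_mono1) simp
  finally show ?thesis .
qed

lemma kron_entry:
  assumes "A \<in> carrier_mat d1 d1" "B \<in> carrier_mat d2 d2" "i < d1 * d2" "j < d1 * d2"
  shows "kron A B $$ (i, j) = kron_form d2 (entry A) (entry B) i j"
proof -
  have "dim_row A = d1" "dim_col A = d1" "dim_row B = d2" "dim_col B = d2" using assms by auto
  then show ?thesis using assms(3,4) unfolding kron_def kron_form_def by simp
qed

lemma sep_cone_carrier: "S \<in> sep_cone d1 d2 \<Longrightarrow> S \<in> carrier_mat (d1 * d2) (d1 * d2)"
  and sep_cone_psd_form: "S \<in> sep_cone d1 d2 \<Longrightarrow> psd_form (d1 * d2) (entry S)"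
  unfolding sep_cone_def psd_iff by blast+

lemma sep_coneI:
  fixes r :: nat
  assumes "psd (d1 * d2) S" "1 \<le> r" "\<And>a. a < r \<Longrightarrow> psd_form d1 (A a)" "\<And>a. a < r \<Longrightarrow> psd_form d2 (B a)"
    and eq: "\<And>i j. i < d1 * d2 \<Longrightarrow> j < d1 * d2 \<Longrightarrow> S $$ (i, j) = (\<Sum>a<r. kron_form d2 (A a) (B a) i j)"
  shows "S \<in> sep_cone d1 d2"
proof -
  let ?A = "\<lambda>a. mat d1 d1 (\<lambda>(i, j). A a i j)" and ?B = "\<lambda>a. mat d2 d2 (\<lambda>(i, j). B a i j)"
  have A: "psd d1 (?A a)" if "a < r" for a
    unfolding psd_iff using assms(3)[OF that] by (auto intro: psd_form_cong[of d1 "A a"])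
  have B: "psd d2 (?B a)" if "a < r" for a
    unfolding psd_iff using assms(4)[OF that] by (auto intro: psd_form_cong[of d2 "B a"])
  have "S = mat_sum (d1 * d2) r (\<lambda>a. kron (?A a) (?B a))"
  proof (rule eq_matI)
    fix i j assume "i < dim_row (mat_sum (d1 * d2) r (\<lambda>a. kron (?A a) (?B a)))"
      "j < dim_col (mat_sum (d1 * d2) r (\<lambda>a. kron (?A a) (?B a)))"
    then have ij: "i < d1 * d2" "j < d1 * d2" by (auto simp: mat_sum_def)
    then have "0 < d2" by (cases d2) auto
    then have lt: "i div d2 < d1" "j div d2 < d1" "i mod d2 < d2" "j mod d2 < d2"
      using ij by (auto simp: less_mult_imp_div_less)
    show "S $$ (i, j) = mat_sum (d1 * d2) r (\<lambda>a. kron (?A a) (?B a)) $$ (i, j)"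
      using ij lt eq[OF ij]
      by (simp add: mat_sum_def kron_entry[of _ d1 _ d2]) (simp add: kron_form_def)
  qed (use assms(1) in \<open>auto simp: mat_sum_def psd_iff\<close>)
  moreover have "\<forall>a<r. psd d1 (?A a) \<and> psd d2 (?B a)" using A B by simp
  ultimately show ?thesis
    unfolding sep_cone_def using assms(1,2)
    by (intro CollectI conjI exI[of _ r] exI[of _ ?A] exI[of _ ?B])
qed

lemma sep_coneE:
  assumes "S \<in> sep_cone d1 d2"
  obtains r :: nat and A B where "psd (d1 * d2) S" "1 \<le> r" "\<And>a. a < r \<Longrightarrow> psd_form d1 (A a)"
    "\<And>a. a < r \<Longrightarrow> psd_form d2 (B a)"
    "\<And>i j. i < d1 * d2 \<Longrightarrow> j < d1 * d2 \<Longrightarrow> S $$ (i, j) = (\<Sum>a<r. kron_form d2 (A a) (B a) i j)"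
proof -
  from assms obtain r A B where S: "psd (d1 * d2) S" "1 \<le> r"
    "\<forall>a<r. psd d1 (A a) \<and> psd d2 (B a)" "S = mat_sum (d1 * d2) r (\<lambda>a. kron (A a) (B a))"
    unfolding sep_cone_def by blast
  show ?thesis
  proof (rule that[of r "\<lambda>a. entry (A a)" "\<lambda>a. entry (B a)"])
    fix i j assume "i < d1 * d2" "j < d1 * d2"
    then show "S $$ (i, j) = (\<Sum>a<r. kron_form d2 (entry (A a)) (entry (B a)) i j)"
      using S(3) unfolding S(4) by (auto simp: mat_sum_def psd_iff kron_entry intro!: sum.cong)
  qed (use S in \<open>auto simp: psd_iff\<close>)
qed

lemma trace_kron_form:
  "(\<Sum>i<d1 * d2. kron_form d2 A B i i) = (\<Sum>x<d1. A x x) * (\<Sum>y<d2. B y y)"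
  unfolding kron_form_def sum_product
  by (rule sum_div_mod[where f = "\<lambda>x y. A x x * B y y"])

lemma kron_form_scale: "kron_form d2 (\<lambda>i j. c * A i j) (\<lambda>i j. e * B i j) i j = c * e * kron_form d2 A B i j"
  by (simp add: kron_form_def)

text \<open>The trace \<tau> of the first factor is moved to the second: c (A \<otimes> B) is (A /
  \<tau>) \<otimes> (c \<tau> B). Entries of a positive semidefinite form are at most its trace,
  which is now 1 for the first factor and the trace of the product for the second. If \<tau> is 0,
  so is \<open>A\<close>, and zero factors do.\<close>

lemma kron_form_normalize:
  assumes "psd_form d1 A" "psd_form d2 B" "0 \<le> c"
  obtains A' B' where "psd_form d1 A'" "psd_form d2 B'"
    "\<And>i j. i < d1 * d2 \<Longrightarrow> j < d1 * d2 \<Longrightarrow> kron_form d2 A' B' i j = complex_of_real c * kron_form d2 A B i j"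
    "\<And>i j. i < d1 \<Longrightarrow> j < d1 \<Longrightarrow> cmod (A' i j) \<le> 1"
    "\<And>i j. i < d2 \<Longrightarrow> j < d2 \<Longrightarrow> cmod (B' i j) \<le> Re (\<Sum>i<d1 * d2. kron_form d2 A' B' i i)"
proof -
  define \<tau> where "\<tau> = (\<Sum>k<d1. Re (A k k))"
  have \<tau>: "0 \<le> \<tau>" unfolding \<tau>_def using psd_form_diag[OF assms(1)] by (intro sum_nonneg) auto
  have le: "cmod (A i j) \<le> \<tau>" if "i < d1" "j < d1" for i j
    unfolding \<tau>_def using psd_form_entry_le_trace[OF assms(1) that] .
  show ?thesis
  proof (cases "\<tau> = 0")
    case True
    have "kron_form d2 A B i j = 0" if "i < d1 * d2" "j < d1 * d2" for i j
      using le[of "i div d2" "j div d2"] that True by (simp add: kron_form_def less_mult_imp_div_less)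
    then show ?thesis
      by (intro that[of "\<lambda>i j. 0" "\<lambda>i j. 0"]) (auto simp: psd_form_zero kron_form_def)
  next
    case False
    let ?A = "\<lambda>i j. complex_of_real (1 / \<tau>) * A i j" and ?B = "\<lambda>i j. complex_of_real (c * \<tau>) * B i j"
    have A: "psd_form d1 ?A" and B: "psd_form d2 ?B"
      using assms \<tau> by (intro psd_form_scale; simp)+
    have "(\<Sum>x<d1. A x x) = complex_of_real \<tau>"
      unfolding \<tau>_def of_real_sum by (intro sum.cong refl) (use psd_form_diag(2)[OF assms(1)] in auto)
    then have trA: "(\<Sum>x<d1. ?A x x) = 1" using False by (simp add: sum_divide_distrib[symmetric])
    show ?thesis
    proof (rule that[OF A B])
      fix i j show "kron_form d2 ?A ?B i j = complex_of_real c * kron_form d2 A B i j"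
        using False unfolding kron_form_scale by simp
    next
      fix i j assume "i < d1" "j < d1"
      then show "cmod (?A i j) \<le> 1" using le[of i j] \<tau> False by (simp add: norm_divide)
    next
      fix i j assume "i < d2" "j < d2"
      from psd_form_entry_le_trace[OF B this]
      show "cmod (?B i j) \<le> Re (\<Sum>i<d1 * d2. kron_form d2 ?A ?B i i)"
        unfolding trace_kron_form trA by simp
    qed
  qed
qed

text \<open>An \<open>n\<close> by \<open>n\<close> complex matrix has \<open>2 * n * n\<close> real
  coordinates, so Caratheodory's theorem leaves at most that many products, and zero terms make
  their number exact. Traces of the terms are nonnegative, so each is at most the trace of
  \<open>S\<close>. Hence a bound on the trace confines all factors to a bounded set.\<close>

lemma sep_cone_bounded_representation:
  assumes S: "S \<in> sep_cone d1 d2" and n: "n = d1 * d2"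
  obtains A B where "\<And>a. psd_form d1 (A a)" "\<And>a. psd_form d2 (B a)"
    "\<And>i j. i < n \<Longrightarrow> j < n \<Longrightarrow> S $$ (i, j) = (\<Sum>a<2 * n * n. kron_form d2 (A a) (B a) i j)"
    "\<And>a i j. i < d1 \<Longrightarrow> j < d1 \<Longrightarrow> cmod (A a i j) \<le> 1"
    "\<And>a i j. i < d2 \<Longrightarrow> j < d2 \<Longrightarrow> cmod (B a i j) \<le> Re (\<Sum>i<n. S $$ (i, i))"
proof -
  obtain r :: nat and A B where psd: "psd n S" and A: "\<And>a. a < r \<Longrightarrow> psd_form d1 (A a)"
    and B: "\<And>a. a < r \<Longrightarrow> psd_form d2 (B a)" and
    eq: "\<And>i j. i < n \<Longrightarrow> j < n \<Longrightarrow> S $$ (i, j) = (\<Sum>a<r. kron_form d2 (A a) (B a) i j)"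
    unfolding n by (rule sep_coneE[OF S]) blast
  define I where "I = {..<n} \<times> {..<n} \<times> {True, False}"
  define V where "V = (\<lambda>a (i, j, b). (if b then Re else Im) (kron_form d2 (A a) (B a) i j))"
  have I: "finite I" "card I = 2 * n * n" by (auto simp: I_def card_cartesian_product)
  have "\<exists>K c. K \<subseteq> {..<r} \<and> card K \<le> 2 * n * n \<and> (\<forall>a\<in>K. 0 \<le> c a) \<and>
      (\<forall>i\<in>I. (\<Sum>a\<in>K. c a * V a i) = (\<Sum>a<r. 1 * V a i))"
    unfolding I(2)[symmetric] by (rule conic_caratheodory) (use I(1) in auto)
  then obtain K c where
    K: "K \<subseteq> {..<r}" "card K \<le> 2 * n * n" "\<forall>a\<in>K. 0 \<le> c a"
    "\<forall>i\<in>I. (\<Sum>a\<in>K. c a * V a i) = (\<Sum>a<r. 1 * V a i)" by blast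
  have eqK: "S $$ (i, j) = (\<Sum>a\<in>K. complex_of_real (c a) * kron_form d2 (A a) (B a) i j)"
    if ij: "i < n" "j < n" for i j
  proof -
    have mem: "(i, j, True) \<in> I" "(i, j, False) \<in> I" using ij by (auto simp: I_def)
    show ?thesis unfolding eq[OF ij]
    proof (rule complex_eqI)
      show "Re (\<Sum>a<r. kron_form d2 (A a) (B a) i j)
          = Re (\<Sum>a\<in>K. complex_of_real (c a) * kron_form d2 (A a) (B a) i j)"
        using bspec[OF K(4) mem(1)] by (simp add: V_def)
      show "Im (\<Sum>a<r. kron_form d2 (A a) (B a) i j)
          = Im (\<Sum>a\<in>K. complex_of_real (c a) * kron_form d2 (A a) (B a) i j)"
        using bspec[OF K(4) mem(2)] by (simp add: V_def)
    qed
  qed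
  have finK: "finite K" using K(1) finite_subset by blast
  then obtain h where h: "bij_betw h {..<card K} K"
    using ex_bij_betw_nat_finite[of K] by (auto simp: atLeast0LessThan)
  \<comment> \<open>All requirements on the \<open>a\<close>-th pair of factors in one predicate, so
    that the pairs can be chosen simultaneously; from \<open>card K\<close> on the product is
    zero.\<close>
  define good where "good = (\<lambda>a AB. psd_form d1 (fst AB) \<and> psd_form d2 (snd AB) \<and>
    (\<forall>i<n. \<forall>j<n. kron_form d2 (fst AB) (snd AB) i j
       = (if a < card K then complex_of_real (c (h a)) * kron_form d2 (A (h a)) (B (h a)) i j else 0)) \<and>
    (\<forall>i<d1. \<forall>j<d1. cmod (fst AB i j) \<le> 1) \<and>
    (\<forall>i<d2. \<forall>j<d2. cmod (snd AB i j) \<le> Re (\<Sum>i<n. kron_form d2 (fst AB) (snd AB) i i)))"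
  have "\<exists>AB. good a AB" for a
  proof (cases "a < card K")
    case True
    then have "h a \<in> K" using h by (auto simp: bij_betw_def)
    then have *: "psd_form d1 (A (h a))" "psd_form d2 (B (h a))" "0 \<le> c (h a)" using K A B by auto
    show ?thesis
    proof (rule kron_form_normalize[OF *])
      fix A' B' assume "psd_form d1 A'" "psd_form d2 B'"
        "\<And>i j. i < d1 * d2 \<Longrightarrow> j < d1 * d2 \<Longrightarrow>
          kron_form d2 A' B' i j = complex_of_real (c (h a)) * kron_form d2 (A (h a)) (B (h a)) i j"
        "\<And>i j. i < d1 \<Longrightarrow> j < d1 \<Longrightarrow> cmod (A' i j) \<le> 1"
        "\<And>i j. i < d2 \<Longrightarrow> j < d2 \<Longrightarrow> cmod (B' i j) \<le> Re (\<Sum>i<d1 * d2. kron_form d2 A' B' i i)"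
      then have "good a (A', B')" using True unfolding good_def n fst_conv snd_conv by auto
      then show ?thesis ..
    qed
  next
    case False
    then show ?thesis
      by (intro exI[of _ "(\<lambda>i j. 0, \<lambda>i j. 0)"]) (simp add: good_def psd_form_zero kron_form_def)
  qed
  then obtain AB where "\<And>a. good a (AB a)" by metis
  then have AB: "\<And>a. psd_form d1 (fst (AB a))" "\<And>a. psd_form d2 (snd (AB a))"
    "\<And>a i j. i < n \<Longrightarrow> j < n \<Longrightarrow> kron_form d2 (fst (AB a)) (snd (AB a)) i j
       = (if a < card K then complex_of_real (c (h a)) * kron_form d2 (A (h a)) (B (h a)) i j else 0)"
    "\<And>a i j. i < d1 \<Longrightarrow> j < d1 \<Longrightarrow> cmod (fst (AB a) i j) \<le> 1"
    "\<And>a i j. i < d2 \<Longrightarrow> j < d2 \<Longrightarrow> cmod (snd (AB a) i j) \<le> Re (\<Sum>i<n. kron_form d2 (fst (AB a)) (snd (AB a)) i i)"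
    unfolding good_def by blast+
  have S_eq: "S $$ (i, j) = (\<Sum>a<2 * n * n. kron_form d2 (fst (AB a)) (snd (AB a)) i j)"
    if ij: "i < n" "j < n" for i j
  proof -
    have "(\<Sum>a<2 * n * n. kron_form d2 (fst (AB a)) (snd (AB a)) i j)
        = (\<Sum>a<card K. complex_of_real (c (h a)) * kron_form d2 (A (h a)) (B (h a)) i j)"
      using K(2) unfolding AB(3)[OF ij]
      by (intro sum.mono_neutral_cong_right) auto
    also have "\<dots> = (\<Sum>a\<in>K. complex_of_real (c a) * kron_form d2 (A a) (B a) i j)"
      by (rule sum.reindex_bij_betw[OF h])
    finally show ?thesis using eqK[OF ij] by simp
  qed
  show ?thesis
  proof (rule that[OF AB(1,2) S_eq AB(4)])
    fix a i j assume ij: "i < d2" "j < d2"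
    let ?t = "\<lambda>a. Re (\<Sum>i<n. kron_form d2 (fst (AB a)) (snd (AB a)) i i)"
    have nn: "0 \<le> ?t b" for b using AB(5)[OF ij, of b] norm_ge_zero order_trans by blast
    have trS: "Re (\<Sum>i<n. S $$ (i, i)) = (\<Sum>b<2 * n * n. ?t b)"
      by (simp add: S_eq Re_sum) (rule sum.swap)
    have "?t a \<le> Re (\<Sum>i<n. S $$ (i, i))"
    proof (cases "a < 2 * n * n")
      case True
      then show ?thesis unfolding trS using nn by (intro member_le_sum) auto
    next
      case False
      then have "\<not> a < card K" using K(2) by simp
      then have "?t a = 0" using AB(3)[of _ _ a] by simp
      then show ?thesis unfolding trS using nn by (simp add: sum_nonneg)
    qed
    with AB(5)[OF ij, of a] show "cmod (snd (AB a) i j) \<le> Re (\<Sum>i<n. S $$ (i, i))" by simp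
  qed
qed


section \<open>Compactness of the parameters and attainment of the minimum\<close>

lemma compact_complex_disc: "compact {z :: complex. cmod z \<le> c}"
proof -
  let ?f = "\<lambda>p. complex_of_real (fst p) + \<i> * complex_of_real (snd p)"
  let ?B = "{- c..c} \<times> {- c..c}"
  have "compact (?f ` ?B)"
    by (intro compact_continuous_image compact_Times compact_Icc continuous_intros)
  moreover have "closed {z :: complex. cmod z \<le> c}"
    by (intro closed_Collect_le continuous_intros)
  moreover have "{z. cmod z \<le> c} \<subseteq> ?f ` ?B"
  proof
    fix z :: complex assume "z \<in> {z. cmod z \<le> c}"
    then have "\<bar>Re z\<bar> \<le> c" "\<bar>Im z\<bar> \<le> c"
      using abs_Re_le_cmod[of z] abs_Im_le_cmod[of z] by auto
    then have "(Re z, Im z) \<in> ?B" by auto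
    moreover have "z = ?f (Re z, Im z)" by (simp add: complex_eq_iff)
    ultimately show "z \<in> ?f ` ?B" by blast
  qed
  ultimately show ?thesis by (metis compact_Int_closed inf.absorb_iff2)
qed

text \<open>Tychonoff's theorem. The index type is arbitrary, so the parameters may be indexed by
  all natural numbers, including those beyond the dimensions.\<close>

lemma compact_bounded_functions: "compact {\<theta> :: 'k \<Rightarrow> complex. \<forall>k. cmod (\<theta> k) \<le> c}"
proof -
  have "compactin (product_topology (\<lambda>_. euclidean) UNIV) (PiE UNIV (\<lambda>_ :: 'k. {z :: complex. cmod z \<le> c}))"
    unfolding compactin_PiE by (simp add: compact_complex_disc)
  then have "compact (PiE UNIV (\<lambda>_ :: 'k. {z :: complex. cmod z \<le> c}))"
    by (simp add: euclidean_product_topology)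
  moreover have "PiE UNIV (\<lambda>_ :: 'k. {z :: complex. cmod z \<le> c}) = {\<theta>. \<forall>k. cmod (\<theta> k) \<le> c}"
    by (auto simp: PiE_def Pi_def)
  ultimately show ?thesis by simp
qed

lemma continuous_on_qform [continuous_intros]:
  assumes "\<And>i j. continuous_on S (\<lambda>\<theta>. a \<theta> i j)"
  shows "continuous_on S (\<lambda>\<theta>. qform n (a \<theta>) v)"
  unfolding qform_def by (intro continuous_intros assms)

lemma closed_psd_form:
  assumes "\<And>i j. continuous_on UNIV (\<lambda>\<theta>. a \<theta> i j)"
  shows "closed {\<theta>. psd_form n (a \<theta>)}"
  unfolding psd_form_def
  by (intro closed_Collect_conj closed_Collect_all closed_Collect_imp closed_Collect_eq
      closed_Collect_le open_Collect_const continuous_intros assms)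

text \<open>
  Separable operators near the minimum are parametrized by the factors of a bounded number of
  terms with bounded entries, which form a compact set.
\<close>

lemma best_approximation_exists:
  assumes S: "S \<in> carrier_mat (d1 * d2) (d1 * d2)"
  obtains T where "T \<in> sep_cone d1 d2"
    "\<And>T'. T' \<in> sep_cone d1 d2 \<Longrightarrow> (hs_norm (T - S))\<^sup>2 \<le> (hs_norm (T' - S))\<^sup>2"
proof -
  define n where "n = d1 * d2"
  \<comment> \<open>The additional term supplies the one term that \<open>sep_cone\<close> asks for
    even when \<open>n\<close> is 0.\<close>
  define R where "R = 2 * n * n + 1"
  define F where "F = (\<lambda>(\<theta> :: bool \<times> nat \<times> nat \<times> nat \<Rightarrow> complex) i j.
    \<Sum>a<R. kron_form d2 (\<lambda>i j. \<theta> (True, a, i, j)) (\<lambda>i j. \<theta> (False, a, i, j)) i j)"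
  define g where "g = (\<lambda>\<theta>. \<Sum>i<n. \<Sum>j<n. (cmod (F \<theta> i j - S $$ (i, j)))\<^sup>2)"
  \<comment> \<open>An operator at least as close to \<open>S\<close> as zero differs from
    \<open>S\<close> by at most \<open>hs_norm S\<close> in each entry. The sum therefore bounds its
    trace and with it the second factors; the summand 1 covers the first factors.\<close>
  define M where "M = (\<Sum>i<n. cmod (S $$ (i, i)) + hs_norm S) + 1"
  define C where "C = {\<theta>. \<forall>k. cmod (\<theta> k) \<le> M} \<inter> {\<theta>.
    (\<forall>a. psd_form d1 (\<lambda>i j. \<theta> (True, a, i, j))) \<and> (\<forall>a. psd_form d2 (\<lambda>i j. \<theta> (False, a, i, j))) \<and>
    psd_form n (F \<theta>)}"
  have Sn: "S \<in> carrier_mat n n" using S by (simp add: n_def)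
  have hS: "0 \<le> hs_norm S" by (rule hs_norm_nonneg[OF Sn])
  have "0 \<le> (\<Sum>i<n. cmod (S $$ (i, i)) + hs_norm S)" using hS by (intro sum_nonneg) simp
  then have M1: "1 \<le> M" by (simp add: M_def)
  have coord: "continuous_on UNIV (\<lambda>\<theta> :: bool \<times> nat \<times> nat \<times> nat \<Rightarrow> complex. \<theta> k)" for k
    by (rule continuous_on_product_coordinates)
  have contF: "continuous_on UNIV (\<lambda>\<theta>. F \<theta> i j)" for i j
    unfolding F_def kron_form_def by (intro continuous_intros coord)
  have contg: "continuous_on UNIV g"
    unfolding g_def by (intro continuous_intros contF)
  have "compact C"
    unfolding C_def by (intro compact_Int_closed compact_bounded_functions closed_Collect_conj
        closed_Collect_all closed_psd_form coord contF)
  moreover have zero: "(\<lambda>_. 0) \<in> C"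
    using M1 by (auto simp: C_def F_def kron_form_def psd_form_zero)
  ultimately obtain \<theta> where \<theta>: "\<theta> \<in> C" "\<And>\<theta>'. \<theta>' \<in> C \<Longrightarrow> g \<theta> \<le> g \<theta>'"
    using continuous_attains_inf[of C g] continuous_on_subset[OF contg] by blast
  define mF where "mF = (\<lambda>\<theta>. mat n n (\<lambda>(i, j). F \<theta> i j))"
  have hs_mF: "(hs_norm (mF \<theta> - S))\<^sup>2 = g \<theta>" for \<theta>
    using hs_norm_diff_sq[of "mF \<theta>" n S] Sn by (simp add: mF_def g_def)
  have mF_cone: "mF \<theta> \<in> sep_cone d1 d2" if "\<theta> \<in> C" for \<theta>
  proof (rule sep_coneI)
    show "psd (d1 * d2) (mF \<theta>)"
      using that unfolding psd_iff n_def[symmetric]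
      by (auto simp: mF_def C_def intro: psd_form_cong[of n "F \<theta>"])
    show "1 \<le> R" by (simp add: R_def)
    fix i j assume "i < d1 * d2" "j < d1 * d2"
    then show "mF \<theta> $$ (i, j) = (\<Sum>a<R. kron_form d2 (\<lambda>i j. \<theta> (True, a, i, j)) (\<lambda>i j. \<theta> (False, a, i, j)) i j)"
      by (simp add: mF_def F_def n_def)
  qed (use that in \<open>auto simp: C_def\<close>)
  have g0: "g (\<lambda>_. 0) = (hs_norm S)\<^sup>2"
    unfolding hs_norm_sq[OF Sn] by (simp add: g_def F_def kron_form_def)
  show ?thesis
  proof (rule that[OF mF_cone[OF \<theta>(1)]])
    fix T assume T: "T \<in> sep_cone d1 d2"
    then have Tn: "T \<in> carrier_mat n n" using sep_cone_carrier by (simp add: n_def)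
    have gT: "(hs_norm (T - S))\<^sup>2 = (\<Sum>i<n. \<Sum>j<n. (cmod (T $$ (i, j) - S $$ (i, j)))\<^sup>2)"
      by (rule hs_norm_diff_sq[OF Tn Sn])
    show "(hs_norm (mF \<theta> - S))\<^sup>2 \<le> (hs_norm (T - S))\<^sup>2"
    \<comment> \<open>An operator farther from \<open>S\<close> than zero is beaten by zero, which
      belongs to \<open>C\<close>; only the others need parameters in \<open>C\<close>.\<close>
    proof (cases "(hs_norm (T - S))\<^sup>2 \<le> (hs_norm S)\<^sup>2")
      case False
      then show ?thesis using \<theta>(2)[OF zero] unfolding g0 hs_mF by simp
    next
      case True
      then have le: "hs_norm (T - S) \<le> hs_norm S" using hS by (rule power2_le_imp_le)
      have "Re (T $$ (i, i)) \<le> cmod (S $$ (i, i)) + hs_norm S" if "i < n" for i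
      proof -
        have "cmod (T $$ (i, i) - S $$ (i, i)) \<le> hs_norm S"
          using entry_diff_le_hs_norm[OF Tn Sn that that] le by simp
        moreover have "Re (T $$ (i, i)) \<le> cmod (T $$ (i, i))" by (rule complex_Re_le_cmod)
        moreover have "cmod (T $$ (i, i)) \<le> cmod (T $$ (i, i) - S $$ (i, i)) + cmod (S $$ (i, i))"
          using norm_triangle_ineq[of "T $$ (i, i) - S $$ (i, i)" "S $$ (i, i)"] by simp
        ultimately show ?thesis by simp
      qed
      then have "(\<Sum>i<n. Re (T $$ (i, i))) \<le> (\<Sum>i<n. cmod (S $$ (i, i)) + hs_norm S)"
        by (intro sum_mono) simp
      then have tr: "Re (\<Sum>i<n. T $$ (i, i)) \<le> M"
        unfolding Re_sum M_def by linarith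
      show ?thesis
      proof (rule sep_cone_bounded_representation[OF T n_def])
        fix A B :: "nat \<Rightarrow> nat \<Rightarrow> nat \<Rightarrow> complex"
        assume A: "\<And>a. psd_form d1 (A a)" "\<And>a i j. i < d1 \<Longrightarrow> j < d1 \<Longrightarrow> cmod (A a i j) \<le> 1" and
          B: "\<And>a. psd_form d2 (B a)" "\<And>a i j. i < d2 \<Longrightarrow> j < d2 \<Longrightarrow> cmod (B a i j) \<le> Re (\<Sum>i<n. T $$ (i, i))" and
          eq: "\<And>i j. i < n \<Longrightarrow> j < n \<Longrightarrow> T $$ (i, j) = (\<Sum>a<2 * n * n. kron_form d2 (A a) (B a) i j)"
        \<comment> \<open>\<open>A\<close> and \<open>B\<close> are bounded only inside the
          dimensions. Elsewhere the parameters are set to 0, since \<open>C\<close> demands the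
          bound at every index.\<close>
        define \<eta> where "\<eta> = (\<lambda>(b, a, i, j).
          if b then (if a < 2 * n * n \<and> i < d1 \<and> j < d1 then A a i j else 0)
          else (if a < 2 * n * n \<and> i < d2 \<and> j < d2 then B a i j else 0))"
        have F\<eta>: "F \<eta> i j = T $$ (i, j)" if ij: "i < n" "j < n" for i j
        proof -
          have "0 < d2" using ij by (cases d2) (auto simp: n_def)
          then have lt: "i div d2 < d1" "j div d2 < d1" "i mod d2 < d2" "j mod d2 < d2"
            using ij by (auto simp: n_def less_mult_imp_div_less)
          have "F \<eta> i j = (\<Sum>a<2 * n * n. kron_form d2 (A a) (B a) i j)"
            unfolding F_def R_def using lt by (simp add: \<eta>_def kron_form_def)
          then show ?thesis using eq[OF ij] by simp
        qed
        have "psd_form d1 (\<lambda>i j. \<eta> (True, a, i, j))" for a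
        proof (cases "a < 2 * n * n")
          case True
          then show ?thesis by (intro psd_form_cong[OF _ A(1)[of a]]) (auto simp: \<eta>_def)
        qed (simp add: \<eta>_def psd_form_zero)
        moreover have "psd_form d2 (\<lambda>i j. \<eta> (False, a, i, j))" for a
        proof (cases "a < 2 * n * n")
          case True
          then show ?thesis by (intro psd_form_cong[OF _ B(1)[of a]]) (auto simp: \<eta>_def)
        qed (simp add: \<eta>_def psd_form_zero)
        moreover have "psd_form n (F \<eta>)"
          using F\<eta> sep_cone_psd_form[OF T] unfolding n_def[symmetric]
          by - (rule psd_form_cong[of n "entry T"], simp_all)
        moreover have "cmod (\<eta> k) \<le> M" for k
        proof -
          obtain b a i j where k: "k = (b, a, i, j)" by (cases k) auto
          have "cmod (A a i j) \<le> M" if "i < d1" "j < d1" using A(2)[OF that, of a] M1 by simp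
          moreover have "cmod (B a i j) \<le> M" if "i < d2" "j < d2" using B(2)[OF that, of a] tr by simp
          ultimately show ?thesis using M1 by (auto simp: \<eta>_def k)
        qed
        ultimately have "\<eta> \<in> C" by (simp add: C_def)
        then have "g \<theta> \<le> g \<eta>" by (rule \<theta>(2))
        also have "g \<eta> = (hs_norm (T - S))\<^sup>2"
          unfolding gT g_def by (intro sum.cong refl) (simp add: F\<eta>)
        finally show ?thesis unfolding hs_mF .
      qed
    qed
  qed
qed

text \<open>\<open>ARG_MIN\<close> is a choice operator and has the property of a minimizer as soon
  as some minimizer exists.\<close>

lemma pi_sep_best:
  assumes "S \<in> carrier_mat (d1 * d2) (d1 * d2)"
  shows "pi_sep d1 d2 S \<in> sep_cone d1 d2"
    "T \<in> sep_cone d1 d2 \<Longrightarrow> (hs_norm (pi_sep d1 d2 S - S))\<^sup>2 \<le> (hs_norm (T - S))\<^sup>2"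
proof -
  let ?f = "\<lambda>S'. (hs_norm (S' - S))\<^sup>2" and ?P = "\<lambda>S'. S' \<in> sep_cone d1 d2"
  obtain T0 where "is_arg_min ?f ?P T0"
    using best_approximation_exists[OF assms] unfolding is_arg_min_def by (metis not_less)
  then have "is_arg_min ?f ?P (pi_sep d1 d2 S)"
    unfolding pi_sep_def arg_min_def by (rule someI)
  then show "pi_sep d1 d2 S \<in> sep_cone d1 d2"
    "T \<in> sep_cone d1 d2 \<Longrightarrow> (hs_norm (pi_sep d1 d2 S - S))\<^sup>2 \<le> (hs_norm (T - S))\<^sup>2"
    unfolding is_arg_min_def by (auto simp: not_less)
qed

lemma pi_sep_fixed:
  assumes S: "S \<in> sep_cone d1 d2"
  shows "pi_sep d1 d2 S = S"
proof -
  let ?P = "pi_sep d1 d2 S"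
  note Sc = sep_cone_carrier[OF S]
  note Pc = sep_cone_carrier[OF pi_sep_best(1)[OF Sc]]
  have "(hs_norm (S - S))\<^sup>2 = 0" by (simp add: hs_norm_diff_sq[OF Sc Sc])
  then have le: "hs_norm (?P - S) \<le> 0"
    using pi_sep_best(2)[OF Sc S] by (simp add: power2_le_imp_le)
  show ?thesis
  proof (rule eq_matI)
    fix i j assume "i < dim_row S" "j < dim_col S"
    then have "cmod (?P $$ (i, j) - S $$ (i, j)) \<le> hs_norm (?P - S)"
      using entry_diff_le_hs_norm[OF Pc Sc, of i j] Sc by simp
    from order_trans[OF this le] show "?P $$ (i, j) = S $$ (i, j)" by simp
  qed (use Sc Pc in auto)
qed

section \<open>A semidefiniteness test by separability\<close>

definition delta :: "nat \<Rightarrow> nat \<Rightarrow> complex" where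
  "delta i j = (if i = j then 1 else 0)"

lemma mult_cnj_eq: "z * cnj z = (complex_of_real (cmod z))\<^sup>2"
  using complex_norm_square[of z] by simp

lemma qform_delta: "qform n delta v = complex_of_real (\<Sum>i<n. (cmod (v i))\<^sup>2)"
  unfolding qform_def of_real_sum
  by (intro sum.cong refl) (simp add: delta_def mult_cnj_eq if_distrib[of "\<lambda>z. z * _"] cong: if_cong)

lemma psd_form_delta: "psd_form n delta"
  by (rule psd_formI) (auto simp: qform_delta delta_def sum_nonneg)

lemma qform_rank_one:
  "qform n (\<lambda>i j. w i * cnj (w j)) v = complex_of_real ((cmod (\<Sum>i<n. w i * cnj (v i)))\<^sup>2)"
  unfolding qform_def complex_norm_square cnj_sum sum_product
  by (intro sum.cong refl) simp

lemma psd_form_rank_one: "psd_form n (\<lambda>i j. w i * cnj (w j))"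
  by (rule psd_formI) (auto simp: qform_rank_one)

lemma psd_form_sum:
  assumes "\<And>k. k \<in> I \<Longrightarrow> psd_form n (a k)"
  shows "psd_form n (\<lambda>i j. \<Sum>k\<in>I. a k i j)"
  using assms by (induction I rule: infinite_finite_induct) (auto intro!: psd_form_zero psd_form_add)

text \<open>This is the trace of \<open>a\<close> times the transposed adjugate of \<open>b\<close>,
  or the value of the partial transpose of a \<otimes> b at e_0 \<otimes> e_1 - e_1 \<otimes> e_0.
  Its sign follows from the minors of \<open>a\<close> and \<open>b\<close> and the inequality
  between arithmetic and geometric mean.\<close>

lemma psd_form_two_pairing:
  assumes a: "psd_form 2 a" and b: "psd_form 2 b"
  shows "0 \<le> Re (a 0 0 * b 1 1 + a 1 1 * b 0 0 - a 0 1 * b 0 1 - a 1 0 * b 1 0)"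
proof -
  define p q r s where "p = Re (a 0 0)" and "q = Re (a 1 1)" and "r = Re (b 0 0)" and "s = Re (b 1 1)"
  define g h where "g = cmod (a 0 1)" and "h = cmod (b 0 1)"
  have pos: "0 \<le> p" "0 \<le> q" "0 \<le> r" "0 \<le> s" "0 \<le> g" "0 \<le> h"
    using psd_form_diag(1)[OF a, of 0] psd_form_diag(1)[OF a, of 1]
      psd_form_diag(1)[OF b, of 0] psd_form_diag(1)[OF b, of 1]
    by (simp_all add: p_def q_def r_def s_def g_def h_def)
  have eqs: "a 0 0 = complex_of_real p" "a 1 1 = complex_of_real q"
    "b 0 0 = complex_of_real r" "b 1 1 = complex_of_real s"
    using psd_form_diag(2)[OF a, of 0] psd_form_diag(2)[OF a, of 1]
      psd_form_diag(2)[OF b, of 0] psd_form_diag(2)[OF b, of 1]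
    by (simp_all add: p_def q_def r_def s_def)
  have "g\<^sup>2 \<le> p * q" "h\<^sup>2 \<le> r * s"
    using psd_form_minor[OF a, of 0 1] psd_form_minor[OF b, of 0 1]
    by (simp_all add: p_def q_def r_def s_def g_def h_def)
  then have "g\<^sup>2 * h\<^sup>2 \<le> (p * q) * (r * s)" using pos by (intro mult_mono) auto
  then have "(2 * (g * h))\<^sup>2 \<le> 4 * ((p * s) * (q * r))" by (simp add: power_mult_distrib algebra_simps)
  also have "\<dots> \<le> (p * s + q * r)\<^sup>2" using arith_geo_mean_sqrt[of "p * s" "q * r"]
    using zero_le_power2[of "p * s - q * r"] by (simp add: power2_eq_square algebra_simps)
  finally have le: "2 * (g * h) \<le> p * s + q * r"
    by (rule power2_le_imp_le) (use pos in simp)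
  have "a 1 0 * b 1 0 = cnj (a 0 1 * b 0 1)"
    using psd_form_hermitian[OF a, of 1 0] psd_form_hermitian[OF b, of 1 0] by simp
  then have "Re (a 0 0 * b 1 1 + a 1 1 * b 0 0 - a 0 1 * b 0 1 - a 1 0 * b 1 0)
      = p * s + q * r - 2 * Re (a 0 1 * b 0 1)"
    unfolding eqs by simp
  moreover have "Re (a 0 1 * b 0 1) \<le> g * h"
    using complex_Re_le_cmod[of "a 0 1 * b 0 1"] by (simp add: norm_mult g_def h_def)
  ultimately show ?thesis using le by simp
qed

text \<open>
  In the basis \<open>e\<^sub>x \<otimes> e\<^sub>k\<close> and \<open>e\<^sub>q\<close> of the two factors, the index \<open>4 x + 2 k + q\<close> stands for
  \<open>e\<^sub>x \<otimes> e\<^sub>k \<otimes> e\<^sub>q\<close>.  For \<open>b = 1 + a\<close> the form below is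
  \<open>1 \<otimes> \<Omega> + a \<otimes> |01\<rangle>\<langle>01|\<close>, where \<open>\<Omega>\<close> averages the product vectors
  \<open>(e\<^sub>0 + \<omega> e\<^sub>1) \<otimes> (e\<^sub>0 + \<omega>\<inverse> e\<^sub>1)\<close> over fourth roots of unity \<open>\<omega>\<close>.  It is
  separable if \<open>a\<close> is positive semidefinite, and its partial transpose takes the value of \<open>a\<close> at \<open>v\<close>
  on the vector \<open>v \<otimes> (e\<^sub>0 \<otimes> e\<^sub>1 - e\<^sub>1 \<otimes> e\<^sub>0)\<close>.
\<close>

definition block_pattern :: "nat \<Rightarrow> nat \<Rightarrow> complex \<Rightarrow> complex \<Rightarrow> complex" where
  "block_pattern k l d b = (if k = 1 \<and> l = 1 then b
     else if k = 2 \<and> l = 2 \<or> k \<in> {0, 3} \<and> l \<in> {0, 3} then d else 0)"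

definition test_form :: "(nat \<Rightarrow> nat \<Rightarrow> complex) \<Rightarrow> nat \<Rightarrow> nat \<Rightarrow> complex" where
  "test_form b i j = block_pattern (i mod 4) (j mod 4) (delta (i div 4) (j div 4)) (b (i div 4) (j div 4))"

lemma sum_lessThan_4: "(\<Sum>k<(4 :: nat). f k) = f 0 + f 1 + f 2 + f 3"
  by (simp add: numeral_eq_Suc add.assoc)

lemma sum_lessThan_2: "(\<Sum>k<(2 :: nat). f k) = f 0 + f 1"
  by (simp add: numeral_eq_Suc)

lemma qform_blocks:
  assumes "0 < m"
  shows "qform (n * m) a v = (\<Sum>x<n. \<Sum>y<n. \<Sum>k<m. \<Sum>l<m. a (x * m + k) (y * m + l) * v (y * m + l) * cnj (v (x * m + k)))"
proof -
  have e: "i = i div m * m + i mod m" for i by simp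
  have "qform (n * m) a v = (\<Sum>i<n * m. \<Sum>j<n * m. a (i div m * m + i mod m) (j div m * m + j mod m)
      * v (j div m * m + j mod m) * cnj (v (i div m * m + i mod m)))"
    unfolding qform_def by simp
  also have "\<dots> = (\<Sum>x<n. \<Sum>k<m. \<Sum>y<n. \<Sum>l<m. a (x * m + k) (y * m + l) * v (y * m + l) * cnj (v (x * m + k)))"
    unfolding sum_div_mod[where f = "\<lambda>y l. a _ (y * m + l) * v (y * m + l) * _"]
    by (rule sum_div_mod[where f = "\<lambda>x k. \<Sum>y<n. \<Sum>l<m. a (x * m + k) (y * m + l) * v (y * m + l) * cnj (v (x * m + k))"])
  also have "\<dots> = (\<Sum>x<n. \<Sum>y<n. \<Sum>k<m. \<Sum>l<m. a (x * m + k) (y * m + l) * v (y * m + l) * cnj (v (x * m + k)))"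
    by (intro sum.cong refl sum.swap)
  finally show ?thesis .
qed

lemma test_form_at:
  "k < 4 \<Longrightarrow> l < 4 \<Longrightarrow> test_form b (x * 4 + k) (y * 4 + l) = block_pattern k l (delta x y) (b x y)"
  by (simp add: test_form_def)

text \<open>\<Omega> is the sum of the rank-one forms of |00> + |11>, |01> and |10>, and
  \<open>b\<close> takes the place of the identity at |01>. So the whole is positive semidefinite as
  soon as \<open>b\<close> is, whereas its separability concerns b - 1.\<close>

lemma qform_test_form:
  "qform (n * 4) (test_form b) v = qform n delta (\<lambda>x. v (x * 4) + v (x * 4 + 3))
     + qform n delta (\<lambda>x. v (x * 4 + 2)) + qform n b (\<lambda>x. v (x * 4 + 1))"
proof -
  have "qform (n * 4) (test_form b) v = (\<Sum>x<n. \<Sum>y<n.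
      delta x y * (v (y * 4) + v (y * 4 + 3)) * cnj (v (x * 4) + v (x * 4 + 3))
      + delta x y * v (y * 4 + 2) * cnj (v (x * 4 + 2)) + b x y * v (y * 4 + 1) * cnj (v (x * 4 + 1)))"
    unfolding qform_blocks[of 4, simplified]
  proof (intro sum.cong refl)
    fix x y
    have e: "test_form b (x * 4 + k) (y * 4 + l) * v (y * 4 + l) * cnj (v (x * 4 + k))
        = block_pattern k l (delta x y) (b x y) * v (y * 4 + l) * cnj (v (x * 4 + k))" if "k < 4" "l < 4" for k l
      using test_form_at[OF that] by simp
    have "(\<Sum>k<4. \<Sum>l<4. test_form b (x * 4 + k) (y * 4 + l) * v (y * 4 + l) * cnj (v (x * 4 + k)))
        = (\<Sum>k<4. \<Sum>l<4. block_pattern k l (delta x y) (b x y) * v (y * 4 + l) * cnj (v (x * 4 + k)))"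
      by (intro sum.cong refl e) auto
    also have "\<dots> = delta x y * (v (y * 4) + v (y * 4 + 3)) * cnj (v (x * 4) + v (x * 4 + 3))
      + delta x y * v (y * 4 + 2) * cnj (v (x * 4 + 2)) + b x y * v (y * 4 + 1) * cnj (v (x * 4 + 1))"
      unfolding sum_lessThan_4 by (simp add: block_pattern_def algebra_simps)
    finally show "(\<Sum>k<4. \<Sum>l<4. test_form b (x * 4 + k) (y * 4 + l) * v (y * 4 + l) * cnj (v (x * 4 + k)))
      = delta x y * (v (y * 4) + v (y * 4 + 3)) * cnj (v (x * 4) + v (x * 4 + 3))
      + delta x y * v (y * 4 + 2) * cnj (v (x * 4 + 2)) + b x y * v (y * 4 + 1) * cnj (v (x * 4 + 1))" .
  qed
  then show ?thesis by (simp add: qform_def sum.distrib)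
qed

lemma block_pattern_hermitian: "block_pattern l k (cnj d) (cnj b) = cnj (block_pattern k l d b)"
  by (auto simp: block_pattern_def)

lemma psd_form_test_form:
  assumes b: "psd_form n b"
  shows "psd_form (n * 4) (test_form b)"
proof (rule psd_formI)
  fix i j assume "i < n * 4" "j < n * 4"
  then have "b (i div 4) (j div 4) = cnj (b (j div 4) (i div 4))"
    by (intro psd_form_hermitian[OF b]) auto
  moreover have "delta (i div 4) (j div 4) = cnj (delta (j div 4) (i div 4))" by (simp add: delta_def)
  ultimately show "test_form b i j = cnj (test_form b j i)"
    unfolding test_form_def block_pattern_hermitian[symmetric] by simp
next
  fix v show "0 \<le> Re (qform (n * 4) (test_form b) v)"
    unfolding qform_test_form qform_delta using psd_form_nonneg[OF b] by (simp add: sum_nonneg)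
qed

text \<open>The form a \<otimes> |0><0|, with the qubit as the last factor.\<close>

lemma psd_form_inflate:
  assumes a: "psd_form n a"
  shows "psd_form (n * 2) (\<lambda>i j. if i mod 2 = 0 \<and> j mod 2 = 0 then a (i div 2) (j div 2) else 0)"
    (is "psd_form _ ?A")
proof (rule psd_formI)
  fix i j assume "i < n * 2" "j < n * 2"
  then have "a (i div 2) (j div 2) = cnj (a (j div 2) (i div 2))"
    by (intro psd_form_hermitian[OF a]) auto
  then show "?A i j = cnj (?A j i)" by simp
next
  fix v
  have [simp]: "Suc (x * 2) mod 2 = Suc 0" for x :: nat by presburger
  have "qform (n * 2) ?A v = qform n a (\<lambda>x. v (x * 2))"
    unfolding qform_blocks[of 2, simplified] sum_lessThan_2 unfolding qform_def by simp
  then show "0 \<le> Re (qform (n * 2) ?A v)" using psd_form_nonneg[OF a] by simp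
qed

text \<open>The average of \<omega>^((k - q) - (l - r)) over the fourth roots of unity is 1 if k - q
  = l - r and 0 otherwise, which is the pattern of \<Omega>. The terms with \<open>a < 4\<close>
  carry \<omega> = \<i>^a; the fifth is (b - 1) \<otimes> |01><01|, whose first factor is positive
  semidefinite by assumption.\<close>

lemma test_form_separable:
  assumes b: "psd_form n (\<lambda>x y. b x y - delta x y)"
    and T: "T \<in> carrier_mat (n * 2 * 2) (n * 2 * 2)"
      "\<And>i j. i < n * 4 \<Longrightarrow> j < n * 4 \<Longrightarrow> T $$ (i, j) = test_form b i j"
  shows "T \<in> sep_cone (n * 2) 2"
proof -
  define \<alpha> \<beta> where "\<alpha> = (\<lambda>a k :: nat. if k = 0 then 1 else \<i> ^ a)"
    and "\<beta> = (\<lambda>a q :: nat. if q = 0 then 1 else cnj (\<i> ^ a))"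
  \<comment> \<open>For \<open>a < 4\<close> the sum over \<open>x\<close> expresses the identity on
    the first \<open>n\<close> dimensions, tensored with a quarter of the projection form of a qubit
    vector, through rank-one forms.\<close>
  define A where "A = (\<lambda>a :: nat. if a < 4 then (\<lambda>i j. \<Sum>x<n.
      complex_of_real (1 / 4) * ((if i div 2 = x then \<alpha> a (i mod 2) else 0) * cnj (if j div 2 = x then \<alpha> a (j mod 2) else 0)))
    else (\<lambda>i j. if i mod 2 = 0 \<and> j mod 2 = 0 then b (i div 2) (j div 2) - delta (i div 2) (j div 2) else 0))"
  define B where "B = (\<lambda>a :: nat. if a < 4 then (\<lambda>q q'. \<beta> a q * cnj (\<beta> a q'))
    else (\<lambda>q q'. (if q = 1 then 1 else 0) * cnj (if q' = 1 then 1 else 0)))"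
  have nn: "n * 2 * 2 = n * 4" by simp
  have "psd_form n (\<lambda>x y. (b x y - delta x y) + delta x y)"
    by (rule psd_form_add[OF b psd_form_delta])
  then have "psd_form (n * 4) (test_form b)" by (intro psd_form_test_form) simp
  then have psd: "psd (n * 2 * 2) T"
    unfolding psd_iff using T(1) unfolding nn
    by (intro conjI) (assumption, rule psd_form_cong[of _ "test_form b"], auto simp: T(2))
  show ?thesis
  proof (rule sep_coneI[OF psd, of 5 A B])
    fix a :: nat
    show "psd_form (n * 2) (A a)"
    proof (cases "a < 4")
      case True
      then show ?thesis unfolding A_def
        by (simp only: if_True) (intro psd_form_sum psd_form_scale psd_form_rank_one; simp)
    next
      case False
      then show ?thesis unfolding A_def using psd_form_inflate[OF b] by simp
    qed
    show "psd_form 2 (B a)"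
      unfolding B_def using psd_form_rank_one by (cases "a < 4") simp_all
  next
    fix i j assume ij: "i < n * 2 * 2" "j < n * 2 * 2"
    define x k q y l r where "x = i div 4" and "k = i div 2 mod 2" and "q = i mod 2"
      and "y = j div 4" and "l = j div 2 mod 2" and "r = j mod 2"
    have xy: "x < n" "y < n" using ij by (auto simp: x_def y_def)
    have lt: "k < 2" "q < 2" "l < 2" "r < 2" by (simp_all add: k_def q_def l_def r_def)
    have i2: "i div 2 div 2 = x" "j div 2 div 2 = y" by (simp_all add: x_def y_def div_mult2_eq[symmetric])
    have i4: "i mod 4 = 2 * k + q" "j mod 4 = 2 * l + r"
      using mod_mult2_eq[of i 2 2] mod_mult2_eq[of j 2 2] by (simp_all add: k_def q_def l_def r_def)
    have summand: "kron_form 2 (A a) (B a) i j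
        = 1 / 4 * delta x y * (\<alpha> a k * \<beta> a q * cnj (\<alpha> a l * \<beta> a r))" if "a < 4" for a
    proof -
      have "(\<Sum>z<n. complex_of_real (1 / 4) * ((if x = z then \<alpha> a k else 0) * cnj (if y = z then \<alpha> a l else 0)))
        = (\<Sum>z<n. if z = x then 1 / 4 * delta x y * (\<alpha> a k * cnj (\<alpha> a l)) else 0)"
        by (intro sum.cong refl) (auto simp: delta_def)
      also have "\<dots> = 1 / 4 * delta x y * (\<alpha> a k * cnj (\<alpha> a l))" using xy by simp
      finally have sum: "(\<Sum>z<n. complex_of_real (1 / 4) * ((if x = z then \<alpha> a k else 0) * cnj (if y = z then \<alpha> a l else 0)))
        = 1 / 4 * delta x y * (\<alpha> a k * cnj (\<alpha> a l))" .
      have "kron_form 2 (A a) (B a) i j = (\<Sum>z<n. complex_of_real (1 / 4) *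
          ((if x = z then \<alpha> a k else 0) * cnj (if y = z then \<alpha> a l else 0))) * (\<beta> a q * cnj (\<beta> a r))"
        unfolding kron_form_def A_def B_def using that
        by (simp only: if_True i2 k_def l_def q_def r_def)
      then show ?thesis unfolding sum by simp
    qed
    have last: "kron_form 2 (A 4) (B 4) i j = (if k = 0 \<and> l = 0 \<and> q = 1 \<and> r = 1 then b x y - delta x y else 0)"
      by (simp add: kron_form_def A_def B_def i2 k_def[symmetric] l_def[symmetric] q_def[symmetric] r_def[symmetric])
    have "(\<Sum>a<5. kron_form 2 (A a) (B a) i j) = (\<Sum>a<4. kron_form 2 (A a) (B a) i j) + kron_form 2 (A 4) (B 4) i j"
      by (simp add: numeral_eq_Suc)
    also have "(\<Sum>a<4. kron_form 2 (A a) (B a) i j)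
        = 1 / 4 * delta x y * (\<Sum>a<4. \<alpha> a k * \<beta> a q * cnj (\<alpha> a l * \<beta> a r))"
      unfolding sum_distrib_left by (intro sum.cong refl summand) simp
    also have "\<dots> + kron_form 2 (A 4) (B 4) i j = block_pattern (2 * k + q) (2 * l + r) (delta x y) (b x y)"
    proof -
      have "k = 0 \<or> k = 1" "q = 0 \<or> q = 1" "l = 0 \<or> l = 1" "r = 0 \<or> r = 1" using lt by auto
      then show ?thesis
        unfolding last sum_lessThan_4
        by (elim disjE) (simp_all add: \<alpha>_def \<beta>_def block_pattern_def power2_eq_square power3_eq_cube)
    qed
    also have "\<dots> = T $$ (i, j)" using T(2)[of i j] ij by (simp add: test_form_def i4 x_def y_def)
    finally show "T $$ (i, j) = (\<Sum>a<5. kron_form 2 (A a) (B a) i j)" ..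
  qed simp
qed


section \<open>The partial transpose criterion and its stability under entrywise errors\<close>

lemma qform_sum: "qform n (\<lambda>x y. \<Sum>a\<in>I. t a x y) v = (\<Sum>a\<in>I. qform n (t a) v)"
proof (induction I rule: infinite_finite_induct)
  case (insert a I)
  then have "(\<lambda>x y. \<Sum>a\<in>insert a I. t a x y) = (\<lambda>x y. t a x y + (\<Sum>a\<in>I. t a x y))" by (simp add: fun_eq_iff)
  then show ?case using insert by (simp add: qform_add)
qed (simp_all add: qform_def)

lemma cmod_qform_le:
  assumes "\<And>x y. x < n \<Longrightarrow> y < n \<Longrightarrow> cmod (e x y) \<le> c" "0 \<le> c"
  shows "cmod (qform n e v) \<le> c * real n * (\<Sum>x<n. (cmod (v x))\<^sup>2)"
proof -
  let ?q = "\<lambda>x. (cmod (v x))\<^sup>2"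
  have term_le: "cmod (e x y * v y * cnj (v x)) \<le> c / 2 * (?q x + ?q y)" if "x < n" "y < n" for x y
  proof -
    have "2 * (cmod (v y) * cmod (v x)) \<le> ?q x + ?q y"
      using zero_le_power2[of "cmod (v x) - cmod (v y)"] by (simp add: power2_eq_square algebra_simps)
    then have "cmod (v y) * cmod (v x) \<le> (?q x + ?q y) / 2" by simp
    then have "cmod (e x y) * (cmod (v y) * cmod (v x)) \<le> c * ((?q x + ?q y) / 2)"
      using assms(1)[OF that] assms(2) by (intro mult_mono) auto
    then show ?thesis by (simp add: norm_mult mult.assoc)
  qed
  have "cmod (qform n e v) \<le> (\<Sum>x<n. \<Sum>y<n. cmod (e x y * v y * cnj (v x)))"
    unfolding qform_def by (intro order_trans[OF norm_sum] sum_mono norm_sum)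
  also have "\<dots> \<le> (\<Sum>x<n. \<Sum>y<n. c / 2 * (?q x + ?q y))"
    by (intro sum_mono term_le) auto
  also have "\<dots> = c / 2 * ((\<Sum>x<n. \<Sum>y<n. ?q x) + (\<Sum>x<n. \<Sum>y<n. ?q y))"
    by (simp only: sum_distrib_left[symmetric] sum.distrib)
  also have "\<dots> = c * real n * (\<Sum>x<n. ?q x)"
    by (simp add: sum_distrib_left[symmetric] algebra_simps)
  finally show ?thesis .
qed

text \<open>An entrywise error \<open>c\<close> changes the form by at most c n |v|^2, which the
  multiple \<kappa> of the identity absorbs. Of \<open>a\<close> only nonnegative real values are
  required, so that no symmetry of a contraction has to be proved.\<close>

lemma psd_form_perturb:
  assumes a: "\<And>v. 0 \<le> Re (qform n a v)"
    and b: "\<And>x y. x < n \<Longrightarrow> y < n \<Longrightarrow> b x y = cnj (b y x)"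
    and close: "\<And>x y. x < n \<Longrightarrow> y < n \<Longrightarrow> cmod (a x y - b x y) \<le> c" "0 \<le> c" "c * real n \<le> \<kappa>"
  shows "psd_form n (\<lambda>x y. b x y + complex_of_real \<kappa> * delta x y)"
proof (rule psd_formI)
  fix x y assume "x < n" "y < n"
  from b[OF this] show "b x y + complex_of_real \<kappa> * delta x y = cnj (b y x + complex_of_real \<kappa> * delta y x)"
    by (simp add: delta_def)
next
  fix v
  let ?s = "\<Sum>x<n. (cmod (v x))\<^sup>2"
  have "cmod (qform n (\<lambda>x y. a x y - b x y) v) \<le> c * real n * ?s"
    by (rule cmod_qform_le[OF close(1,2)])
  also have "\<dots> \<le> \<kappa> * ?s" using close(3) by (intro mult_right_mono sum_nonneg) auto
  finally have "Re (qform n (\<lambda>x y. a x y - b x y) v) \<le> \<kappa> * ?s"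
    using complex_Re_le_cmod order_trans by blast
  moreover have "qform n a v = qform n b v + qform n (\<lambda>x y. a x y - b x y) v"
    unfolding qform_add[symmetric] by simp
  ultimately have "0 \<le> Re (qform n b v) + \<kappa> * ?s" using a[of v] by simp
  then show "0 \<le> Re (qform n (\<lambda>x y. b x y + complex_of_real \<kappa> * delta x y) v)"
    unfolding qform_add qform_scale qform_delta by simp
qed

text \<open>The partial transpose over the last qubit, evaluated at e_0 \<otimes> e_1 - e_1
  \<otimes> e_0; what remains is a form on the first \<open>n\<close> dimensions. Positions 0, 1, 2,
  3 in a block stand for |00>, |01>, |10>, |11>, and the transposition moves the mixed terms from
  (1, 2) and (2, 1) to (0, 3) and (3, 0).\<close>

definition contraction :: "(nat \<Rightarrow> nat \<Rightarrow> complex) \<Rightarrow> nat \<Rightarrow> nat \<Rightarrow> complex" where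
  "contraction t x y = t (x * 4 + 1) (y * 4 + 1) + t (x * 4 + 2) (y * 4 + 2)
     - t (x * 4 + 0) (y * 4 + 3) - t (x * 4 + 3) (y * 4 + 0)"

text \<open>Evaluating the first factor at \<open>v\<close> leaves a form \<open>G\<close> on a
  qubit, positive semidefinite because its value at \<open>w\<close> is that of \<open>A\<close> at
  v \<otimes> w. The pairing of \<open>G\<close> with \<open>B\<close> is the value of the
  contraction.\<close>

lemma contraction_kron_form:
  assumes A: "psd_form (n * 2) A" and B: "psd_form 2 B"
  shows "0 \<le> Re (qform n (contraction (kron_form 2 A B)) v)"
proof -
  define G where "G = (\<lambda>k l. qform n (\<lambda>x y. A (x * 2 + k) (y * 2 + l)) v)"
  have "psd_form 2 G"
  proof (rule psd_formI)
    fix k l :: nat assume "k < 2" "l < 2"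
    then have "A (y * 2 + k) (x * 2 + l) = cnj (A (x * 2 + l) (y * 2 + k))" if "x < n" "y < n" for x y
      using that by (intro psd_form_hermitian[OF A] index_less) auto
    then have "cnj (G l k) = (\<Sum>x<n. \<Sum>y<n. A (y * 2 + k) (x * 2 + l) * v x * cnj (v y))"
      unfolding G_def qform_def cnj_sum by (intro sum.cong refl) (simp add: mult_ac)
    also have "\<dots> = G k l" unfolding G_def qform_def by (rule sum.swap)
    finally show "G k l = cnj (G l k)" ..
  next
    fix w
    have "qform (n * 2) A (\<lambda>i. w (i mod 2) * v (i div 2))
      = (\<Sum>x<n. \<Sum>y<n. \<Sum>k<2. \<Sum>l<2. A (x * 2 + k) (y * 2 + l) * (w l * v y) * cnj (w k * v x))"
      unfolding qform_blocks[of 2, simplified] by (intro sum.cong refl) simp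
    also have "\<dots> = (\<Sum>k<2. \<Sum>l<2. \<Sum>x<n. \<Sum>y<n. A (x * 2 + k) (y * 2 + l) * (w l * v y) * cnj (w k * v x))"
      unfolding sum_lessThan_2 by (simp add: sum.distrib)
    also have "\<dots> = qform 2 G w"
      unfolding qform_def[of 2] G_def unfolding qform_def sum_distrib_right sum_distrib_left
      by (intro sum.cong refl) (simp add: mult_ac)
    finally show "0 \<le> Re (qform 2 G w)" using psd_form_nonneg[OF A] by metis
  qed
  from psd_form_two_pairing[OF this B]
  have "0 \<le> Re (B 1 1 * G 0 0 + B 0 0 * G 1 1 + (- B 0 1) * G 0 1 + (- B 1 0) * G 1 0)"
    by (simp add: mult.commute)
  also have "B 1 1 * G 0 0 + B 0 0 * G 1 1 + (- B 0 1) * G 0 1 + (- B 1 0) * G 1 0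
      = qform n (\<lambda>x y. B 1 1 * A (x * 2 + 0) (y * 2 + 0) + B 0 0 * A (x * 2 + 1) (y * 2 + 1)
          + (- B 0 1) * A (x * 2 + 0) (y * 2 + 1) + (- B 1 0) * A (x * 2 + 1) (y * 2 + 0)) v"
    unfolding G_def qform_add qform_scale ..
  also have "\<dots> = qform n (contraction (kron_form 2 A B)) v"
  proof (rule qform_cong)
    fix x y
    have d: "(z * 4 + 0) div 2 = z * 2 + 0" "(z * 4 + 0) mod 2 = 0" "(z * 4 + 1) div 2 = z * 2 + 0" "(z * 4 + 1) mod 2 = 1"
      "(z * 4 + 2) div 2 = z * 2 + 1" "(z * 4 + 2) mod 2 = 0" "(z * 4 + 3) div 2 = z * 2 + 1" "(z * 4 + 3) mod 2 = 1"
      for z :: nat by presburger+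
    show "B 1 1 * A (x * 2 + 0) (y * 2 + 0) + B 0 0 * A (x * 2 + 1) (y * 2 + 1)
          + (- B 0 1) * A (x * 2 + 0) (y * 2 + 1) + (- B 1 0) * A (x * 2 + 1) (y * 2 + 0)
        = contraction (kron_form 2 A B) x y"
      unfolding contraction_def kron_form_def d by (simp add: mult.commute)
  qed
  finally show ?thesis .
qed

text \<open>The case of the Peres criterion that is needed: the contraction is linear, so it
  suffices to consider products.\<close>

lemma contraction_sep_cone:
  assumes T: "T \<in> sep_cone (n * 2) 2"
  shows "0 \<le> Re (qform n (contraction (entry T)) v)"
proof (rule sep_coneE[OF T])
  fix r :: nat and A B
  assume A: "\<And>a. a < r \<Longrightarrow> psd_form (n * 2) (A a)" and B: "\<And>a. a < r \<Longrightarrow> psd_form 2 (B a)"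
    and eq: "\<And>i j. i < n * 2 * 2 \<Longrightarrow> j < n * 2 * 2 \<Longrightarrow> T $$ (i, j) = (\<Sum>a<r. kron_form 2 (A a) (B a) i j)"
  have "qform n (contraction (entry T)) v = qform n (\<lambda>x y. \<Sum>a<r. contraction (kron_form 2 (A a) (B a)) x y) v"
  proof (rule qform_cong)
    fix x y assume "x < n" "y < n"
    then have "x * 4 + k < n * 2 * 2" "y * 4 + k < n * 2 * 2" if "k < 4" for k
      using index_less[of x n k 4] index_less[of y n k 4] that by simp_all
    then have E: "T $$ (x * 4 + k, y * 4 + l) = (\<Sum>a<r. kron_form 2 (A a) (B a) (x * 4 + k) (y * 4 + l))"
      if "k < 4" "l < 4" for k l using eq that by blast
    have L: "(0 :: nat) < 4" "(1 :: nat) < 4" "(2 :: nat) < 4" "(3 :: nat) < 4" by simp_all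
    show "contraction (entry T) x y = (\<Sum>a<r. contraction (kron_form 2 (A a) (B a)) x y)"
      unfolding contraction_def E[OF L(2) L(2)] E[OF L(3) L(3)] E[OF L(1) L(4)] E[OF L(4) L(1)]
      by (simp only: sum_subtractf sum.distrib)
  qed
  also have "\<dots> = (\<Sum>a<r. qform n (contraction (kron_form 2 (A a) (B a))) v)"
    by (rule qform_sum)
  finally have "Re (qform n (contraction (entry T)) v)
      = (\<Sum>a<r. Re (qform n (contraction (kron_form 2 (A a) (B a))) v))" by simp
  also have "0 \<le> \<dots>" by (intro sum_nonneg contraction_kron_form A B) auto
  finally show ?thesis .
qed

lemma contraction_test_form: "contraction (test_form b) x y = b x y - delta x y"
  using test_form_at[of 1 1 b x y] test_form_at[of 2 2 b x y] test_form_at[of 0 3 b x y] test_form_at[of 3 0 b x y]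
  by (simp add: contraction_def block_pattern_def)

lemma norm_four_terms:
  fixes a b c d :: complex
  assumes "cmod a \<le> e" "cmod b \<le> e" "cmod c \<le> e" "cmod d \<le> e"
  shows "cmod (a + b - c - d) \<le> 4 * e"
  using assms norm_triangle_ineq[of a b] norm_triangle_ineq4[of "a + b" c] norm_triangle_ineq4[of "a + b - c" d]
  by linarith

text \<open>The contraction of \<open>T\<close> is nonnegative on every vector, and that of the test
  form is b - 1. Its four terms are off by at most \<epsilon> each.\<close>

lemma psd_form_of_test:
  assumes T: "T \<in> sep_cone (n * 2) 2"
    and b: "\<And>x y. x < n \<Longrightarrow> y < n \<Longrightarrow> b x y = cnj (b y x)"
    and close: "\<And>i j. i < n * 4 \<Longrightarrow> j < n * 4 \<Longrightarrow> cmod (T $$ (i, j) - test_form b i j) \<le> \<epsilon>"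
    and \<kappa>: "0 \<le> \<epsilon>" "4 * \<epsilon> * real n \<le> \<kappa>"
  shows "psd_form n (\<lambda>x y. b x y - delta x y + complex_of_real \<kappa> * delta x y)"
proof (rule psd_form_perturb[where a = "contraction (entry T)" and c = "4 * \<epsilon>"])
  fix v show "0 \<le> Re (qform n (contraction (entry T)) v)" by (rule contraction_sep_cone[OF T])
next
  fix x y assume xy: "x < n" "y < n"
  from b[OF this] show "b x y - delta x y = cnj (b y x - delta y x)" by (simp add: delta_def)
  let ?d = "\<lambda>k l. T $$ (x * 4 + k, y * 4 + l) - test_form b (x * 4 + k) (y * 4 + l)"
  have le: "cmod (?d k l) \<le> \<epsilon>" if "k < 4" "l < 4" for k l
    using xy that by (intro close index_less)
  have eq: "contraction (entry T) x y - (b x y - delta x y) = ?d 1 1 + ?d 2 2 - ?d 0 3 - ?d 3 0"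
    unfolding contraction_test_form[symmetric] contraction_def by simp
  show "cmod (contraction (entry T) x y - (b x y - delta x y)) \<le> 4 * \<epsilon>"
    unfolding eq by (rule norm_four_terms; rule le; simp)
qed (use \<kappa> in auto)

section \<open>Separability of operators with a small multiple of the identity added\<close>

text \<open>The multiple of the identity is itself a product, (\<eta> 1) \<otimes> 1, and is
  appended as one more term.\<close>

lemma sep_cone_add_identity:
  assumes X: "X \<in> sep_cone d1 d2" and \<eta>: "0 \<le> \<eta>"
    and T: "T \<in> carrier_mat (d1 * d2) (d1 * d2)"
      "\<And>i j. i < d1 * d2 \<Longrightarrow> j < d1 * d2 \<Longrightarrow> T $$ (i, j) = X $$ (i, j) + complex_of_real \<eta> * delta i j"
  shows "T \<in> sep_cone d1 d2"
proof (rule sep_coneE[OF X])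
  fix r :: nat and A B
  assume A: "\<And>a. a < r \<Longrightarrow> psd_form d1 (A a)" and B: "\<And>a. a < r \<Longrightarrow> psd_form d2 (B a)"
    and eq: "\<And>i j. i < d1 * d2 \<Longrightarrow> j < d1 * d2 \<Longrightarrow> X $$ (i, j) = (\<Sum>a<r. kron_form d2 (A a) (B a) i j)"
  have "psd_form (d1 * d2) (\<lambda>i j. X $$ (i, j) + complex_of_real \<eta> * delta i j)"
    by (intro psd_form_add psd_form_scale psd_form_delta sep_cone_psd_form X \<eta>)
  then have psd: "psd (d1 * d2) T"
    unfolding psd_iff using T by (auto intro: psd_form_cong[rotated])
  let ?A = "A(r := \<lambda>i j. complex_of_real \<eta> * delta i j)" and ?B = "B(r := delta)"
  show ?thesis
  proof (rule sep_coneI[OF psd, of "Suc r" ?A ?B])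
    fix a assume "a < Suc r"
    then show "psd_form d1 (?A a)" "psd_form d2 (?B a)"
      using A[of a] B[of a] \<eta> psd_form_delta by (auto simp: less_Suc_eq intro: psd_form_scale)
  next
    fix i j assume ij: "i < d1 * d2" "j < d1 * d2"
    have "i = j \<longleftrightarrow> i div d2 = j div d2 \<and> i mod d2 = j mod d2" by (metis div_mult_mod_eq)
    then have "kron_form d2 (\<lambda>i j. complex_of_real \<eta> * delta i j) delta i j = complex_of_real \<eta> * delta i j"
      by (auto simp: kron_form_def delta_def)
    then show "T $$ (i, j) = (\<Sum>a<Suc r. kron_form d2 (?A a) (?B a) i j)"
      using T(2)[OF ij] eq[OF ij] by simp
  qed simp
qed

lemma sep_cone_scale:
  assumes X: "X \<in> sep_cone d1 d2" and c: "0 \<le> c"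
  shows "mat (d1 * d2) (d1 * d2) (\<lambda>(i, j). complex_of_real c * X $$ (i, j)) \<in> sep_cone d1 d2"
proof (rule sep_coneE[OF X])
  fix r :: nat and A B
  assume "1 \<le> r" and A: "\<And>a. a < r \<Longrightarrow> psd_form d1 (A a)" and B: "\<And>a. a < r \<Longrightarrow> psd_form d2 (B a)"
    and eq: "\<And>i j. i < d1 * d2 \<Longrightarrow> j < d1 * d2 \<Longrightarrow> X $$ (i, j) = (\<Sum>a<r. kron_form d2 (A a) (B a) i j)"
  have "psd_form (d1 * d2) (\<lambda>i j. complex_of_real c * X $$ (i, j))"
    by (intro psd_form_scale sep_cone_psd_form X c)
  then have psd: "psd (d1 * d2) (mat (d1 * d2) (d1 * d2) (\<lambda>(i, j). complex_of_real c * X $$ (i, j)))"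
    unfolding psd_iff by (auto intro: psd_form_cong[rotated])
  show ?thesis
  proof (rule sep_coneI[OF psd \<open>1 \<le> r\<close>, of "\<lambda>a i j. complex_of_real c * A a i j" B])
    fix i j assume ij: "i < d1 * d2" "j < d1 * d2"
    then show "mat (d1 * d2) (d1 * d2) (\<lambda>(i, j). complex_of_real c * X $$ (i, j)) $$ (i, j)
        = (\<Sum>a<r. kron_form d2 (\<lambda>i j. complex_of_real c * A a i j) (B a) i j)"
      using eq[OF ij] by (simp add: sum_distrib_left kron_form_def mult.assoc)
  qed (auto intro: psd_form_scale A B c)
qed

text \<open>Dividing \<open>T\<close> by its trace \<open>t\<close> gives a separable state
  \<open>Z\<close>. The trace is off by at most n e, so 1 / t \<le> 2, and X - Z = ((X - T) + (t -
  1) X) / t has entries at most 2 e (1 + n c); the norm costs another factor n.\<close>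

lemma sep_states_plus_of_close:
  assumes T: "T \<in> sep_cone d1 d2" and n: "n = d1 * d2" "0 < n"
    and X: "X \<in> trace_one_hermitian n" "\<And>i j. i < n \<Longrightarrow> j < n \<Longrightarrow> cmod (X $$ (i, j)) \<le> c"
    and close: "\<And>i j. i < n \<Longrightarrow> j < n \<Longrightarrow> cmod (T $$ (i, j) - X $$ (i, j)) \<le> e"
    and e: "0 \<le> e" "real n * e \<le> 1 / 2" and \<delta>: "2 * real n * e * (1 + real n * c) \<le> \<delta>"
  shows "X \<in> sep_states_plus d1 d2 \<delta>"
proof -
  have Xc: "X \<in> carrier_mat n n" and trX: "mat_trace X = 1"
    using X(1) by (auto simp: trace_one_hermitian_def hermitian_def)
  have Tc: "T \<in> carrier_mat n n" using sep_cone_carrier[OF T] n by simp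
  have c0: "0 \<le> c" using X(2)[of 0 0] n(2) norm_ge_zero order_trans by blast
  define t where "t = (\<Sum>i<n. Re (T $$ (i, i)))"
  have trT: "(\<Sum>i<n. T $$ (i, i)) = complex_of_real t"
    unfolding t_def of_real_sum
    by (intro sum.cong refl) (use psd_form_diag(2)[OF sep_cone_psd_form[OF T]] n in auto)
  have "complex_of_real t - 1 = (\<Sum>i<n. T $$ (i, i) - X $$ (i, i))"
    using trX Xc trT by (simp add: sum_subtractf mat_trace_def)
  moreover have "cmod (\<Sum>i<n. T $$ (i, i) - X $$ (i, i)) \<le> (\<Sum>i<n. e)"
    by (intro order_trans[OF norm_sum] sum_mono close) auto
  ultimately have "cmod (complex_of_real (t - 1)) \<le> real n * e" by simp
  then have t1: "\<bar>t - 1\<bar> \<le> real n * e" unfolding norm_of_real .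
  then have t: "1 / 2 \<le> t" using e(2) by linarith
  define Z where "Z = mat n n (\<lambda>(i, j). complex_of_real (1 / t) * T $$ (i, j))"
  have "Z \<in> sep_cone d1 d2"
    unfolding Z_def n(1) using t by (intro sep_cone_scale[OF T]) simp
  moreover have "mat_trace Z = 1"
    using trT t by (simp add: mat_trace_def Z_def sum_divide_distrib[symmetric])
  ultimately have Z: "Z \<in> sep_states d1 d2" by (simp add: sep_states_def)
  have "hs_norm (X - Z) \<le> real n * (2 * e * (1 + real n * c))"
  proof (rule hs_norm_le)
    show "X - Z \<in> carrier_mat n n" by (simp add: Z_def minus_carrier_mat)
    show "0 \<le> 2 * e * (1 + real n * c)" using e c0 by simp
    fix i j assume ij: "i < n" "j < n"
    have "X $$ (i, j) - Z $$ (i, j)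
        = complex_of_real (1 / t) * ((X $$ (i, j) - T $$ (i, j)) + complex_of_real (t - 1) * X $$ (i, j))"
      using ij t by (simp add: Z_def field_simps)
    then have "cmod (X $$ (i, j) - Z $$ (i, j))
        = 1 / t * cmod ((X $$ (i, j) - T $$ (i, j)) + complex_of_real (t - 1) * X $$ (i, j))"
      using t by (simp add: norm_mult norm_divide)
    also have "\<dots> \<le> 2 * (e + real n * e * c)"
    proof (rule mult_mono)
      show "1 / t \<le> 2" using t by (simp add: field_simps)
      have "cmod (complex_of_real (t - 1) * X $$ (i, j)) \<le> real n * e * c"
        unfolding norm_mult norm_of_real using t1 X(2)[OF ij] e by (intro mult_mono) auto
      then show "cmod ((X $$ (i, j) - T $$ (i, j)) + complex_of_real (t - 1) * X $$ (i, j)) \<le> e + real n * e * c"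
        using close[OF ij] by (intro order_trans[OF norm_triangle_ineq] add_mono) (simp_all add: norm_minus_commute)
    qed auto
    finally have "cmod (X $$ (i, j) - Z $$ (i, j)) \<le> 2 * e * (1 + real n * c)"
      by (simp add: algebra_simps)
    then show "cmod ((X - Z) $$ (i, j)) \<le> 2 * e * (1 + real n * c)"
      using ij Xc by (simp add: Z_def)
  qed
  then have "hs_norm (X - Z) \<le> \<delta>" using \<delta> by (simp add: mult_ac)
  then show ?thesis
    unfolding sep_states_plus_def hs_ball_def using Z X(1) n(1) by blast
qed

section \<open>The reduction\<close>

definition order_data :: "data \<Rightarrow> data" where
  "order_data z = mul_data (hd_data z) (hd_data (tl_data z))"

definition order_power :: "nat \<Rightarrow> data \<Rightarrow> data" where
  "order_power j z = (mul_data (order_data z) ^^ j) (Num 1)"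

text \<open>The fraction (a u + b) / e. Nothing is reduced to lowest terms, since the coding admits
  arbitrary fractions.\<close>

definition affine_rat :: "data \<Rightarrow> data \<Rightarrow> data \<Rightarrow> data \<Rightarrow> data" where
  "affine_rat a b e u = cons_data (add_data (mul_data a (hd_data u)) (mul_data b (hd_data (tl_data u))))
     (cons_data (mul_data e (hd_data (tl_data u))) (Lst []))"

text \<open>The offset \<open>b\<close> is real, hence the 0 in the imaginary part.\<close>

definition affine_entry :: "data \<Rightarrow> data \<Rightarrow> data \<Rightarrow> data \<Rightarrow> data" where
  "affine_entry a b e z = cons_data (affine_rat a b e (hd_data z))
     (cons_data (affine_rat a (Num 0) e (hd_data (tl_data z))) (Lst []))"

definition delta_entry :: "data \<Rightarrow> data \<Rightarrow> data" where
  "delta_entry i j = cons_data (cons_data (eq_data i j) (Lst [Num 1])) (Lst [Lst [Num 0, Num 1]])"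

definition zero_entry :: data where
  "zero_entry = Lst [Lst [Num 0, Num 1], Lst [Num 0, Num 1]]"

definition expand_mat :: "(data \<Rightarrow> data \<Rightarrow> data \<Rightarrow> data) list list \<Rightarrow> data \<Rightarrow> data" where
  "expand_mat gss X =
     Lst (expand_list (map (\<lambda>gs i row. Lst (expand_list (map (\<lambda>g. g i) gs) (items row))) gss) (items X))"

definition sq_data :: "data \<Rightarrow> data" where
  "sq_data d = mul_data d d"

text \<open>For fractions this says |s - t| \<le> 1 / k and |s| \<le> 2, cross-multiplied, with
  squares in place of absolute values. \<open>less_data\<close> yields \<open>Num 0\<close> only on
  integers, so a missing integer makes the test fail. The second clause does not mention
  \<open>t\<close>: it checks the query itself.\<close>

definition rat_close :: "data \<Rightarrow> data \<Rightarrow> data \<Rightarrow> bool" where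
  "rat_close k s t \<longleftrightarrow>
     less_data (sq_data (mul_data (hd_data (tl_data s)) (hd_data (tl_data t))))
       (sq_data (mul_data k (sub_data (mul_data (hd_data s) (hd_data (tl_data t)))
          (mul_data (hd_data t) (hd_data (tl_data s)))))) = Num 0 \<and>
     less_data (mul_data (Num 4) (sq_data (hd_data (tl_data s)))) (sq_data (hd_data s)) = Num 0"

definition entry_close :: "data \<Rightarrow> data \<Rightarrow> data \<Rightarrow> bool" where
  "entry_close k s t \<longleftrightarrow> rat_close k (hd_data s) (hd_data t) \<and>
     rat_close k (hd_data (tl_data s)) (hd_data (tl_data t))"

definition mat_close :: "data \<Rightarrow> data \<Rightarrow> data \<Rightarrow> bool" where
  "mat_close k M T \<longleftrightarrow> all2_data (\<lambda>s t. all2_data (entry_close k) (items s) t) (items M) T"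

definition sep_query :: "data \<Rightarrow> data \<Rightarrow> data \<Rightarrow> data \<Rightarrow> data" where
  "sep_query d1 d2 k M =
     cons_data d1 (cons_data d2 (cons_data (cons_data (Num 1) (cons_data k (Lst []))) (cons_data M (Lst []))))"

definition scaled_power :: "int \<Rightarrow> nat \<Rightarrow> data \<Rightarrow> data" where
  "scaled_power N j z = mul_data (Num N) (order_power j z)"

text \<open>The coded test form for b = 1 + X / n^3; the nested list repeats
  \<open>block_pattern\<close>. The scaling makes \<open>b\<close> positive semidefinite if the
  entries of \<open>X\<close> are at most 5, because 5 n \<le> n^3 for n \<ge> 4.\<close>

definition psd_instance :: "data \<Rightarrow> data" where
  "psd_instance z =
     (let ze = (\<lambda>i j e. zero_entry); d = (\<lambda>i j e. delta_entry i j);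
          b = (\<lambda>i j e. affine_entry (Num 1) (mul_data (order_power 3 z) (eq_data i j)) (order_power 3 z) e)
      in expand_mat [[d, ze, ze, d], [ze, b, ze, ze], [ze, ze, d, ze], [d, ze, ze, d]] (hd_data (tl_data (tl_data z))))"

text \<open>The operator X + \<eta> for \<eta> = 1 / (N n^26).\<close>

definition sep_instance :: "int \<Rightarrow> data \<Rightarrow> data" where
  "sep_instance N z = expand_mat
     [[\<lambda>i j e. affine_entry (scaled_power N 26 z) (eq_data i j) (scaled_power N 26 z) e]]
     (hd_data (tl_data (tl_data z)))"

text \<open>Both queries are made in any case. Two successful comparisons imply that both were
  within the promise, and a separable state passes both.\<close>

definition membership_answer :: "int \<Rightarrow> answers \<Rightarrow> data \<Rightarrow> data" where
  "membership_answer N f z = (let k = scaled_power N 34 z in bool_data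
     (mat_close k (psd_instance z)
        (f (sep_query (mul_data (order_data z) (Num 2)) (Num 2) k (psd_instance z))) \<and>
      mat_close k (sep_instance N z)
        (f (sep_query (hd_data z) (hd_data (tl_data z)) k (sep_instance N z)))))"

subsection \<open>Running time\<close>

lemma computable_conj:
  assumes "computable \<Gamma> (\<lambda>f x. bool_data (P f x))" "computable \<Gamma> (\<lambda>f x. bool_data (Q f x))"
  shows "computable \<Gamma> (\<lambda>f x. bool_data (P f x \<and> Q f x))"
  using computable_mul[OF assms] by simp

lemmas computable_ops = computable_hd computable_tl computable_cons computable_add computable_sub
  computable_mul computable_less computable_eq computable_const computable_conj computable_query

lemma computable_order_power:
  "computable \<Gamma> F \<Longrightarrow> computable \<Gamma> (\<lambda>f x. order_power j (F f x))"
  unfolding order_power_def order_data_def by (intro computable_num_power computable_ops)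

lemma computable_scaled_power:
  "computable \<Gamma> F \<Longrightarrow> computable \<Gamma> (\<lambda>f x. scaled_power N j (F f x))"
  unfolding scaled_power_def by (intro computable_ops computable_order_power)

lemma computable_affine_entry:
  "computable \<Gamma> A \<Longrightarrow> computable \<Gamma> B \<Longrightarrow> computable \<Gamma> E \<Longrightarrow> computable \<Gamma> Z \<Longrightarrow>
    computable \<Gamma> (\<lambda>f x. affine_entry (A f x) (B f x) (E f x) (Z f x))"
  unfolding affine_entry_def affine_rat_def by (intro computable_ops)

lemma computable_delta_entry:
  "computable \<Gamma> A \<Longrightarrow> computable \<Gamma> B \<Longrightarrow> computable \<Gamma> (\<lambda>f x. delta_entry (A f x) (B f x))"
  unfolding delta_entry_def by (intro computable_ops)

text \<open>The four bindings are the row index, the row, the column index and the entry, in this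
  order.\<close>

lemma computable_expand_mat:
  fixes gss :: "(answers \<Rightarrow> 'x \<Rightarrow> data \<Rightarrow> data \<Rightarrow> data \<Rightarrow> data) list list"
  assumes L: "computable \<Gamma> L"
    and g: "\<And>gs g. gs \<in> set gss \<Longrightarrow> g \<in> set gs \<Longrightarrow> computable (lift (lift (lift (lift \<Gamma>))))
      (\<lambda>f y. g f (fst (fst (fst (fst y)))) (snd (fst (fst (fst y)))) (snd (fst y)) (snd y))"
  shows "computable \<Gamma> (\<lambda>f x. expand_mat (map (map (\<lambda>g. g f x)) gss) (L f x))"
proof -
  have "computable (lift (lift \<Gamma>)) (\<lambda>f y. Lst (expand_list
      (map (\<lambda>g. g f y) (map (\<lambda>g f y. g f (fst (fst y)) (snd (fst y))) gs)) (items (snd y))))"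
    if "gs \<in> set gss" for gs
  proof (rule computable_expand_list)
    show "computable (lift (lift \<Gamma>)) (\<lambda>f y. snd y)" by (rule computable_var) (simp add: lift_def)
  qed (use g[OF that] in auto)
  then have "computable \<Gamma> (\<lambda>f x. Lst (expand_list (map (\<lambda>h. h f x)
      (map (\<lambda>gs f x i row. Lst (expand_list (map (\<lambda>g. g f x i) gs) (items row))) gss)) (items (L f x))))"
    by (intro computable_expand_list L) (auto simp: o_def)
  then show ?thesis by (simp add: expand_mat_def o_def)
qed

lemma computable_psd_instance:
  "computable [\<lambda>z. z] (\<lambda>f z. psd_instance z)"
proof -
  let ?O = "\<lambda>(f :: answers) (z :: data) i j e. zero_entry"
    and ?D = "\<lambda>(f :: answers) (z :: data) i j e. delta_entry i j"
    and ?B = "\<lambda>(f :: answers) (z :: data) i j e.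
      affine_entry (Num 1) (mul_data (order_power 3 z) (eq_data i j)) (order_power 3 z) e"
  let ?gss = "[[?D, ?O, ?O, ?D], [?O, ?B, ?O, ?O], [?O, ?O, ?D, ?O], [?D, ?O, ?O, ?D]]"
  let ?\<Gamma> = "lift (lift (lift (lift [\<lambda>z. z])))"
  have "computable ?\<Gamma> (\<lambda>f y. ?O f (fst (fst (fst (fst y)))) (snd (fst (fst (fst y)))) (snd (fst y)) (snd y))"
    by (rule computable_const)
  moreover have "computable ?\<Gamma> (\<lambda>f y. ?D f (fst (fst (fst (fst y)))) (snd (fst (fst (fst y)))) (snd (fst y)) (snd y))"
    by (intro computable_delta_entry computable_var) (simp_all add: lift_def)
  moreover have "computable ?\<Gamma> (\<lambda>f y. ?B f (fst (fst (fst (fst y)))) (snd (fst (fst (fst y)))) (snd (fst y)) (snd y))"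
    by (intro computable_affine_entry computable_order_power computable_mul computable_eq computable_const computable_var)
      (simp_all add: lift_def)
  ultimately have "computable [\<lambda>z. z] (\<lambda>f z. expand_mat (map (map (\<lambda>g. g f z)) ?gss) (hd_data (tl_data (tl_data z))))"
    by (intro computable_expand_mat computable_hd computable_tl computable_var) auto
  then show ?thesis by (simp add: psd_instance_def Let_def)
qed

lemma computable_sep_instance:
  "computable [\<lambda>z. z] (\<lambda>f z. sep_instance N z)"
proof -
  let ?B = "\<lambda>(f :: answers) (z :: data) i j e.
    affine_entry (scaled_power N 26 z) (eq_data i j) (scaled_power N 26 z) e"
  have "computable (lift (lift (lift (lift [\<lambda>z. z]))))
      (\<lambda>f y. ?B f (fst (fst (fst (fst y)))) (snd (fst (fst (fst y)))) (snd (fst y)) (snd y))"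
    by (intro computable_affine_entry computable_scaled_power computable_eq computable_var)
      (simp_all add: lift_def)
  then have "computable [\<lambda>z. z] (\<lambda>f z. expand_mat (map (map (\<lambda>g. g f z)) [[?B]]) (hd_data (tl_data (tl_data z))))"
    by (intro computable_expand_mat computable_hd computable_tl computable_var) auto
  then show ?thesis by (simp add: sep_instance_def)
qed

lemma computable_rat_close:
  "computable \<Gamma> K \<Longrightarrow> computable \<Gamma> S \<Longrightarrow> computable \<Gamma> T \<Longrightarrow>
    computable \<Gamma> (\<lambda>f x. bool_data (rat_close (K f x) (S f x) (T f x)))"
  unfolding rat_close_def sq_data_def by (intro computable_ops)

lemma computable_mat_close:
  assumes K: "computable \<Gamma> K" and M: "computable \<Gamma> M" and T: "computable \<Gamma> T"
  shows "computable \<Gamma> (\<lambda>f x. bool_data (mat_close (K f x) (M f x) (T f x)))"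
  unfolding mat_close_def
proof (rule computable_all2[OF M T])
  show "computable (lift (lift \<Gamma>)) (\<lambda>f y. bool_data (all2_data (entry_close (K f (fst (fst y)))) (items (snd (fst y))) (snd y)))"
  proof (rule computable_all2)
    let ?\<Delta> = "lift (lift (lift (lift \<Gamma>)))"
    have K': "computable ?\<Delta> (\<lambda>f y. K f (fst (fst (fst (fst y)))))"
      by (intro computable_lift[where F = "\<lambda>f y. K f (fst (fst (fst y)))"]
          computable_lift[where F = "\<lambda>f y. K f (fst (fst y))"] computable_lift[where F = "\<lambda>f y. K f (fst y)"]
          computable_lift[OF K])
    show "computable ?\<Delta> (\<lambda>f y. bool_data (entry_close (K f (fst (fst (fst (fst y))))) (snd (fst y)) (snd y)))"
      unfolding entry_close_def
      by (intro computable_conj computable_rat_close K' computable_hd computable_tl computable_var)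
        (simp_all add: lift_def)
  qed (rule computable_var, simp add: lift_def)+
qed

lemma computable_membership_answer: "computable [\<lambda>z. z] (membership_answer N)"
proof -
  have z: "computable [\<lambda>z. z] (\<lambda>f z :: data. z)" by (rule computable_var) simp
  have "computable [\<lambda>z. z] (\<lambda>f z. membership_answer N f z)"
    unfolding membership_answer_def Let_def sep_query_def order_data_def
    by (intro computable_conj computable_mat_close computable_scaled_power computable_psd_instance
        computable_sep_instance computable_query computable_cons computable_mul computable_hd
        computable_tl computable_const z)
  then show ?thesis by simp
qed


subsection \<open>Coding of matrices\<close>

lemma codes_mat_iff:
  "codes_mat n v A \<longleftrightarrow> A \<in> carrier_mat n n \<and> length (items v) = n \<and> v = Lst (items v) \<and>
     (\<forall>i<n. \<exists>ws. items v ! i = Lst ws \<and> length ws = n \<and> (\<forall>j<n. codes_complex (ws ! j) (A $$ (i, j))))"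
proof (cases "A \<in> carrier_mat n n")
  case A: True
  have row: "codes_row d (list_of_vec (row A i)) \<longleftrightarrow>
      (\<exists>ws. d = Lst ws \<and> length ws = n \<and> (\<forall>j<n. codes_complex (ws ! j) (A $$ (i, j))))" if "i < n" for d i
    using A that by (auto simp: codes_row_def list_all2_conv_all_nth list_of_vec_index)
  have "list_all2 codes_row vs (map list_of_vec (rows A)) \<longleftrightarrow> length vs = n \<and>
      (\<forall>i<n. \<exists>ws. vs ! i = Lst ws \<and> length ws = n \<and> (\<forall>j<n. codes_complex (ws ! j) (A $$ (i, j))))" for vs
    using A row by (auto simp: list_all2_conv_all_nth)
  then have "codes_mat n v A \<longleftrightarrow> (\<exists>vs. v = Lst vs \<and> length vs = n \<and>
      (\<forall>i<n. \<exists>ws. vs ! i = Lst ws \<and> length ws = n \<and> (\<forall>j<n. codes_complex (ws ! j) (A $$ (i, j)))))"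
    using A by (simp add: codes_mat_def)
  moreover have "(\<exists>vs. v = Lst vs \<and> P vs) \<longleftrightarrow> v = Lst (items v) \<and> P (items v)" for P
    by (metis items.simps(1))
  ultimately show ?thesis using A by auto
qed (simp add: codes_mat_def)

lemma codes_matD:
  assumes "codes_mat n v A"
  shows "A \<in> carrier_mat n n" "length (items v) = n"
    "i < n \<Longrightarrow> length (items (items v ! i)) = n"
    "i < n \<Longrightarrow> j < n \<Longrightarrow> codes_complex (items (items v ! i) ! j) (A $$ (i, j))"
  using assms unfolding codes_mat_iff by force+

lemma expand_list_nth:
  assumes "r < length xs * length gs"
  shows "expand_list gs xs ! r = (gs ! (r mod length gs)) (Num (int (r div length gs))) (xs ! (r div length gs))"
  using assms
proof (induction xs rule: rev_induct)
  case (snoc a xs)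
  let ?b = "length gs"
  show ?case
  proof (cases "r < length xs * ?b")
    case True
    then have "r div ?b < length xs" by (rule less_mult_imp_div_less)
    then show ?thesis using snoc.IH[OF True] True
      by (simp add: expand_list_append1 nth_append length_expand_list)
  next
    case False
    then obtain k where k: "r = length xs * ?b + k" by (metis le_Suc_ex not_less)
    then have kb: "k < ?b" using snoc.prems by simp
    then have "r mod ?b = k" unfolding k by simp
    moreover have "r div ?b = length xs"
      unfolding k by (rule div_nat_eqI) (use kb in \<open>simp_all add: mult.commute\<close>)
    ultimately show ?thesis using k kb
      by (simp add: expand_list_append1 nth_append length_expand_list)
  qed
qed simp

lemma codes_expand_mat:
  assumes X: "codes_mat n v X" and b: "length gss = b" "\<And>gs. gs \<in> set gss \<Longrightarrow> length gs = b"
    and A: "A \<in> carrier_mat (n * b) (n * b)"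
    and g: "\<And>k l i j e. k < b \<Longrightarrow> l < b \<Longrightarrow> i < n \<Longrightarrow> j < n \<Longrightarrow> codes_complex e (X $$ (i, j)) \<Longrightarrow>
      codes_complex ((gss ! k ! l) (Num (int i)) (Num (int j)) e) (A $$ (i * b + k, j * b + l))"
  shows "codes_mat (n * b) (expand_mat gss v) A"
proof -
  note XD = codes_matD[OF X]
  have "\<exists>ws. items (expand_mat gss v) ! r = Lst ws \<and> length ws = n * b \<and>
      (\<forall>c<n * b. codes_complex (ws ! c) (A $$ (r, c)))" if r: "r < n * b" for r
  proof -
    let ?i = "r div b" and ?k = "r mod b"
    have b0: "0 < b" using r by (cases b) auto
    have ik: "?i < n" "?k < b" using r b0 by (auto simp: less_mult_imp_div_less)
    have lk: "length (gss ! ?k) = b" using b ik by simp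
    let ?ws = "expand_list (map (\<lambda>g. g (Num (int ?i))) (gss ! ?k)) (items (items v ! ?i))"
    have "items (expand_mat gss v) ! r = Lst ?ws"
      using r ik b XD(2) by (simp add: expand_mat_def expand_list_nth)
    moreover have "length ?ws = n * b" using XD(3)[OF ik(1)] lk by (simp add: length_expand_list)
    moreover have "codes_complex (?ws ! c) (A $$ (r, c))" if c: "c < n * b" for c
    proof -
      let ?j = "c div b" and ?l = "c mod b"
      have jl: "?j < n" "?l < b" using c b0 by (auto simp: less_mult_imp_div_less)
      have "?ws ! c = (gss ! ?k ! ?l) (Num (int ?i)) (Num (int ?j)) (items (items v ! ?i) ! ?j)"
        using c jl lk XD(3)[OF ik(1)] by (simp add: expand_list_nth)
      then show ?thesis using g[OF ik(2) jl(2) ik(1) jl(1) XD(4)[OF ik(1) jl(1)]] by simp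
    qed
    ultimately show ?thesis by blast
  qed
  moreover have "length (items (expand_mat gss v)) = n * b"
    using XD(2) b by (simp add: expand_mat_def length_expand_list)
  moreover have "expand_mat gss v = Lst (items (expand_mat gss v))" by (simp add: expand_mat_def)
  ultimately show ?thesis unfolding codes_mat_iff using A by blast
qed

lemma codes_affine_rat:
  assumes "codes_rat u x" "0 < e"
  shows "codes_rat (affine_rat (Num a) (Num b) (Num e) u) ((of_int a * x + of_int b) / of_int e)"
proof -
  from assms obtain p q where "u = Lst [Num p, Num q]" "q > 0" "x = of_int p / of_int q"
    by (auto simp: codes_rat_def)
  then show ?thesis using assms(2)
    by (auto simp: codes_rat_def affine_rat_def field_simps intro!: exI[of _ "a * p + b * q"] exI[of _ "e * q"])
qed

lemma codes_affine_entry: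
  assumes "codes_complex z x" "0 < e"
  shows "codes_complex (affine_entry (Num a) (Num b) (Num e) z)
    ((complex_of_real (of_int a) * x + complex_of_real (of_int b)) / complex_of_real (of_int e))"
proof -
  from assms obtain u v where z: "z = Lst [u, v]" "codes_rat u (Re x)" "codes_rat v (Im x)"
    by (auto simp: codes_complex_def)
  show ?thesis
    using codes_affine_rat[OF z(2) assms(2), of a b] codes_affine_rat[OF z(3) assms(2), of a 0] z(1)
    by (auto simp: codes_complex_def affine_entry_def Re_divide_of_real Im_divide_of_real)
qed

lemma codes_zero_entry: "codes_complex zero_entry 0"
  by (auto simp: zero_entry_def codes_complex_def codes_rat_def)

lemma codes_delta_entry: "codes_complex (delta_entry (Num (int i)) (Num (int j))) (delta i j)"
  by (auto simp: delta_entry_def delta_def bool_data_def codes_complex_def codes_rat_def)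

lemma rat_close_bound:
  assumes "codes_rat s x" "rat_close k s t"
  shows "\<bar>x\<bar> \<le> 2"
proof -
  from assms(1) obtain p q where s: "s = Lst [Num p, Num q]" "q > 0" "x = of_int p / of_int q"
    by (auto simp: codes_rat_def)
  with assms(2) have "p * p \<le> 4 * (q * q)" by (auto simp: rat_close_def sq_data_def split: if_splits)
  then have "p\<^sup>2 \<le> (2 * q)\<^sup>2" by (simp add: power2_eq_square)
  then have "\<bar>p\<bar> \<le> 2 * q" using s(2) by (metis abs_le_square_iff abs_of_pos mult_pos_pos zero_less_numeral)
  then have "real_of_int \<bar>p\<bar> \<le> 2 * real_of_int q" by linarith
  then show ?thesis unfolding s(3) using s(2) by (simp add: pos_divide_le_eq)
qed

lemma rat_close_iff:
  assumes "codes_rat s x" "codes_rat t y" "0 < k"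
  shows "rat_close (Num k) s t \<longleftrightarrow> \<bar>x - y\<bar> \<le> 1 / of_int k \<and> \<bar>x\<bar> \<le> 2"
proof -
  from assms(1) obtain p q where s: "s = Lst [Num p, Num q]" "q > 0" "x = of_int p / of_int q"
    by (auto simp: codes_rat_def)
  from assms(2) obtain p' q' where t: "t = Lst [Num p', Num q']" "q' > 0" "y = of_int p' / of_int q'"
    by (auto simp: codes_rat_def)
  let ?d = "p * q' - p' * q"
  have "rat_close (Num k) s t \<longleftrightarrow> (k * ?d) * (k * ?d) \<le> (q * q') * (q * q') \<and> p * p \<le> 4 * (q * q)"
    using s t by (auto simp: rat_close_def sq_data_def)
  also have "(k * ?d) * (k * ?d) \<le> (q * q') * (q * q') \<longleftrightarrow> \<bar>k * ?d\<bar> \<le> \<bar>q * q'\<bar>"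
    unfolding power2_eq_square[symmetric] by (rule abs_le_square_iff[symmetric])
  also have "\<dots> \<longleftrightarrow> k * \<bar>?d\<bar> \<le> q * q'" using s(2) t(2) assms(3) by (simp add: abs_mult)
  also have "\<dots> \<longleftrightarrow> real_of_int (k * \<bar>?d\<bar>) \<le> real_of_int (q * q')" by (rule of_int_le_iff[symmetric])
  also have "\<dots> \<longleftrightarrow> \<bar>x - y\<bar> \<le> 1 / of_int k"
  proof -
    have "x - y = real_of_int ?d / real_of_int (q * q')"
      unfolding s(3) t(3) using s(2) t(2) by (simp add: field_simps)
    then have "\<bar>x - y\<bar> = real_of_int \<bar>?d\<bar> / real_of_int (q * q')"
      using s(2) t(2) by (simp add: abs_mult)
    moreover have "real_of_int k * A \<le> B \<longleftrightarrow> A / B \<le> 1 / real_of_int k" if "0 < B" for A B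
      using that assms(3) by (simp add: field_simps)
    ultimately show ?thesis using s(2) t(2) by simp
  qed
  also have "p * p \<le> 4 * (q * q) \<longleftrightarrow> \<bar>p\<bar> \<le> \<bar>2 * q\<bar>"
    unfolding abs_le_square_iff by (simp add: power2_eq_square)
  also have "\<dots> \<longleftrightarrow> \<bar>p\<bar> \<le> 2 * q" using s(2) by simp
  also have "\<dots> \<longleftrightarrow> real_of_int \<bar>p\<bar> \<le> real_of_int (2 * q)" by (rule of_int_le_iff[symmetric])
  also have "\<dots> \<longleftrightarrow> \<bar>x\<bar> \<le> 2"
    unfolding s(3) using s(2) by (simp add: pos_divide_le_eq)
  finally show ?thesis .
qed

text \<open>Every element of the list is compared with some datum, whatever the shape of
  \<open>d\<close>; no more is known about an answer until its query is seen to be valid.\<close>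

lemma all2_data_ex: "all2_data P xs d \<Longrightarrow> a \<in> set xs \<Longrightarrow> \<exists>b. P a b"
  by (induction xs arbitrary: d) auto

lemma all2_data_iff:
  "length ys = length xs \<Longrightarrow> all2_data P xs (Lst ys) \<longleftrightarrow> (\<forall>i<length xs. P (xs ! i) (ys ! i))"
proof (induction xs arbitrary: ys)
  case (Cons a xs)
  then obtain b bs where "ys = b # bs" "length bs = length xs" by (cases ys) auto
  then show ?case using Cons.IH[of bs] by (auto simp: nth_Cons split: nat.splits)
qed simp

lemma entry_close_iff:
  assumes "codes_complex s x" "codes_complex t y" "0 < k"
  shows "entry_close (Num k) s t \<longleftrightarrow> \<bar>Re x - Re y\<bar> \<le> 1 / of_int k \<and> \<bar>Re x\<bar> \<le> 2 \<and>
    \<bar>Im x - Im y\<bar> \<le> 1 / of_int k \<and> \<bar>Im x\<bar> \<le> 2"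
  using assms by (auto simp: codes_complex_def entry_close_def rat_close_iff)

lemma mat_close_iff:
  assumes S: "codes_mat n M S" and T: "codes_mat n d T" and k: "0 < k"
  shows "mat_close (Num k) M d \<longleftrightarrow> (\<forall>i<n. \<forall>j<n.
    \<bar>Re (S $$ (i, j)) - Re (T $$ (i, j))\<bar> \<le> 1 / of_int k \<and> \<bar>Re (S $$ (i, j))\<bar> \<le> 2 \<and>
    \<bar>Im (S $$ (i, j)) - Im (T $$ (i, j))\<bar> \<le> 1 / of_int k \<and> \<bar>Im (S $$ (i, j))\<bar> \<le> 2)"
proof -
  note SD = codes_matD[OF S] and TD = codes_matD[OF T]
  have d: "d = Lst (items d)" using T unfolding codes_mat_iff by blast
  have "mat_close (Num k) M d \<longleftrightarrow> (\<forall>i<n. all2_data (entry_close (Num k)) (items (items M ! i)) (items d ! i))"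
    unfolding mat_close_def by (subst d) (simp add: all2_data_iff SD(2) TD(2))
  also have "\<dots> \<longleftrightarrow> (\<forall>i<n. \<forall>j<n. entry_close (Num k) (items (items M ! i) ! j) (items (items d ! i) ! j))"
  proof -
    have "all2_data (entry_close (Num k)) (items (items M ! i)) (items d ! i) \<longleftrightarrow>
        (\<forall>j<n. entry_close (Num k) (items (items M ! i) ! j) (items (items d ! i) ! j))" if i: "i < n" for i
    proof -
      obtain ws where ws: "items d ! i = Lst ws" using T i unfolding codes_mat_iff by blast
      then show ?thesis using TD(3)[OF i] SD(3)[OF i] by (simp add: all2_data_iff)
    qed
    then show ?thesis by auto
  qed
  also have "\<dots> \<longleftrightarrow> (\<forall>i<n. \<forall>j<n.
    \<bar>Re (S $$ (i, j)) - Re (T $$ (i, j))\<bar> \<le> 1 / of_int k \<and> \<bar>Re (S $$ (i, j))\<bar> \<le> 2 \<and>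
    \<bar>Im (S $$ (i, j)) - Im (T $$ (i, j))\<bar> \<le> 1 / of_int k \<and> \<bar>Im (S $$ (i, j))\<bar> \<le> 2)"
    using entry_close_iff[OF SD(4) TD(4) k] by auto
  finally show ?thesis .
qed

text \<open>
  This bound certifies that the first query was valid; it must not depend on the answer \<open>d\<close>, which
  is arbitrary as long as the query is not known to be valid.
\<close>

lemma mat_close_bound:
  assumes S: "codes_mat n M S" and close: "mat_close k M d" and ij: "i < n" "j < n"
  shows "\<bar>Re (S $$ (i, j))\<bar> \<le> 2" "\<bar>Im (S $$ (i, j))\<bar> \<le> 2"
proof -
  note SD = codes_matD[OF S]
  obtain b where "all2_data (entry_close k) (items (items M ! i)) b"
    using all2_data_ex[OF close[unfolded mat_close_def], of "items M ! i"] SD(2) ij by auto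
  moreover have "items (items M ! i) ! j \<in> set (items (items M ! i))"
    using SD(3)[OF ij(1)] ij(2) by (intro nth_mem) simp
  ultimately obtain c where "entry_close k (items (items M ! i) ! j) c"
    using all2_data_ex by blast
  then show "\<bar>Re (S $$ (i, j))\<bar> \<le> 2" "\<bar>Im (S $$ (i, j))\<bar> \<le> 2"
    using SD(4)[OF ij] by (auto simp: entry_close_def codes_complex_def dest: rat_close_bound)
qed


subsection \<open>Correctness\<close>

lemma sep_query_answer:
  assumes f: "solves f sep_approximation" and d: "d2 \<le> d1" "2 \<le> d2"
    and S: "codes_mat (d1 * d2) M S" "psd (d1 * d2) S" and k: "0 < k"
  obtains T where "codes_mat (d1 * d2) (f (sep_query (Num (int d1)) (Num (int d2)) (Num k) M)) T"
    "hs_norm (T - pi_sep d1 d2 S) \<le> 1 / of_int k"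
proof -
  let ?x = "Lst [Num (int d1), Num (int d2), Lst [Num 1, Num k], M]"
  have x: "sep_query (Num (int d1)) (Num (int d2)) (Num k) M = ?x" by (simp add: sep_query_def)
  have "sep_approximation ?x (f ?x)" using f by (simp add: solves_def)
  moreover have "codes_rat (Lst [Num 1, Num k]) (1 / of_int k)" using k by (auto simp: codes_rat_def)
  moreover have "0 < 1 / real_of_int k" using k by simp
  ultimately have "\<exists>T. codes_mat (d1 * d2) (f ?x) T \<and> hs_norm (T - pi_sep d1 d2 S) \<le> 1 / of_int k"
    unfolding sep_approximation_def using d S by blast
  then show ?thesis using that unfolding x by blast
qed

text \<open>One 1 / k comes from the precision of the oracle, two from comparing real and imaginary
  parts.\<close>

lemma mat_close_sound:
  assumes f: "solves f sep_approximation" and d: "d2 \<le> d1" "2 \<le> d2"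
    and S: "codes_mat (d1 * d2) M S" "psd (d1 * d2) S" and k: "0 < k"
    and close: "mat_close (Num k) M (f (sep_query (Num (int d1)) (Num (int d2)) (Num k) M))"
    and ij: "i < d1 * d2" "j < d1 * d2"
  shows "cmod (pi_sep d1 d2 S $$ (i, j) - S $$ (i, j)) \<le> 3 / of_int k"
proof -
  obtain T where T: "codes_mat (d1 * d2) (f (sep_query (Num (int d1)) (Num (int d2)) (Num k) M)) T"
    "hs_norm (T - pi_sep d1 d2 S) \<le> 1 / of_int k"
    by (rule sep_query_answer[OF f d S k])
  let ?P = "pi_sep d1 d2 S"
  have Sc: "S \<in> carrier_mat (d1 * d2) (d1 * d2)" and Tc: "T \<in> carrier_mat (d1 * d2) (d1 * d2)"
    using codes_matD(1)[OF S(1)] codes_matD(1)[OF T(1)] .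
  have Pc: "?P \<in> carrier_mat (d1 * d2) (d1 * d2)"
    by (rule sep_cone_carrier[OF pi_sep_best(1)[OF Sc]])
  have "cmod (T $$ (i, j) - ?P $$ (i, j)) \<le> 1 / of_int k"
    using entry_diff_le_hs_norm[OF Tc Pc ij] T(2) by linarith
  moreover have "cmod (S $$ (i, j) - T $$ (i, j)) \<le> 1 / of_int k + 1 / of_int k"
    using cmod_le[of "S $$ (i, j) - T $$ (i, j)"] close[unfolded mat_close_iff[OF S(1) T(1) k]] ij
    by (intro order_trans[OF cmod_le] add_mono) auto
  moreover have "cmod (?P $$ (i, j) - S $$ (i, j))
      \<le> cmod (T $$ (i, j) - ?P $$ (i, j)) + cmod (S $$ (i, j) - T $$ (i, j))"
    using norm_triangle_ineq[of "T $$ (i, j) - ?P $$ (i, j)" "S $$ (i, j) - T $$ (i, j)"]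
    by (simp add: norm_minus_commute)
  ultimately show ?thesis by simp
qed

text \<open>A separable operator is its own best approximation, so a valid answer lies within 1 / k
  of it in norm and hence in every entry.\<close>

lemma mat_close_complete:
  assumes f: "solves f sep_approximation" and d: "d2 \<le> d1" "2 \<le> d2"
    and S: "codes_mat (d1 * d2) M S" "S \<in> sep_cone d1 d2" and k: "0 < k"
    and le: "\<And>i j. i < d1 * d2 \<Longrightarrow> j < d1 * d2 \<Longrightarrow> cmod (S $$ (i, j)) \<le> 2"
  shows "mat_close (Num k) M (f (sep_query (Num (int d1)) (Num (int d2)) (Num k) M))"
proof -
  have psd: "psd (d1 * d2) S" using S(2) by (simp add: sep_cone_def)
  obtain T where T: "codes_mat (d1 * d2) (f (sep_query (Num (int d1)) (Num (int d2)) (Num k) M)) T"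
    "hs_norm (T - pi_sep d1 d2 S) \<le> 1 / of_int k"
    by (rule sep_query_answer[OF f d S(1) psd k])
  have "\<bar>Re (S $$ (i, j)) - Re (T $$ (i, j))\<bar> \<le> 1 / of_int k \<and> \<bar>Re (S $$ (i, j))\<bar> \<le> 2 \<and>
      \<bar>Im (S $$ (i, j)) - Im (T $$ (i, j))\<bar> \<le> 1 / of_int k \<and> \<bar>Im (S $$ (i, j))\<bar> \<le> 2"
    if ij: "i < d1 * d2" "j < d1 * d2" for i j
  proof -
    have "cmod (T $$ (i, j) - S $$ (i, j)) \<le> 1 / of_int k"
      using entry_diff_le_hs_norm[OF codes_matD(1)[OF T(1)] codes_matD(1)[OF S(1)] ij] T(2)
      unfolding pi_sep_fixed[OF S(2)] by linarith
    then have "cmod (S $$ (i, j) - T $$ (i, j)) \<le> 1 / of_int k" by (simp add: norm_minus_commute)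
    then show ?thesis
      using abs_Re_le_cmod[of "S $$ (i, j) - T $$ (i, j)"] abs_Im_le_cmod[of "S $$ (i, j) - T $$ (i, j)"]
        abs_Re_le_cmod[of "S $$ (i, j)"] abs_Im_le_cmod[of "S $$ (i, j)"] le[OF ij] by auto
  qed
  then show ?thesis unfolding mat_close_iff[OF S(1) T(1) k] by blast
qed

lemma order_power_eq: "order_data z = Num a \<Longrightarrow> order_power j z = Num (a ^ j)"
  by (induction j) (auto simp: order_power_def)

lemma codes_psd_instance:
  assumes X: "codes_mat n vX X" and z: "order_data z = Num (int n)" "hd_data (tl_data (tl_data z)) = vX"
    and n: "0 < n"
  shows "codes_mat (n * 4) (psd_instance z)
    (mat (n * 4) (n * 4) (\<lambda>(i, j). test_form (\<lambda>x y. X $$ (x, y) / complex_of_real (real n ^ 3) + delta x y) i j))"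
    (is "codes_mat _ _ ?S")
  unfolding psd_instance_def Let_def z(2)
proof (rule codes_expand_mat[OF X])
  let ?b = "\<lambda>x y. X $$ (x, y) / complex_of_real (real n ^ 3) + delta x y"
  fix k l i j e
  assume kl: "k < (4 :: nat)" "l < (4 :: nat)" and ij: "i < n" "j < n" and e: "codes_complex e (X $$ (i, j))"
  let ?t = "affine_entry (Num 1) (mul_data (order_power 3 z) (eq_data (Num (int i)) (Num (int j)))) (order_power 3 z) e"
  have "codes_complex ?t (?b i j)"
  proof -
    have "?t = affine_entry (Num 1) (Num (int n ^ 3 * (if i = j then 1 else 0))) (Num (int n ^ 3)) e"
      by (simp add: order_power_eq[OF z(1)] bool_data_def)
    moreover have "(complex_of_real (of_int 1) * X $$ (i, j) + complex_of_real (of_int (int n ^ 3 * (if i = j then 1 else 0))))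
        / complex_of_real (of_int (int n ^ 3)) = ?b i j"
      using n by (simp add: delta_def add_divide_distrib)
    ultimately show ?thesis using codes_affine_entry[OF e, of "int n ^ 3" 1 "int n ^ 3 * (if i = j then 1 else 0)"] n
      by simp
  qed
  moreover have "?S $$ (i * 4 + k, j * 4 + l) = block_pattern k l (delta i j) (?b i j)"
    using index_less[OF ij(1) kl(1)] index_less[OF ij(2) kl(2)] test_form_at[OF kl, of ?b i j] by simp
  moreover have "k = 0 \<or> k = 1 \<or> k = 2 \<or> k = 3" "l = 0 \<or> l = 1 \<or> l = 2 \<or> l = 3" using kl by auto
  ultimately show "codes_complex (([[\<lambda>i j e. delta_entry i j, \<lambda>i j e. zero_entry, \<lambda>i j e. zero_entry, \<lambda>i j e. delta_entry i j],
       [\<lambda>i j e. zero_entry, \<lambda>i j e. affine_entry (Num 1) (mul_data (order_power 3 z) (eq_data i j)) (order_power 3 z) e,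
        \<lambda>i j e. zero_entry, \<lambda>i j e. zero_entry],
       [\<lambda>i j e. zero_entry, \<lambda>i j e. zero_entry, \<lambda>i j e. delta_entry i j, \<lambda>i j e. zero_entry],
       [\<lambda>i j e. delta_entry i j, \<lambda>i j e. zero_entry, \<lambda>i j e. zero_entry, \<lambda>i j e. delta_entry i j]] ! k ! l)
      (Num (int i)) (Num (int j)) e) (?S $$ (i * 4 + k, j * 4 + l))"
    using codes_zero_entry codes_delta_entry[of i j]
    by (elim disjE) (simp_all add: block_pattern_def)
qed auto

lemma codes_sep_instance:
  assumes X: "codes_mat n vX X" and z: "order_data z = Num (int n)" "hd_data (tl_data (tl_data z)) = vX"
    and n: "0 < n" "0 < N"
  shows "codes_mat n (sep_instance (int N) z)
    (mat n n (\<lambda>(i, j). X $$ (i, j) + complex_of_real (1 / (real N * real n ^ 26)) * delta i j))"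
    (is "codes_mat _ _ ?S")
proof -
  let ?h = "int N * int n ^ 26"
  have h: "0 < ?h" using n by simp
  have "codes_mat (n * 1) (sep_instance (int N) z) ?S"
    unfolding sep_instance_def z(2)
  proof (rule codes_expand_mat[OF X])
    fix k l i j e
    assume kl: "k < (1 :: nat)" "l < (1 :: nat)" and ij: "i < n" "j < n" and e: "codes_complex e (X $$ (i, j))"
    let ?t = "affine_entry (scaled_power (int N) 26 z) (eq_data (Num (int i)) (Num (int j))) (scaled_power (int N) 26 z) e"
    have "?t = affine_entry (Num ?h) (Num (if i = j then 1 else 0)) (Num ?h) e"
      by (simp add: scaled_power_def order_power_eq[OF z(1)] bool_data_def)
    moreover have "(complex_of_real (of_int ?h) * X $$ (i, j) + complex_of_real (of_int (if i = j then 1 else 0)))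
        / complex_of_real (of_int ?h) = X $$ (i, j) + complex_of_real (1 / (real N * real n ^ 26)) * delta i j"
      using n by (simp add: delta_def add_divide_distrib)
    ultimately have "codes_complex ?t (X $$ (i, j) + complex_of_real (1 / (real N * real n ^ 26)) * delta i j)"
      using codes_affine_entry[OF e h, of ?h "if i = j then 1 else 0"] by simp
    then show "codes_complex (([[\<lambda>i j e. affine_entry (scaled_power (int N) 26 z) (eq_data i j) (scaled_power (int N) 26 z) e]] ! k ! l)
      (Num (int i)) (Num (int j)) e) (?S $$ (i * 1 + k, j * 1 + l))"
      using kl ij by simp
  qed auto
  then show ?thesis by simp
qed


text \<open>With \<open>r\<close> for n, these are in order: semidefiniteness of 1 + X / n^3 for
  entries of \<open>X\<close> up to 5; the conclusion X + \<eta> \<ge> 0 of the first test, where 3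
  / k is the error of an entry and 4 the number of terms in a contraction; the error of the second
  test, at most \<eta>; a trace of at least 1 / 2 for the second best approximation; the distance
  from \<open>X\<close> after normalising it; and the smallness of the shift and the scaling, which
  keeps the entries of both queries below the bound 2. As r \<ge> 4, numerical factors are absorbed
  by powers: 5 \<le> r^2, 12 \<le> r^4, 24 \<le> r^3.\<close>

lemma reduction_bounds:
  fixes r N :: real
  assumes r: "4 \<le> r" and N: "1 \<le> N"
  shows "5 / r ^ 3 * r \<le> 1"
    "4 * (3 / (N * r ^ 34)) * r \<le> 1 / (N * r ^ 26) / r ^ 3"
    "3 / (N * r ^ 34) \<le> 1 / (N * r ^ 26)"
    "r * (2 * (1 / (N * r ^ 26))) \<le> 1 / 2"
    "2 * r * (2 * (1 / (N * r ^ 26))) * (1 + r * 5) \<le> 1 / (N * r ^ 21)"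
    "1 / (N * r ^ 26) \<le> 1" "1 / r ^ 3 \<le> 1"
proof -
  have r0: "0 < r" "1 \<le> r" and N0: "0 < N" using r N by auto
  have p: "4 ^ j \<le> r ^ j" for j :: nat using r by (intro power_mono) auto
  show "5 / r ^ 3 * r \<le> 1" using p[of 2] r0 by (simp add: field_simps power_numeral_reduce)
  have k: "1 / (N * r ^ 26) / r ^ 3 = r ^ 5 / (N * r ^ 34)" "1 / (N * r ^ 26) = r ^ 8 / (N * r ^ 34)"
    "1 / (N * r ^ 21) = r ^ 13 / (N * r ^ 34)"
    using r0 N0 by (simp_all add: field_simps flip: power_add)
  have pos: "0 < N * r ^ 34" using r0 N0 by simp
  have "12 * r \<le> r ^ 4 * r" using p[of 4] r0 by (intro mult_right_mono) auto
  then have "12 * r / (N * r ^ 34) \<le> r ^ 5 / (N * r ^ 34)"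
    using pos by (intro divide_right_mono) (simp_all add: power_numeral_reduce mult_ac)
  then show "4 * (3 / (N * r ^ 34)) * r \<le> 1 / (N * r ^ 26) / r ^ 3" unfolding k(1) by simp
  show "3 / (N * r ^ 34) \<le> 1 / (N * r ^ 26)"
    unfolding k(2) using pos p[of 8] by (intro divide_right_mono) simp_all
  have one: "1 \<le> r ^ j" for j :: nat by (rule one_le_power[OF r0(2)])
  have Nr: "r ^ j \<le> N * r ^ j" for j :: nat using mult_right_mono[OF N, of "r ^ j"] r0 by simp
  have "1 / (N * r ^ 26) \<le> 1 / r ^ 26" using r0 N0 by (intro divide_left_mono Nr mult_pos_pos) simp_all
  moreover have "1 / r ^ 26 \<le> 1 / r ^ 2"
    using r0 by (intro divide_left_mono power_increasing mult_pos_pos) simp_all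
  ultimately have le: "1 / (N * r ^ 26) \<le> 1 / r ^ 2" by (rule order_trans)
  have "2 * r * (1 / (N * r ^ 26)) \<le> 2 * r * (1 / r ^ 2)"
    by (rule mult_left_mono[OF le]) (use r0 in simp)
  also have "\<dots> = 2 / r" using r0 by (simp add: power2_eq_square)
  also have "\<dots> \<le> 1 / 2" using r by (simp add: field_simps)
  finally show "r * (2 * (1 / (N * r ^ 26))) \<le> 1 / 2" by (simp only: mult_ac)
  have inverse_le: "1 / x \<le> 1" if "1 \<le> x" for x :: real using that by simp
  show "1 / (N * r ^ 26) \<le> 1" by (rule inverse_le[OF order_trans[OF one Nr]])
  show "1 / r ^ 3 \<le> 1" by (rule inverse_le[OF one])
  have "4 * r * (1 + r * 5) \<le> 24 * r ^ 2" using r0 by (simp add: power2_eq_square algebra_simps)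
  also have "24 * r ^ 2 \<le> r ^ 3 * r ^ 2"
  proof (rule mult_right_mono)
    show "24 \<le> r ^ 3" using p[of 3] by simp
  qed simp
  also have "r ^ 3 * r ^ 2 = r ^ 5" by (simp flip: power_add)
  finally have "4 * r * (1 + r * 5) * r ^ 8 \<le> r ^ 5 * r ^ 8"
    by (rule mult_right_mono) (use r0 in simp)
  then have le: "4 * r * (1 + r * 5) * r ^ 8 / (N * r ^ 34) \<le> r ^ 5 * r ^ 8 / (N * r ^ 34)"
    by (rule divide_right_mono) (use pos in simp)
  have "2 * r * (2 * (r ^ 8 / K)) * (1 + r * 5) = 4 * r * (1 + r * 5) * r ^ 8 / K" for K by simp
  moreover have "r ^ 5 * r ^ 8 = r ^ 13" by (simp flip: power_add)
  ultimately show "2 * r * (2 * (1 / (N * r ^ 26))) * (1 + r * 5) \<le> 1 / (N * r ^ 21)"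
    unfolding k(2,3) using le by (simp only:)
qed

lemma norm_two_terms: "cmod a \<le> 1 \<Longrightarrow> cmod b \<le> 1 \<Longrightarrow> cmod (a + b) \<le> 2"
  using norm_triangle_ineq[of a b] by linarith

text \<open>Two successful comparisons are exploited in the order entry bound, first query, second
  query, since each step makes the next query valid. The negative answer is justified by
  contraposition: a separable state \<open>X\<close> yields separable queries with entries of
  modulus at most 2, for which both comparisons succeed.\<close>

lemma membership_answer_valid:
  assumes N: "0 < N" and f: "solves f sep_approximation"
  shows "solves (membership_answer (int N) f)
    (weak_membership (\<lambda>d1 d2. 1 / (real N * (real d1 * real d2) ^ 21)))"
  unfolding solves_def weak_membership_def
proof (intro allI impI, elim conjE)
  fix z d1 d2 X vX
  assume z: "z = Lst [Num (int d1), Num (int d2), vX]" and d: "d2 \<le> d1" "2 \<le> d2"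
    and X: "codes_mat (d1 * d2) vX X" "X \<in> trace_one_hermitian (d1 * d2)"
  define n where "n = d1 * d2"
  define r \<eta> where "r = real n" and "\<eta> = 1 / (real N * r ^ 26)"
  define k where "k = int N * int n ^ 34"
  have "2 * 2 \<le> d1 * d2" using d by (intro mult_le_mono) auto
  then have n4: "4 \<le> n" by (simp add: n_def)
  then have r: "4 \<le> r" and N1: "1 \<le> real N" and n0: "0 < n" using N by (auto simp: r_def)
  note bounds = reduction_bounds[OF r N1, folded \<eta>_def]
  have k: "0 < k" "real_of_int k = real N * r ^ 34" using N n0 by (simp_all add: k_def r_def)
  have \<eta>: "0 < \<eta>" using N r by (simp add: \<eta>_def)
  have m: "0 < r ^ 3" using r by simp
  have Xc: "X \<in> carrier_mat n n" and herm: "\<And>i j. i < n \<Longrightarrow> j < n \<Longrightarrow> X $$ (i, j) = cnj (X $$ (j, i))"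
    and trX: "mat_trace X = 1"
    using X(2) unfolding trace_one_hermitian_def hermitian_iff n_def by blast+
  have z_simps: "order_data z = Num (int n)" "hd_data z = Num (int d1)" "hd_data (tl_data z) = Num (int d2)"
    "hd_data (tl_data (tl_data z)) = vX" "scaled_power (int N) 34 z = Num k"
    "mul_data (order_data z) (Num 2) = Num (int (n * 2))"
  proof -
    show o: "order_data z = Num (int n)" by (simp add: z order_data_def n_def)
    show "scaled_power (int N) 34 z = Num k" by (simp add: scaled_power_def order_power_eq[OF o] k_def)
    show "mul_data (order_data z) (Num 2) = Num (int (n * 2))" unfolding o by simp
  qed (simp_all add: z)
  define b where "b = (\<lambda>x y. X $$ (x, y) / complex_of_real (r ^ 3) + delta x y)"
  define S1 where "S1 = mat (n * 4) (n * 4) (\<lambda>(i, j). test_form b i j)"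
  define S2 where "S2 = mat n n (\<lambda>(i, j). X $$ (i, j) + complex_of_real \<eta> * delta i j)"
  have n44: "n * 2 * 2 = n * 4" by simp
  have c1: "codes_mat (n * 2 * 2) (psd_instance z) S1"
    using codes_psd_instance[OF X(1)[folded n_def] z_simps(1,4) n0] unfolding S1_def b_def r_def n44 .
  have c2: "codes_mat (d1 * d2) (sep_instance (int N) z) S2"
    using codes_sep_instance[OF X(1)[folded n_def] z_simps(1,4) n0 N] unfolding S2_def \<eta>_def r_def n_def .
  have d': "2 \<le> n * 2" "(2 :: nat) \<le> 2" using n4 by auto
  let ?q1 = "f (sep_query (Num (int (n * 2))) (Num (int 2)) (Num k) (psd_instance z))"
  let ?q2 = "f (sep_query (Num (int d1)) (Num (int d2)) (Num k) (sep_instance (int N) z))"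
  let ?\<delta> = "1 / (real N * (real d1 * real d2) ^ 21)"
  have \<delta>: "?\<delta> = 1 / (real N * r ^ 21)" by (simp add: r_def n_def)
  have ans: "membership_answer (int N) f z = bool_data
      (mat_close (Num k) (psd_instance z) ?q1 \<and> mat_close (Num k) (sep_instance (int N) z) ?q2)"
    unfolding membership_answer_def Let_def z_simps by simp
  have S1c: "S1 \<in> carrier_mat (n * 2 * 2) (n * 2 * 2)" unfolding S1_def n44 by simp
  have S1_psd: "psd (n * 2 * 2) S1" if "psd_form n b"
    unfolding psd_iff n44 S1_def
    by (intro conjI psd_form_cong[OF _ psd_form_test_form[OF that]]) auto
  show "membership_answer (int N) f z = Num 1 \<and> X \<in> sep_states_plus d1 d2 ?\<delta> \<or>
    membership_answer (int N) f z = Num 0 \<and> X \<notin> sep_states_minus d1 d2 ?\<delta>"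
  proof (cases "mat_close (Num k) (psd_instance z) ?q1 \<and> mat_close (Num k) (sep_instance (int N) z) ?q2")
    case True
    then have close1: "mat_close (Num k) (psd_instance z) ?q1"
      and close2: "mat_close (Num k) (sep_instance (int N) z) ?q2" by auto
    \<comment> \<open>The shift changes the real part by at most 1, so the two parts are at most 3
      and 2.\<close>
    have X5: "cmod (X $$ (i, j)) \<le> 5" if ij: "i < n" "j < n" for i j
    proof -
      have "\<bar>Re (S2 $$ (i, j))\<bar> \<le> 2" "\<bar>Im (S2 $$ (i, j))\<bar> \<le> 2"
        using mat_close_bound[OF c2 close2] ij by (auto simp: n_def)
      then have "\<bar>Re (X $$ (i, j))\<bar> \<le> 3" "\<bar>Im (X $$ (i, j))\<bar> \<le> 2"
        using ij \<eta> bounds(6) by (auto simp: S2_def delta_def split: if_splits)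
      then show ?thesis using cmod_le[of "X $$ (i, j)"] by linarith
    qed
    have "psd_form n (\<lambda>x y. X $$ (x, y) / complex_of_real (r ^ 3) + complex_of_real 1 * delta x y)"
    \<comment> \<open>X / n^3 counts as a perturbation of the zero form, absorbed by the identity
      contained in \<open>b\<close>.\<close>
    proof (rule psd_form_perturb[where a = "\<lambda>x y. 0" and c = "5 / r ^ 3"])
      fix x y assume xy: "x < n" "y < n"
      from herm[OF this] show "X $$ (x, y) / complex_of_real (r ^ 3) = cnj (X $$ (y, x) / complex_of_real (r ^ 3))"
        by simp
      show "cmod (0 - X $$ (x, y) / complex_of_real (r ^ 3)) \<le> 5 / r ^ 3"
        using X5[OF xy] m by (simp add: norm_divide divide_right_mono del: of_real_power)
    qed (use m bounds(1) in \<open>auto simp: qform_def r_def\<close>)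
    then have b: "psd_form n b" by (simp add: b_def)
    note S1 = S1_psd[OF b]
    have "psd_form n (\<lambda>x y. b x y - delta x y + complex_of_real (\<eta> / r ^ 3) * delta x y)"
    proof (rule psd_form_of_test[OF pi_sep_best(1)[OF S1c]])
      fix x y assume "x < n" "y < n"
      then show "b x y = cnj (b y x)" by (rule psd_form_hermitian[OF b])
    next
      fix i j assume ij: "i < n * 4" "j < n * 4"
      then show "cmod (pi_sep (n * 2) 2 S1 $$ (i, j) - test_form b i j) \<le> 3 / of_int k"
        using mat_close_sound[OF f d' c1 S1 k(1) close1, of i j] by (simp add: S1_def)
    qed (use k bounds(2) in \<open>auto simp: r_def\<close>)
    \<comment> \<open>Undoing the scaling turns the slack \<eta> / n^3 into \<eta>.\<close>
    then have "psd_form n (\<lambda>x y. complex_of_real (r ^ 3) *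
        (b x y - delta x y + complex_of_real (\<eta> / r ^ 3) * delta x y))"
      using m by (intro psd_form_scale) auto
    then have "psd_form n (\<lambda>x y. X $$ (x, y) + complex_of_real \<eta> * delta x y)"
    proof (rule psd_form_cong[rotated])
      fix x y
      have m0: "complex_of_real (r ^ 3) \<noteq> 0" using m by simp
      show "complex_of_real (r ^ 3) * (b x y - delta x y + complex_of_real (\<eta> / r ^ 3) * delta x y)
          = X $$ (x, y) + complex_of_real \<eta> * delta x y"
        using m0 by (simp add: b_def distrib_left del: of_real_power)
    qed
    then have S2: "psd (d1 * d2) S2"
      unfolding psd_iff n_def[symmetric] S2_def by (auto intro: psd_form_cong[rotated])
    have S2c: "S2 \<in> carrier_mat (d1 * d2) (d1 * d2)" by (simp add: S2_def n_def)
    have "X \<in> sep_states_plus d1 d2 ?\<delta>"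
    proof (rule sep_states_plus_of_close[OF pi_sep_best(1)[OF S2c] n_def n0 X(2)[folded n_def] X5])
      fix i j assume ij: "i < n" "j < n"
      let ?P = "pi_sep d1 d2 S2"
      have "cmod (?P $$ (i, j) - S2 $$ (i, j)) \<le> \<eta>"
        using mat_close_sound[OF f d c2 S2 k(1) close2, folded n_def, OF ij] bounds(3) k by simp
      moreover have "cmod (S2 $$ (i, j) - X $$ (i, j)) \<le> \<eta>"
        using ij \<eta> by (simp add: S2_def delta_def)
      ultimately show "cmod (?P $$ (i, j) - X $$ (i, j)) \<le> 2 * \<eta>"
        using norm_triangle_ineq[of "?P $$ (i, j) - S2 $$ (i, j)" "S2 $$ (i, j) - X $$ (i, j)"] by simp
    next
      show "0 \<le> 2 * \<eta>" using \<eta> by simp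
      show "real n * (2 * \<eta>) \<le> 1 / 2" using bounds(4) by (simp add: r_def)
      show "2 * real n * (2 * \<eta>) * (1 + real n * 5) \<le> ?\<delta>" unfolding \<delta> using bounds(5) by (simp add: r_def)
    qed
    moreover have "membership_answer (int N) f z = Num 1"
      using True unfolding ans bool_data_def by (simp only: if_True simp_thms)
    ultimately show ?thesis by blast
  next
    case False
    have "X \<notin> sep_states_minus d1 d2 ?\<delta>"
    proof
      assume "X \<in> sep_states_minus d1 d2 ?\<delta>"
      then have Xs: "X \<in> sep_cone d1 d2" unfolding sep_states_minus_def sep_states_def by blast
      have Xp: "psd_form n (entry X)" using sep_cone_psd_form[OF Xs] by (simp add: n_def)
      have X1: "cmod (X $$ (i, j)) \<le> 1" if "i < n" "j < n" for i j
      proof -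
        have "(\<Sum>k<n. Re (X $$ (k, k))) = Re (mat_trace X)" using Xc by (simp add: mat_trace_def)
        then show ?thesis using psd_form_entry_le_trace[OF Xp that] trX by simp
      qed
      have Xm: "psd_form n (\<lambda>x y. b x y - delta x y)"
      proof (rule psd_form_cong[OF _ psd_form_scale[OF Xp, of "1 / r ^ 3"]])
        fix x y show "complex_of_real (1 / r ^ 3) * X $$ (x, y) = b x y - delta x y" by (simp add: b_def)
      qed (use m in simp)
      have "S1 \<in> sep_cone (n * 2) 2"
        by (rule test_form_separable[OF Xm S1c]) (simp add: S1_def)
      then have "mat_close (Num k) (psd_instance z) ?q1"
      proof (rule mat_close_complete[OF f d' c1 _ k(1)])
        fix i j assume ij: "i < n * 2 * 2" "j < n * 2 * 2"
        then have ij4: "i div 4 < n" "j div 4 < n"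
          unfolding n44 by (blast intro: less_mult_imp_div_less)+
        have "cmod (X $$ (i div 4, j div 4) / complex_of_real (r ^ 3)) \<le> 1 / r ^ 3"
          using X1[OF ij4] m by (simp add: norm_divide divide_right_mono del: of_real_power)
        from order_trans[OF this bounds(7)]
        have "cmod (X $$ (i div 4, j div 4) / complex_of_real (r ^ 3)) \<le> 1" .
        moreover have delta_le: "cmod (delta (i div 4) (j div 4)) \<le> 1" by (simp add: delta_def)
        ultimately have "cmod (b (i div 4) (j div 4)) \<le> 2"
          unfolding b_def by (rule norm_two_terms)
        then show "cmod (S1 $$ (i, j)) \<le> 2"
          using ij delta_le by (simp add: S1_def test_form_def block_pattern_def)
      qed
      moreover have "S2 \<in> sep_cone d1 d2"
        by (rule sep_cone_add_identity[OF Xs, of \<eta>]) (use \<eta> in \<open>simp_all add: S2_def n_def\<close>)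
      then have "mat_close (Num k) (sep_instance (int N) z) ?q2"
      proof (rule mat_close_complete[OF f d c2 _ k(1)])
        fix i j assume "i < d1 * d2" "j < d1 * d2"
        then have ij: "i < n" "j < n" by (simp_all add: n_def)
        have "cmod (complex_of_real \<eta> * delta i j) \<le> 1" using \<eta> bounds(6) by (simp add: delta_def)
        from norm_two_terms[OF X1[OF ij] this]
        have "cmod (X $$ (i, j) + complex_of_real \<eta> * delta i j) \<le> 2" .
        then show "cmod (S2 $$ (i, j)) \<le> 2" using ij by (simp add: S2_def)
      qed
      ultimately show False using False by blast
    qed
    moreover have "membership_answer (int N) f z = Num 0"
      using False unfolding ans bool_data_def by (simp only: if_False)
    ultimately show ?thesis by blast
  qed
qed

theorem theorem4:
  assumes gharibian:
    "\<exists>C > 0. \<forall>\<delta> :: nat \<Rightarrow> nat \<Rightarrow> real.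
       (\<forall>d1 d2. d1 \<ge> d2 \<and> d2 \<ge> 2 \<longrightarrow>
          0 < \<delta> d1 d2 \<and> \<delta> d1 d2 \<le> C * real d1 powr (- 16) * real d2 powr (- 20.5)) \<longrightarrow>
       NP_hard (weak_membership \<delta>)"
  shows "NP_hard sep_approximation"
proof -
  from gharibian obtain C where C: "C > 0" and hard: "\<forall>\<delta> :: nat \<Rightarrow> nat \<Rightarrow> real.
      (\<forall>d1 d2. d1 \<ge> d2 \<and> d2 \<ge> 2 \<longrightarrow>
        0 < \<delta> d1 d2 \<and> \<delta> d1 d2 \<le> C * real d1 powr (- 16) * real d2 powr (- 20.5)) \<longrightarrow>
      NP_hard (weak_membership \<delta>)" by (elim exE conjE)
  \<comment> \<open>The constant \<open>C\<close> enters the reduction only through the integer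
    \<open>N\<close>, which is built into the program.\<close>
  obtain N :: nat where N: "1 / C < real N" using reals_Archimedean2 by blast
  moreover have "0 < 1 / C" using C by simp
  ultimately have N0: "0 < N" by (metis gr0I less_asym of_nat_0)
  \<comment> \<open>The common exponent 21 is an integer and at least 16 and 20.5. The tolerance is
    thus the reciprocal of an integer multiple of a power of n, in step with the precisions that the
    program computes by multiplication.\<close>
  have "NP_hard (weak_membership (\<lambda>d1 d2. 1 / (real N * (real d1 * real d2) ^ 21)))"
  proof (rule hard[rule_format], elim conjE, intro conjI)
    fix d1 d2 :: nat assume d: "d1 \<ge> d2" "d2 \<ge> 2"
    then show "0 < 1 / (real N * (real d1 * real d2) ^ 21)" using N0 by simp
    have "1 / real N \<le> C" using N C N0 by (simp add: field_simps)
    moreover have "real d1 powr (- 21) \<le> real d1 powr (- 16)" "real d2 powr (- 21) \<le> real d2 powr (- 20.5)"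
      using d by (intro powr_mono; simp)+
    ultimately have "1 / real N * real d1 powr (- 21) * real d2 powr (- 21)
        \<le> C * real d1 powr (- 16) * real d2 powr (- 20.5)"
      using C by (intro mult_mono) auto
    moreover have "1 / real N * real d1 powr (- 21) * real d2 powr (- 21) = 1 / (real N * (real d1 * real d2) ^ 21)"
    proof -
      have powr_eq: "real e powr (- 21) = inverse (real e ^ 21)" if "2 \<le> e" for e :: nat
        using that by (simp only: powr_minus) (simp add: powr_numeral)
      have "2 \<le> d1" using d by simp
      show ?thesis
        unfolding powr_eq[OF \<open>2 \<le> d1\<close>] powr_eq[OF d(2)] power_mult_distrib by (simp add: divide_inverse)
    qed
    ultimately show "1 / (real N * (real d1 * real d2) ^ 21) \<le> C * real d1 powr (- 16) * real d2 powr (- 20.5)"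
      by (simp only:)
  qed
  then obtain L where "NP_complete L"
    "turing_reducible L (weak_membership (\<lambda>d1 d2. 1 / (real N * (real d1 * real d2) ^ 21)))"
    unfolding NP_hard_def by blast
  then show ?thesis
    unfolding NP_hard_def
    using turing_reducible_trans[OF _ computable_membership_answer membership_answer_valid[OF N0], of L]
    by blast
qed

end
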